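(* Let $(X^{(d)})_{d\in\mathbb{N}}$ be random vectors, $X^{(d)}$ taking values in $\mathbb{R}^d\subset\ell^2$, and for each $d$ let $(X^{(d)}_i)_{i\in\mathbb{N}}$ be independent copies of $X^{(d)}$. Put $S^{(d)}_0=0$, $S^{(d)}_k=X^{(d)}_1+\cdots+X^{(d)}_k$, and $\Theta^{(d)}_i=X_i^{(d)}/\|X_i^{(d)}\|_2$. Let $n=n(d)$ be positive integers with $n(d)\to\infty$ as $d\to\infty$. Assume that there exist positive constants $(a(k))_{k\in\mathbb{N}}$ and a measure $\nu$ on $(0,\infty]$ with $\int_{(0,\infty)}\min(1,x)\,\nu(\mathrm{d}x)<\infty$ and $\nu(\{\infty\})=0$ such that the following hold. (a) As $d\to\infty$, $n\,\mathbb{P}\{(a(n))^{-1}\|X^{(d)}\|_2^2\in\cdot\}\to\nu(\cdot)$ vaguely on $(0,\infty]$, and $$\lim_{s\to0+}\limsup_{d\to\infty}\frac{n}{a(n)}\mathbb{E}\left(\|X^{(d)}\|_2^2\,\mathbf 1_{\{\|X^{(d)}\|_2^2\le s a(n)\}}\right)=0.$$ (b) For all fixed $s>0$ and $\varepsilon>0$, $$\lim_{d\to\infty}\mathbb{P}\left\{\left|\langle\Theta^{(d)}_1,\Theta^{(d)}_2\rangle_2\right|>\varepsilon\;\Big|\;\|X_1^{(d)}\|_2^2\ge s a(n),\ \|X_2^{(d)}\|_2^2\ge s a(n)\right\}=0.$$ (c) $$\lim_{s\to0+}\limsup_{d\to\infty}\frac{n}{\sqrt{a(n)}}\left\|\mathbb{E}\left(X^{(d)}\mathbf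 1_{\{\|X^{(d)}\|_2^2\le s a(n)\}}\right)\right\|_2=0.$$ Fix $T>0$ and let $\mathcal{M}^{(d)}_{\lfloor nT\rfloor}=\{S^{(d)}_k/\sqrt{a(n)}:\ k=0,1,\ldots,\lfloor nT\rfloor\}$. Then, as $d\to\infty$, the random compact metric spaces $(\mathcal{M}^{(d)}_{\lfloor nT\rfloor},\rho_2)$ converge in distribution (weakly), as random elements of the Gromov--Hausdorff space, to $(\mathcal{R}_\nu(T),\rho_2)$, where $\mathcal{R}_\nu(T)$ is the range on $[0,T]$ of a crinkled subordinator with Lévy measure $\nu$.
   Context: $\ell^2$ is the real Hilbert space of square-summable sequences with norm $\|\cdot\|_2$, inner product $\langle\cdot,\cdot\rangle_2$, metric $\rho_2(x,y)=\|x-y\|_2$ and standard orthonormal basis $(e_k)_{k\in\mathbb{N}}$; $\mathbb{R}^d$ is identified with the linear span of $e_1,\ldots,e_d$. All finite or compact subsets of $\ell^2$ are given the induced metric $\rho_2$. Vague convergence on $(0,\infty]$ means convergence of integrals of continuous functions with compact support in $(0,\infty]$ (compact sets being contained in some $[\delta,\infty]$, $\delta>0$). A conditional probability given an event of probability zero is taken to be $0$. Crinkled subordinator: let $\mathcal{P}=\sum_k\delta_{(x_k,y_k)}$ be a Poisson random measure on $[0,\infty)\times(0,\infty]$ with intensity measure Lebesgue $\times\,\nu$, with atoms enumerated (measurably) by indices $k\in\mathbb{N}$. The crinkled subordinator with Lévy measure $\nu$ is the $\ell^2$-valued process $\mathcal{C}_\nu(t)=\sum_{k:\,x_k\le t}e_k\sqrt{y_k}$,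 $t\ge0$. Its range on $[0,T]$ is $\mathcal{R}_\nu(T)$, the closure in $\ell^2$ of $\{\mathcal{C}_\nu(t):0\le t\le T\}$; it is a.s. compact. The measure $\nu$ may be finite. The Gromov--Hausdorff space is the complete separable metric space of isometry classes of (non-empty) compact metric spaces with the Gromov--Hausdorff distance $d_{GH}(E_1,E_2)=\inf d_H(\varphi_1(E_1),\varphi_2(E_2))$, the infimum being over all metric spaces $M$ and isometric embeddings $\varphi_i:E_i\to M$, where $d_H$ is the Hausdorff distance in $M$. *)

theory Defs
  imports "HOL-Probability.Probability"
begin

section \<open>The Hilbert space of square-summable sequences\<close>

lemma summable_l2_mult:
  fixes x y :: "nat \<Rightarrow> real"
  assumes "summable (\<lambda>k. (x k)\<^sup>2)" "summable (\<lambda>k. (y k)\<^sup>2)"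
  shows "summable (\<lambda>k. x k * y k)"
proof (rule summable_comparison_test')
  show "summable (\<lambda>k. (x k)\<^sup>2 + (y k)\<^sup>2)" using assms by (rule summable_add)
  show "norm (x k * y k) \<le> (x k)\<^sup>2 + (y k)\<^sup>2" if "k \<ge> 0" for k
  proof -
    have "2 * (\<bar>x k\<bar> * \<bar>y k\<bar>) \<le> (x k)\<^sup>2 + (y k)\<^sup>2"
      using sum_squares_bound[of "\<bar>x k\<bar>" "\<bar>y k\<bar>"] by simp
    moreover have "0 \<le> \<bar>x k\<bar> * \<bar>y k\<bar>" by simp
    ultimately show ?thesis by (simp only: real_norm_def abs_mult)
  qed
qed

lemma summable_l2_add:
  fixes x y :: "nat \<Rightarrow> real"
  assumes "summable (\<lambda>k. (x k)\<^sup>2)" "summable (\<lambda>k. (y k)\<^sup>2)"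
  shows "summable (\<lambda>k. (x k + y k)\<^sup>2)"
proof -
  have "summable (\<lambda>k. (x k)\<^sup>2 + (y k)\<^sup>2 + 2 * (x k * y k))"
    by (intro summable_add summable_mult summable_l2_mult assms)
  then show ?thesis by (simp add: power2_sum mult.assoc)
qed

typedef l2 = "{x :: nat \<Rightarrow> real. summable (\<lambda>k. (x k)\<^sup>2)}"
  morphisms l2_nth Abs_l2
  by (rule exI[of _ "\<lambda>_. 0"]) simp

setup_lifting type_definition_l2

lemma summable_l2_nth: "summable (\<lambda>k. (l2_nth x k)\<^sup>2)"
  using l2_nth[of x] by simp

lemma l2_eqI: "(\<And>k. l2_nth x k = l2_nth y k) \<Longrightarrow> x = y"
  by (simp add: l2_nth_inject[symmetric] fun_eq_iff)

instantiation l2 :: real_vector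
begin

lift_definition zero_l2 :: l2 is "\<lambda>_. 0" by simp
lift_definition plus_l2 :: "l2 \<Rightarrow> l2 \<Rightarrow> l2" is "\<lambda>x y k. x k + y k"
  by (rule summable_l2_add)
lift_definition uminus_l2 :: "l2 \<Rightarrow> l2" is "\<lambda>x k. - x k" by simp
lift_definition minus_l2 :: "l2 \<Rightarrow> l2 \<Rightarrow> l2" is "\<lambda>x y k. x k - y k"
  using summable_l2_add[where y = "\<lambda>k. - y k" for y] by simp
lift_definition scaleR_l2 :: "real \<Rightarrow> l2 \<Rightarrow> l2" is "\<lambda>c x k. c * x k"
  by (simp add: power_mult_distrib summable_mult)

instance
  by standard (transfer; simp add: algebra_simps fun_eq_iff)+

end

lemma l2_nth_simps [simp]:
  "l2_nth 0 k = 0" "l2_nth (x + y) k = l2_nth x k + l2_nth y k"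
  "l2_nth (- x) k = - l2_nth x k" "l2_nth (x - y) k = l2_nth x k - l2_nth y k"
  "l2_nth (c *\<^sub>R x) k = c * l2_nth x k"
  by (transfer; simp)+

lemma l2_nth_sum [simp]: "l2_nth (sum f A) k = (\<Sum>i\<in>A. l2_nth (f i) k)"
  by (induction A rule: infinite_finite_induct) auto

instantiation l2 :: real_inner
begin

definition inner_l2 :: "l2 \<Rightarrow> l2 \<Rightarrow> real"
  where "inner_l2 x y = (\<Sum>k. l2_nth x k * l2_nth y k)"
definition norm_l2 :: "l2 \<Rightarrow> real"
  where "norm_l2 x = sqrt (\<Sum>k. (l2_nth x k)\<^sup>2)"
definition sgn_l2 :: "l2 \<Rightarrow> l2" where "sgn_l2 x = x /\<^sub>R norm x"
definition dist_l2 :: "l2 \<Rightarrow> l2 \<Rightarrow> real" where "dist_l2 x y = norm (x - y)"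
definition uniformity_l2 :: "(l2 \<times> l2) filter"
  where "uniformity_l2 = (INF e\<in>{0<..}. principal {(x, y). dist x y < e})"
definition open_l2 :: "l2 set \<Rightarrow> bool"
  where "open_l2 U = (\<forall>x\<in>U. eventually (\<lambda>(x', y). x' = x \<longrightarrow> y \<in> U) uniformity)"

instance
proof
  fix x y z :: l2 and r :: real
  have s: "summable (\<lambda>k. l2_nth x k * l2_nth y k)" for x y
    by (intro summable_l2_mult summable_l2_nth)
  show "sgn x = x /\<^sub>R norm x" by (rule sgn_l2_def)
  show "dist x y = norm (x - y)" by (rule dist_l2_def)
  show "inner x y = inner y x" by (simp add: inner_l2_def mult.commute)
  show "inner (x + y) z = inner x z + inner y z"
    by (simp add: inner_l2_def distrib_right suminf_add[OF s s])
  show "inner (r *\<^sub>R x) y = r * inner x y"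
    by (simp add: inner_l2_def mult.assoc suminf_mult[OF s])
  show "0 \<le> inner x x"
    unfolding inner_l2_def by (rule suminf_nonneg[OF s]) simp
  show "inner x x = 0 \<longleftrightarrow> x = 0"
    unfolding inner_l2_def by (subst suminf_eq_zero_iff[OF s]) (auto intro!: l2_eqI)
  show "norm x = sqrt (inner x x)"
    by (simp add: norm_l2_def inner_l2_def power2_eq_square)
qed (fact uniformity_l2_def open_l2_def)+

end

lemma norm_l2_sums: "(\<lambda>k. (l2_nth x k)\<^sup>2) sums (norm x)\<^sup>2"
  by (simp add: norm_l2_def suminf_nonneg summable_l2_nth summable_sums)

lemma sum_le_norm_l2: "finite A \<Longrightarrow> (\<Sum>k\<in>A. (l2_nth x k)\<^sup>2) \<le> (norm x)\<^sup>2"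
  using sum_le_suminf[OF summable_l2_nth, of A x] sums_unique[OF norm_l2_sums[of x]] by simp

lemma l2_nth_le_norm: "\<bar>l2_nth x k\<bar> \<le> norm x"
  using sum_le_norm_l2[of "{k}" x] by (simp add: abs_le_square_iff[symmetric])

lemma norm_l2_leI:
  assumes "\<And>n. (\<Sum>k<n. (f k)\<^sup>2) \<le> C\<^sup>2" "0 \<le> C"
  shows "summable (\<lambda>k. (f k)\<^sup>2) \<and> norm (Abs_l2 f) \<le> C"
proof
  show s: "summable (\<lambda>k. (f k)\<^sup>2)"
    by (rule summableI_nonneg_bounded[where x = "C\<^sup>2"]) (use assms in auto)
  have "(\<Sum>k. (f k)\<^sup>2) \<le> C\<^sup>2"
    by (rule suminf_le_const[OF s assms(1)])
  then show "norm (Abs_l2 f) \<le> C"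
    using s \<open>0 \<le> C\<close> by (simp add: norm_l2_def Abs_l2_inverse real_le_lsqrt)
qed

instance l2 :: banach
proof
  fix X :: "nat \<Rightarrow> l2" assume X: "Cauchy X"
  have "Cauchy (\<lambda>n. l2_nth (X n) k)" for k
  proof (rule metric_CauchyI)
    fix e :: real assume "0 < e"
    then obtain M where "\<And>m n. m \<ge> M \<Longrightarrow> n \<ge> M \<Longrightarrow> norm (X m - X n) < e"
      using X unfolding Cauchy_def dist_norm by blast
    moreover have "dist (l2_nth (X m) k) (l2_nth (X n) k) \<le> norm (X m - X n)" for m n
      using l2_nth_le_norm[of "X m - X n" k] by (simp add: dist_real_def)
    ultimately show "\<exists>M. \<forall>m\<ge>M. \<forall>n\<ge>M. dist (l2_nth (X m) k) (l2_nth (X n) k) < e"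
      by (meson le_less_trans)
  qed
  then have "\<exists>l. (\<lambda>n. l2_nth (X n) k) \<longlonglongrightarrow> l" for k
    by (simp add: Cauchy_convergent_iff convergent_def)
  then obtain f where f: "\<And>k. (\<lambda>n. l2_nth (X n) k) \<longlonglongrightarrow> f k" by metis
  have key: "\<exists>M. \<forall>m\<ge>M. summable (\<lambda>k. (l2_nth (X m) k - f k)\<^sup>2) \<and>
      norm (Abs_l2 (\<lambda>k. l2_nth (X m) k - f k)) \<le> e" if e: "0 < e" for e
  proof -
    obtain M where M: "\<And>m n. m \<ge> M \<Longrightarrow> n \<ge> M \<Longrightarrow> norm (X m - X n) < e"
      using X e unfolding Cauchy_def dist_norm by blast
    show ?thesis
    proof (intro exI allI impI norm_l2_leI)
      fix m N assume m: "m \<ge> M"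
      have "(\<lambda>n. \<Sum>k<N. (l2_nth (X m) k - l2_nth (X n) k)\<^sup>2)
          \<longlonglongrightarrow> (\<Sum>k<N. (l2_nth (X m) k - f k)\<^sup>2)"
        by (intro tendsto_intros f)
      moreover have "\<exists>M. \<forall>n\<ge>M. (\<Sum>k<N. (l2_nth (X m) k - l2_nth (X n) k)\<^sup>2) \<le> e\<^sup>2"
      proof (intro exI allI impI)
        fix n assume "n \<ge> M"
        have "(\<Sum>k<N. (l2_nth (X m - X n) k)\<^sup>2) \<le> (norm (X m - X n))\<^sup>2"
          by (rule sum_le_norm_l2) simp
        also have "\<dots> \<le> e\<^sup>2"
          using M[OF m \<open>n \<ge> M\<close>] by (intro power_mono) auto
        finally show "(\<Sum>k<N. (l2_nth (X m) k - l2_nth (X n) k)\<^sup>2) \<le> e\<^sup>2" by simp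
      qed
      ultimately show "(\<Sum>k<N. (l2_nth (X m) k - f k)\<^sup>2) \<le> e\<^sup>2"
        by (rule LIMSEQ_le_const2)
    qed (use e in simp)
  qed
  obtain M where "summable (\<lambda>k. (l2_nth (X M) k - f k)\<^sup>2)"
    using key[of 1] by auto
  from summable_l2_add[OF summable_l2_nth[of "X M"], of "\<lambda>k. - (l2_nth (X M) k - f k)"] this
  have "summable (\<lambda>k. (f k)\<^sup>2)" by (simp add: power2_commute)
  then have L: "l2_nth (Abs_l2 f) = f" by (simp add: Abs_l2_inverse)
  have D: "Abs_l2 (\<lambda>k. l2_nth (X m) k - f k) = X m - Abs_l2 f" for m
    by (subst L[symmetric]) (simp only: l2_nth_simps(4)[symmetric] l2_nth_inverse)
  have "X \<longlonglongrightarrow> Abs_l2 f"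
  proof (rule LIMSEQ_I)
    fix r :: real assume "0 < r"
    then obtain M where "\<forall>m\<ge>M. norm (X m - Abs_l2 f) \<le> r / 2"
      using key[of "r / 2"] unfolding D by auto
    then show "\<exists>M. \<forall>m\<ge>M. norm (X m - Abs_l2 f) < r"
      using \<open>0 < r\<close> by (intro exI[of _ M]) fastforce
  qed
  then show "convergent X" by (auto simp: convergent_def)
qed

text \<open>Coordinates are indexed from \<open>0\<close>: the standard basis is \<open>l2_basis 0, l2_basis 1, \<dots>\<close>,
  and \<open>\<real>\<^sup>d\<close> is the span of the first \<open>d\<close> basis vectors.\<close>

lift_definition l2_basis :: "nat \<Rightarrow> l2" is "\<lambda>k i. if i = k then 1 else 0"
  by (rule summable_finite[of "{k}" for k]) auto

definition l2_coord_space :: "nat \<Rightarrow> l2 set"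
  where "l2_coord_space d = span (l2_basis ` {..<d})"

lemma l2_nth_basis [simp]: "l2_nth (l2_basis k) i = (if i = k then 1 else 0)"
  by transfer simp

lemma norm_l2_basis [simp]: "norm (l2_basis k) = 1"
proof -
  have "(\<lambda>i. (l2_nth (l2_basis k) i)\<^sup>2) = (\<lambda>i. if i = k then 1 else 0)"
    by (simp add: fun_eq_iff)
  then have "(norm (l2_basis k))\<^sup>2 = 1"
    using norm_l2_sums[of "l2_basis k"] sums_single[of k "\<lambda>_. 1::real"]
    by (metis sums_unique2)
  then show ?thesis by (simp add: power2_eq_1_iff) (metis norm_ge_zero not_one_le_zero neg_0_le_iff_le)
qed

lemma l2_basis_tendsto: "(\<lambda>N. \<Sum>k<N. l2_nth x k *\<^sub>R l2_basis k) \<longlonglongrightarrow> x"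
proof -
  have "(norm (x - (\<Sum>k<N. l2_nth x k *\<^sub>R l2_basis k)))\<^sup>2
      = (norm x)\<^sup>2 - (\<Sum>k<N. (l2_nth x k)\<^sup>2)" for N
  proof -
    let ?y = "x - (\<Sum>k<N. l2_nth x k *\<^sub>R l2_basis k)"
    have y: "l2_nth ?y i = (if i < N then 0 else l2_nth x i)" for i
      by (simp add: if_distrib cong: if_cong)
    have "(\<lambda>i. (l2_nth ?y i)\<^sup>2) = (\<lambda>i. (l2_nth x i)\<^sup>2 - (if i \<in> {..<N} then (l2_nth x i)\<^sup>2 else 0))"
      by (simp only: y fun_eq_iff) auto
    moreover have "(\<lambda>i. (l2_nth x i)\<^sup>2 - (if i \<in> {..<N} then (l2_nth x i)\<^sup>2 else 0))
        sums ((norm x)\<^sup>2 - (\<Sum>k<N. (l2_nth x k)\<^sup>2))"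
      by (intro sums_diff norm_l2_sums sums_If_finite_set) simp
    ultimately show ?thesis
      using norm_l2_sums[of ?y] sums_unique2 by metis
  qed
  moreover have "(\<lambda>N. (norm x)\<^sup>2 - (\<Sum>k<N. (l2_nth x k)\<^sup>2)) \<longlonglongrightarrow> (norm x)\<^sup>2 - (norm x)\<^sup>2"
    by (intro tendsto_intros norm_l2_sums[unfolded sums_def])
  ultimately have "(\<lambda>N. (norm (x - (\<Sum>k<N. l2_nth x k *\<^sub>R l2_basis k)))\<^sup>2) \<longlonglongrightarrow> 0"
    by simp
  then have "(\<lambda>N. sqrt ((norm (x - (\<Sum>k<N. l2_nth x k *\<^sub>R l2_basis k)))\<^sup>2)) \<longlonglongrightarrow> sqrt 0"
    by (rule tendsto_real_sqrt)
  then have "(\<lambda>N. norm ((\<Sum>k<N. l2_nth x k *\<^sub>R l2_basis k) - x)) \<longlonglongrightarrow> 0"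
    by (simp add: norm_minus_commute)
  then show ?thesis
    using Lim_null tendsto_norm_zero_iff by blast
qed

instance l2 :: polish_space
proof
  define D :: "l2 set"
    where "D = range (\<lambda>q :: rat list. \<Sum>k<length q. of_rat (q ! k) *\<^sub>R l2_basis k)"
  have D: "\<exists>y\<in>D. dist x y < e" if e: "0 < e" for x :: l2 and e :: real
  proof -
    obtain N where N: "norm ((\<Sum>k<N. l2_nth x k *\<^sub>R l2_basis k) - x) < e / 2"
      using LIMSEQ_D[OF l2_basis_tendsto[of x], of "e / 2"] e by auto
    have "\<exists>q :: rat. \<bar>of_rat q - l2_nth x k\<bar> < e / (2 * (real N + 1))" for k
    proof -
      have "0 < e / (2 * (real N + 1))" using e by (intro divide_pos_pos) auto
      then obtain q where "l2_nth x k < of_rat q" "of_rat q < l2_nth x k + e / (2 * (real N + 1))"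
        using of_rat_dense[of "l2_nth x k" "l2_nth x k + e / (2 * (real N + 1))"] by auto
      then show ?thesis by (intro exI[of _ q]) linarith
    qed
    then obtain q :: "nat \<Rightarrow> rat"
      where q: "\<And>k. \<bar>of_rat (q k) - l2_nth x k\<bar> < e / (2 * (real N + 1))" by metis
    let ?y = "\<Sum>k<N. of_rat (q k) *\<^sub>R l2_basis k"
    have "norm (?y - (\<Sum>k<N. l2_nth x k *\<^sub>R l2_basis k))
        = norm (\<Sum>k<N. (of_rat (q k) - l2_nth x k) *\<^sub>R l2_basis k)"
      by (simp add: scaleR_left_diff_distrib sum_subtractf)
    also have "\<dots> \<le> (\<Sum>k<N. e / (2 * (real N + 1)))"
      by (rule sum_norm_le) (use q in \<open>simp add: less_imp_le\<close>)
    also have "\<dots> \<le> e / 2"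
      using e by (simp add: field_simps)
    finally have "norm (?y - x) < e"
      using N norm_triangle_ineq[of "?y - (\<Sum>k<N. l2_nth x k *\<^sub>R l2_basis k)"
          "(\<Sum>k<N. l2_nth x k *\<^sub>R l2_basis k) - x"] by simp
    moreover have "?y \<in> D"
      unfolding D_def by (intro image_eqI[of _ _ "map q [0..<N]"]) simp_all
    ultimately show ?thesis by (auto simp: dist_norm norm_minus_commute)
  qed
  define B where "B = (\<lambda>(y, n). ball y (1 / real (Suc n))) ` (D \<times> (UNIV :: nat set))"
  have "countable B" unfolding B_def D_def by auto
  moreover have "topological_basis B"
  proof (rule topological_basisI)
    show "\<And>b. b \<in> B \<Longrightarrow> open b" by (auto simp: B_def)
  next
    fix U :: "l2 set" and x assume "open U" "x \<in> U"
    then obtain e where e: "0 < e" "ball x e \<subseteq> U" by (auto simp: open_contains_ball)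
    then obtain n where n: "1 / real (Suc n) < e / 2"
      using nat_approx_posE[of "e / 2"] by auto
    obtain y where y: "y \<in> D" "dist x y < 1 / real (Suc n)" using D[of "1 / real (Suc n)" x] by auto
    have "ball y (1 / real (Suc n)) \<subseteq> ball x e"
    proof
      fix z assume "z \<in> ball y (1 / real (Suc n))"
      then show "z \<in> ball x e" using y n dist_triangle[of x z y] by auto
    qed
    with y e show "\<exists>b\<in>B. x \<in> b \<and> b \<subseteq> U"
      by (intro bexI[of _ "ball y (1 / real (Suc n))"]) (auto simp: B_def dist_commute)
  qed
  ultimately show "\<exists>B :: l2 set set. countable B \<and> open = generate_topology B"
    using topological_basis_imp_subbasis by blast
qed

section \<open>The Gromov--Hausdorff space\<close>

definition isometric_embedding :: "'a metric \<Rightarrow> 'b metric \<Rightarrow> ('a \<Rightarrow> 'b) \<Rightarrow> bool"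
  where "isometric_embedding m1 m2 \<phi> \<longleftrightarrow> \<phi> \<in> mspace m1 \<rightarrow> mspace m2 \<and>
    (\<forall>x\<in>mspace m1. \<forall>y\<in>mspace m1. mdist m2 (\<phi> x) (\<phi> y) = mdist m1 x y)"

definition isometric_to :: "'a metric \<Rightarrow> 'b metric \<Rightarrow> bool"
  where "isometric_to m1 m2 \<longleftrightarrow>
    (\<exists>\<phi>. isometric_embedding m1 m2 \<phi> \<and> \<phi> ` mspace m1 = mspace m2)"

definition hausdorff_dist :: "'a metric \<Rightarrow> 'a set \<Rightarrow> 'a set \<Rightarrow> real"
  where "hausdorff_dist m A B =
    max (SUP a\<in>A. INF b\<in>B. mdist m a b) (SUP b\<in>B. INF a\<in>A. mdist m a b)"

text \<open>The infimum defining the Gromov--Hausdorff distance is over all metric spaces \<open>M\<close> with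
  isometric embeddings of the two spaces. Only the union of the two images matters, and
  this union always injects into the disjoint sum, so it suffices to let \<open>M\<close> range over the
  metric spaces whose points are taken from the type \<open>'a + 'b\<close>.\<close>

definition gh_distances :: "'a metric \<Rightarrow> 'b metric \<Rightarrow> real set"
  where "gh_distances m1 m2 =
    {hausdorff_dist M (\<phi>1 ` mspace m1) (\<phi>2 ` mspace m2) | (M :: ('a + 'b) metric) \<phi>1 \<phi>2.
       isometric_embedding m1 M \<phi>1 \<and> isometric_embedding m2 M \<phi>2}"

definition gh_dist :: "'a metric \<Rightarrow> 'b metric \<Rightarrow> real"
  where "gh_dist m1 m2 = Inf (gh_distances m1 m2)"

definition nonempty_compact :: "'a metric \<Rightarrow> bool"
  where "nonempty_compact m \<longleftrightarrow> compact_space (mtopology_of m) \<and> mspace m \<noteq> {}"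

lemma mdist_self: "x \<in> mspace m \<Longrightarrow> mdist m x x = 0"
  by simp

lemma isometric_to_refl: "isometric_to m m"
  by (auto simp: isometric_to_def isometric_embedding_def intro!: exI[of _ "\<lambda>x. x"])

lemma isometric_to_sym:
  assumes "isometric_to m1 m2" shows "isometric_to m2 m1"
proof -
  obtain \<phi> where \<phi>: "isometric_embedding m1 m2 \<phi>" "\<phi> ` mspace m1 = mspace m2"
    using assms by (auto simp: isometric_to_def)
  let ?\<psi> = "inv_into (mspace m1) \<phi>"
  have \<psi>: "?\<psi> y \<in> mspace m1" "\<phi> (?\<psi> y) = y" if "y \<in> mspace m2" for y
    using that \<phi>(2) by (auto intro: inv_into_into f_inv_into_f)
  have inj: "x = x'" if "x \<in> mspace m1" "x' \<in> mspace m1" "\<phi> x = \<phi> x'" for x x'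
    using \<phi> that unfolding isometric_embedding_def
    by (metis mdist_zero imageI)
  have "?\<psi> ` mspace m2 = mspace m1"
  proof
    show "mspace m1 \<subseteq> ?\<psi> ` mspace m2"
    proof
      fix x assume x: "x \<in> mspace m1"
      then have "\<phi> x \<in> mspace m2" using \<phi>(2) by auto
      with x \<psi> inj show "x \<in> ?\<psi> ` mspace m2" by (metis imageI)
    qed
  qed (use \<psi> in auto)
  moreover have "isometric_embedding m2 m1 ?\<psi>"
    unfolding isometric_embedding_def
    using \<phi>(1) \<psi> unfolding isometric_embedding_def by (metis Pi_I)
  ultimately show ?thesis unfolding isometric_to_def by blast
qed

lemma isometric_embedding_trans:
  assumes "isometric_embedding m1 m2 \<phi>" "isometric_embedding m2 m3 \<psi>"
  shows "isometric_embedding m1 m3 (\<psi> \<circ> \<phi>)"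
  using assms by (auto simp: isometric_embedding_def Pi_iff)

lemma isometric_to_trans:
  assumes "isometric_to m1 m2" "isometric_to m2 m3" shows "isometric_to m1 m3"
  using assms isometric_embedding_trans unfolding isometric_to_def by (metis image_comp)

lemma nonempty_compact_bounded:
  assumes "nonempty_compact m"
  shows "\<exists>D. \<forall>x\<in>mspace m. \<forall>y\<in>mspace m. mdist m x y \<le> D"
proof -
  interpret Metric_space "mspace m" "mdist m" by simp
  have "compactin mtopology (mspace m)"
    using assms by (simp add: nonempty_compact_def compact_space_def mtopology_of_def)
  then have "mbounded (mspace m)" by (rule compactin_imp_mbounded)
  then show ?thesis by (auto simp: mbounded_alt)
qed

subsection \<open>Cross distances\<close>

text \<open>\<open>gh_couple m1 m2 r \<delta>\<close>: \<open>\<delta>\<close> behaves like the distance between points of \<open>m1\<close> and \<open>m2\<close>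
  placed in a common (pseudo)metric space, at Hausdorff distance at most \<open>r\<close>.\<close>

definition gh_couple :: "'a metric \<Rightarrow> 'b metric \<Rightarrow> real \<Rightarrow> ('a \<Rightarrow> 'b \<Rightarrow> real) \<Rightarrow> bool"
  where "gh_couple m1 m2 r \<delta> \<longleftrightarrow>
    (\<forall>x\<in>mspace m1. \<forall>y\<in>mspace m2. 0 \<le> \<delta> x y) \<and>
    (\<forall>x\<in>mspace m1. \<forall>x'\<in>mspace m1. \<forall>y\<in>mspace m2. mdist m1 x x' \<le> \<delta> x y + \<delta> x' y) \<and>
    (\<forall>x\<in>mspace m1. \<forall>y\<in>mspace m2. \<forall>y'\<in>mspace m2. mdist m2 y y' \<le> \<delta> x y + \<delta> x y') \<and>
    (\<forall>x\<in>mspace m1. \<forall>x'\<in>mspace m1. \<forall>y\<in>mspace m2. \<delta> x y \<le> mdist m1 x x' + \<delta> x' y) \<and>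
    (\<forall>x\<in>mspace m1. \<forall>y\<in>mspace m2. \<forall>y'\<in>mspace m2. \<delta> x y \<le> \<delta> x y' + mdist m2 y' y) \<and>
    (\<forall>x\<in>mspace m1. \<exists>y\<in>mspace m2. \<delta> x y < r) \<and>
    (\<forall>y\<in>mspace m2. \<exists>x\<in>mspace m1. \<delta> x y < r)"

lemma gh_coupleD:
  assumes "gh_couple m1 m2 r \<delta>"
  shows "\<And>x y. x \<in> mspace m1 \<Longrightarrow> y \<in> mspace m2 \<Longrightarrow> 0 \<le> \<delta> x y"
    and "\<And>x x' y. x \<in> mspace m1 \<Longrightarrow> x' \<in> mspace m1 \<Longrightarrow> y \<in> mspace m2 \<Longrightarrow> mdist m1 x x' \<le> \<delta> x y + \<delta> x' y"
    and "\<And>x y y'. x \<in> mspace m1 \<Longrightarrow> y \<in> mspace m2 \<Longrightarrow> y' \<in> mspace m2 \<Longrightarrow> mdist m2 y y' \<le> \<delta> x y + \<delta> x y'"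
    and "\<And>x x' y. x \<in> mspace m1 \<Longrightarrow> x' \<in> mspace m1 \<Longrightarrow> y \<in> mspace m2 \<Longrightarrow> \<delta> x y \<le> mdist m1 x x' + \<delta> x' y"
    and "\<And>x y y'. x \<in> mspace m1 \<Longrightarrow> y \<in> mspace m2 \<Longrightarrow> y' \<in> mspace m2 \<Longrightarrow> \<delta> x y \<le> \<delta> x y' + mdist m2 y' y"
    and "\<And>x. x \<in> mspace m1 \<Longrightarrow> \<exists>y\<in>mspace m2. \<delta> x y < r"
    and "\<And>y. y \<in> mspace m2 \<Longrightarrow> \<exists>x\<in>mspace m1. \<delta> x y < r"
  using assms unfolding gh_couple_def by simp_all

lemma gh_couple_flip: "gh_couple m1 m2 r \<delta> \<Longrightarrow> gh_couple m2 m1 r (\<lambda>y x. \<delta> x y)"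
  unfolding gh_couple_def by (simp add: mdist_commute add.commute)

lemma embedded_bounded:
  assumes m: "nonempty_compact m1" "nonempty_compact m2"
    and \<phi>: "isometric_embedding m1 M \<phi>1" "isometric_embedding m2 M \<phi>2"
  shows "\<exists>D. \<forall>x\<in>mspace m1. \<forall>y\<in>mspace m2. mdist M (\<phi>1 x) (\<phi>2 y) \<le> D"
proof -
  obtain D1 where D1: "\<And>x x'. x \<in> mspace m1 \<Longrightarrow> x' \<in> mspace m1 \<Longrightarrow> mdist m1 x x' \<le> D1"
    using nonempty_compact_bounded[OF m(1)] by auto
  obtain D2 where D2: "\<And>x x'. x \<in> mspace m2 \<Longrightarrow> x' \<in> mspace m2 \<Longrightarrow> mdist m2 x x' \<le> D2"
    using nonempty_compact_bounded[OF m(2)] by auto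
  obtain x0 y0 where 0: "x0 \<in> mspace m1" "y0 \<in> mspace m2"
    using m by (auto simp: nonempty_compact_def)
  have in1: "\<phi>1 x \<in> mspace M" if "x \<in> mspace m1" for x
    using \<phi> that by (auto simp: isometric_embedding_def)
  have in2: "\<phi>2 x \<in> mspace M" if "x \<in> mspace m2" for x
    using \<phi> that by (auto simp: isometric_embedding_def)
  show ?thesis
  proof (intro exI ballI)
    fix x y assume xy: "x \<in> mspace m1" "y \<in> mspace m2"
    have "mdist M (\<phi>1 x) (\<phi>2 y) \<le> mdist M (\<phi>1 x) (\<phi>1 x0) + mdist M (\<phi>1 x0) (\<phi>2 y)"
      using xy 0 in1 in2 by (intro mdist_triangle) auto
    also have "\<dots> \<le> mdist M (\<phi>1 x) (\<phi>1 x0) + (mdist M (\<phi>1 x0) (\<phi>2 y0) + mdist M (\<phi>2 y0) (\<phi>2 y))"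
      using xy 0 in1 in2 by (intro add_left_mono mdist_triangle) auto
    also have "\<dots> \<le> D1 + (mdist M (\<phi>1 x0) (\<phi>2 y0) + D2)"
      using D1[OF xy(1) 0(1)] D2[OF 0(2) xy(2)] \<phi> xy 0 by (auto simp: isometric_embedding_def)
    finally show "mdist M (\<phi>1 x) (\<phi>2 y) \<le> D1 + (mdist M (\<phi>1 x0) (\<phi>2 y0) + D2)" .
  qed
qed

lemma
  assumes m: "nonempty_compact m1" "nonempty_compact m2"
    and \<phi>: "isometric_embedding m1 M \<phi>1" "isometric_embedding m2 M \<phi>2"
  shows hausdorff_dist_nonneg: "0 \<le> hausdorff_dist M (\<phi>1 ` mspace m1) (\<phi>2 ` mspace m2)" (is ?A)
    and hausdorff_dist_less_imp_couple:
      "hausdorff_dist M (\<phi>1 ` mspace m1) (\<phi>2 ` mspace m2) < r \<Longrightarrow>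
        gh_couple m1 m2 r (\<lambda>x y. mdist M (\<phi>1 x) (\<phi>2 y))" (is "_ \<Longrightarrow> ?B")
proof -
  obtain D where D: "\<And>x y. x \<in> mspace m1 \<Longrightarrow> y \<in> mspace m2 \<Longrightarrow> mdist M (\<phi>1 x) (\<phi>2 y) \<le> D"
    using embedded_bounded[OF m \<phi>] by auto
  have ne: "mspace m1 \<noteq> {}" "mspace m2 \<noteq> {}" using m by (auto simp: nonempty_compact_def)
  have in1: "\<phi>1 x \<in> mspace M" if "x \<in> mspace m1" for x
    using \<phi> that by (auto simp: isometric_embedding_def)
  have in2: "\<phi>2 x \<in> mspace M" if "x \<in> mspace m2" for x
    using \<phi> that by (auto simp: isometric_embedding_def)
  have bb: "bdd_below (f ` S)" if "\<And>x. x \<in> S \<Longrightarrow> 0 \<le> f x" for f :: "'z \<Rightarrow> real" and S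
    using that by (intro bdd_belowI2) auto
  have le1: "(INF b\<in>\<phi>2 ` mspace m2. mdist M (\<phi>1 x) b) \<le> hausdorff_dist M (\<phi>1 ` mspace m1) (\<phi>2 ` mspace m2)"
    if x: "x \<in> mspace m1" for x
  proof -
    obtain y0 where y0: "y0 \<in> mspace m2" using ne by auto
    have "bdd_above ((\<lambda>a. INF b\<in>\<phi>2 ` mspace m2. mdist M a b) ` \<phi>1 ` mspace m1)"
    proof (rule bdd_aboveI2)
      fix a assume "a \<in> \<phi>1 ` mspace m1"
      then show "(INF b\<in>\<phi>2 ` mspace m2. mdist M a b) \<le> D"
        using y0 D by (intro cINF_lower2[of _ _ "\<phi>2 y0"] bb) auto
    qed
    then have "(INF b\<in>\<phi>2 ` mspace m2. mdist M (\<phi>1 x) b) \<le>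
        (SUP a\<in>\<phi>1 ` mspace m1. INF b\<in>\<phi>2 ` mspace m2. mdist M a b)"
      using x by (intro cSUP_upper) auto
    then show ?thesis by (simp add: hausdorff_dist_def)
  qed
  have le2: "(INF a\<in>\<phi>1 ` mspace m1. mdist M a (\<phi>2 y)) \<le> hausdorff_dist M (\<phi>1 ` mspace m1) (\<phi>2 ` mspace m2)"
    if y: "y \<in> mspace m2" for y
  proof -
    obtain x0 where x0: "x0 \<in> mspace m1" using ne by auto
    have "bdd_above ((\<lambda>b. INF a\<in>\<phi>1 ` mspace m1. mdist M a b) ` \<phi>2 ` mspace m2)"
    proof (rule bdd_aboveI2)
      fix b assume "b \<in> \<phi>2 ` mspace m2"
      then show "(INF a\<in>\<phi>1 ` mspace m1. mdist M a b) \<le> D"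
        using x0 D by (intro cINF_lower2[of _ _ "\<phi>1 x0"] bb) auto
    qed
    then have "(INF a\<in>\<phi>1 ` mspace m1. mdist M a (\<phi>2 y)) \<le>
        (SUP b\<in>\<phi>2 ` mspace m2. INF a\<in>\<phi>1 ` mspace m1. mdist M a b)"
      using y by (intro cSUP_upper) auto
    then show ?thesis by (simp add: hausdorff_dist_def)
  qed
  show ?A
  proof -
    obtain x0 where x0: "x0 \<in> mspace m1" using ne by auto
    have "0 \<le> (INF b\<in>\<phi>2 ` mspace m2. mdist M (\<phi>1 x0) b)"
      using ne by (intro cINF_greatest) auto
    then show ?thesis using le1[OF x0] by linarith
  qed
  show ?B if r: "hausdorff_dist M (\<phi>1 ` mspace m1) (\<phi>2 ` mspace m2) < r"
    unfolding gh_couple_def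
  proof (intro conjI ballI)
    fix x assume x: "x \<in> mspace m1"
    have "(INF b\<in>\<phi>2 ` mspace m2. mdist M (\<phi>1 x) b) < r" using le1[OF x] r by simp
    then show "\<exists>y\<in>mspace m2. mdist M (\<phi>1 x) (\<phi>2 y) < r"
      using ne by (subst (asm) cINF_less_iff) (auto intro: bb)
  next
    fix y assume y: "y \<in> mspace m2"
    have "(INF a\<in>\<phi>1 ` mspace m1. mdist M a (\<phi>2 y)) < r" using le2[OF y] r by simp
    then show "\<exists>x\<in>mspace m1. mdist M (\<phi>1 x) (\<phi>2 y) < r"
      using ne by (subst (asm) cINF_less_iff) (auto intro: bb)
  next
    fix x x' y assume xy: "x \<in> mspace m1" "x' \<in> mspace m1" "y \<in> mspace m2"
    have e: "mdist M (\<phi>1 x) (\<phi>1 x') = mdist m1 x x'"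
      using \<phi> xy by (auto simp: isometric_embedding_def)
    show "mdist m1 x x' \<le> mdist M (\<phi>1 x) (\<phi>2 y) + mdist M (\<phi>1 x') (\<phi>2 y)"
      using xy in1 in2 mdist_triangle[of "\<phi>1 x" M "\<phi>2 y" "\<phi>1 x'"]
      by (simp add: e mdist_commute[of M "\<phi>2 y"])
    show "mdist M (\<phi>1 x) (\<phi>2 y) \<le> mdist m1 x x' + mdist M (\<phi>1 x') (\<phi>2 y)"
      using xy in1 in2 mdist_triangle[of "\<phi>1 x" M "\<phi>1 x'" "\<phi>2 y"] by (simp add: e)
  next
    fix x y y' assume xy: "x \<in> mspace m1" "y \<in> mspace m2" "y' \<in> mspace m2"
    have e: "mdist M (\<phi>2 y) (\<phi>2 y') = mdist m2 y y'" "mdist M (\<phi>2 y') (\<phi>2 y) = mdist m2 y' y"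
      using \<phi> xy by (auto simp: isometric_embedding_def)
    show "mdist m2 y y' \<le> mdist M (\<phi>1 x) (\<phi>2 y) + mdist M (\<phi>1 x) (\<phi>2 y')"
      using xy in1 in2 mdist_triangle[of "\<phi>2 y" M "\<phi>1 x" "\<phi>2 y'"]
      by (simp add: e mdist_commute[of M "\<phi>2 y" "\<phi>1 x"])
    show "mdist M (\<phi>1 x) (\<phi>2 y) \<le> mdist M (\<phi>1 x) (\<phi>2 y') + mdist m2 y' y"
      using xy in1 in2 mdist_triangle[of "\<phi>1 x" M "\<phi>2 y'" "\<phi>2 y"] by (simp add: e)
  qed auto
qed

text \<open>Conversely, a cross distance glues the two spaces together (\<open>\<eta>\<close> prevents points
  of the two copies from coinciding).\<close>

lemma gh_couple_imp_gh_distances: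
  fixes m1 :: "'a metric" and m2 :: "'b metric"
  assumes c: "gh_couple m1 m2 r \<delta>" and \<eta>: "0 < \<eta>" and ne: "mspace m1 \<noteq> {}" "mspace m2 \<noteq> {}"
  shows "\<exists>h\<in>gh_distances m1 m2. h \<le> r + \<eta>"
proof -
  note c = gh_coupleD[OF c]
  define e where "e x y = \<bar>\<delta> x y\<bar> + \<eta>" for x y
  define d where "d u v = (case u of
      Inl x \<Rightarrow> (case v of Inl x' \<Rightarrow> mdist m1 x x' | Inr y \<Rightarrow> e x y)
    | Inr y \<Rightarrow> (case v of Inl x \<Rightarrow> e x y | Inr y' \<Rightarrow> mdist m2 y y'))" for u v
  have d: "d (Inl x) (Inl x') = mdist m1 x x'" "d (Inl x) (Inr y) = e x y"
    "d (Inr y) (Inl x) = e x y" "d (Inr y) (Inr y') = mdist m2 y y'" for x x' y y'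
    by (simp_all add: d_def)
  define S where "S = Inl ` mspace m1 \<union> Inr ` mspace m2"
  have e: "e x y = \<delta> x y + \<eta>" if "x \<in> mspace m1" "y \<in> mspace m2" for x y
    using c(1)[OF that] by (simp add: e_def)
  have e0: "0 < e x y" for x y using \<eta> by (simp add: e_def)
  interpret Metric_space S d
  proof
    show "0 \<le> d u v" for u v
      by (cases u; cases v) (use e0 in \<open>auto simp: d less_imp_le\<close>)
    show "d u v = d v u" for u v
      by (cases u; cases v) (auto simp: d mdist_commute)
    show "d u v = 0 \<longleftrightarrow> u = v" if "u \<in> S" "v \<in> S" for u v
      using that e0 by (auto simp: S_def d less_le dest!: sym[of "e _ _" 0])
    have t: "e x y \<le> mdist m1 x x' + e x' y" "e x y \<le> e x' y + mdist m1 x' x"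
      "mdist m1 x x' \<le> e x y + e x' y"
      if "x \<in> mspace m1" "x' \<in> mspace m1" "y \<in> mspace m2" for x x' y
      using c(2,4)[OF that] that \<eta> by (simp_all add: e mdist_commute[of m1 x' x])
    have t': "e x y \<le> e x y' + mdist m2 y' y" "e x y \<le> mdist m2 y y' + e x y'"
      "mdist m2 y y' \<le> e x y + e x y'"
      if "x \<in> mspace m1" "y \<in> mspace m2" "y' \<in> mspace m2" for x y y'
      using c(3,5)[OF that] that \<eta> by (simp_all add: e mdist_commute[of m2 y' y])
    show "d u w \<le> d u v + d v w" if "u \<in> S" "v \<in> S" "w \<in> S" for u v w
      using that by (cases u; cases v; cases w) (auto simp: S_def d mdist_triangle t t')
  qed
  define M where "M = metric (S, d)"
  have M: "mspace M = S" "mdist M = d" by (simp_all add: M_def)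
  have emb: "isometric_embedding m1 M Inl" "isometric_embedding m2 M Inr"
    unfolding isometric_embedding_def M by (auto simp: S_def d)
  have bb: "bdd_below (f ` X)" if "\<And>x. x \<in> X \<Longrightarrow> 0 \<le> f x" for f :: "'z \<Rightarrow> real" and X
    using that by (intro bdd_belowI2) auto
  have "hausdorff_dist M (Inl ` mspace m1) (Inr ` mspace m2) \<le> r + \<eta>"
    unfolding hausdorff_dist_def
  proof (intro max.boundedI cSUP_least)
    fix a :: "'a + 'b" assume "a \<in> Inl ` mspace m1"
    then obtain x where x: "a = Inl x" "x \<in> mspace m1" by auto
    then obtain y where y: "y \<in> mspace m2" "\<delta> x y < r" using c(6) by blast
    show "(INF b\<in>Inr ` mspace m2. mdist M a b) \<le> r + \<eta>"
      using x y by (intro cINF_lower2[of _ _ "Inr y"] bb) (auto simp: M d e)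
  next
    fix b :: "'a + 'b" assume "b \<in> Inr ` mspace m2"
    then obtain y where y: "b = Inr y" "y \<in> mspace m2" by auto
    then obtain x where x: "x \<in> mspace m1" "\<delta> x y < r" using c(7) by blast
    show "(INF a\<in>Inl ` mspace m1. mdist M a b) \<le> r + \<eta>"
      using x y by (intro cINF_lower2[of _ _ "Inl x"] bb) (auto simp: M d e)
  qed (use ne in auto)
  then show ?thesis using emb unfolding gh_distances_def by blast
qed

lemma gh_distances_nonneg:
  assumes "nonempty_compact m1" "nonempty_compact m2" "h \<in> gh_distances m1 m2"
  shows "0 \<le> h"
  using assms hausdorff_dist_nonneg unfolding gh_distances_def by blast

lemma gh_couple_imp_gh_dist_le:
  assumes m: "nonempty_compact m1" "nonempty_compact m2" and c: "gh_couple m1 m2 r \<delta>"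
  shows "gh_dist m1 m2 \<le> r"
proof (rule field_le_epsilon)
  fix \<eta> :: real assume "0 < \<eta>"
  then obtain h where "h \<in> gh_distances m1 m2" "h \<le> r + \<eta>"
    using gh_couple_imp_gh_distances[OF c] m by (auto simp: nonempty_compact_def)
  moreover have "bdd_below (gh_distances m1 m2)"
    using gh_distances_nonneg[OF m] by (intro bdd_belowI)
  ultimately show "gh_dist m1 m2 \<le> r + \<eta>"
    unfolding gh_dist_def by (intro cInf_lower2)
qed

lemma gh_distances_nonempty:
  assumes m: "nonempty_compact m1" "nonempty_compact m2"
  shows "gh_distances m1 m2 \<noteq> {}"
proof -
  obtain D1 where D1: "\<And>x x'. x \<in> mspace m1 \<Longrightarrow> x' \<in> mspace m1 \<Longrightarrow> mdist m1 x x' \<le> D1"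
    using nonempty_compact_bounded[OF m(1)] by auto
  obtain D2 where D2: "\<And>x x'. x \<in> mspace m2 \<Longrightarrow> x' \<in> mspace m2 \<Longrightarrow> mdist m2 x x' \<le> D2"
    using nonempty_compact_bounded[OF m(2)] by auto
  obtain x0 y0 where 0: "x0 \<in> mspace m1" "y0 \<in> mspace m2"
    using m by (auto simp: nonempty_compact_def)
  define D where "D = max 0 (max D1 D2)"
  have D: "0 \<le> D" "D1 \<le> D" "D2 \<le> D" by (auto simp: D_def)
  have "gh_couple m1 m2 (D + 1) (\<lambda>_ _. D)"
    unfolding gh_couple_def
  proof (intro conjI ballI)
    show "mdist m1 x x' \<le> D + D" if "x \<in> mspace m1" "x' \<in> mspace m1" for x x'
      using D1[OF that] D by linarith
    show "mdist m2 y y' \<le> D + D" if "y \<in> mspace m2" "y' \<in> mspace m2" for y y'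
      using D2[OF that] D by linarith
  qed (use D 0 in auto)
  from gh_couple_imp_gh_distances[OF this, of 1] 0 show ?thesis by auto
qed

lemma gh_dist_nonneg:
  assumes m: "nonempty_compact m1" "nonempty_compact m2"
  shows "0 \<le> gh_dist m1 m2"
  unfolding gh_dist_def
  using gh_distances_nonempty[OF m] gh_distances_nonneg[OF m] by (intro cInf_greatest)

lemma gh_dist_less_imp_couple:
  assumes m: "nonempty_compact m1" "nonempty_compact m2" and r: "gh_dist m1 m2 < r"
  shows "\<exists>\<delta>. gh_couple m1 m2 r \<delta>"
proof -
  obtain h where "h \<in> gh_distances m1 m2" "h < r"
    using cInf_lessD[OF gh_distances_nonempty[OF m]] r by (auto simp: gh_dist_def)
  then show ?thesis
    using hausdorff_dist_less_imp_couple[OF m] unfolding gh_distances_def by blast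
qed

lemma gh_dist_commute:
  assumes m: "nonempty_compact m1" "nonempty_compact m2"
  shows "gh_dist m1 m2 = gh_dist m2 m1"
proof -
  have *: "gh_dist m2 m1 \<le> gh_dist m1 m2"
    if m: "nonempty_compact m1" "nonempty_compact m2" for m1 :: "'x metric" and m2 :: "'y metric"
  proof (rule dense_ge)
    fix r assume "gh_dist m1 m2 < r"
    then obtain \<delta> where "gh_couple m1 m2 r \<delta>" using gh_dist_less_imp_couple[OF m] by blast
    then show "gh_dist m2 m1 \<le> r"
      by (intro gh_couple_imp_gh_dist_le[OF m(2,1) gh_couple_flip])
  qed
  show ?thesis using *[OF m] *[OF m(2,1)] by simp
qed

lemma gh_couple_trans:
  assumes c12: "gh_couple m1 m2 r \<delta>" and c23: "gh_couple m2 m3 s \<epsilon>" and ne: "mspace m2 \<noteq> {}"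
  shows "gh_couple m1 m3 (r + s) (\<lambda>x z. INF y\<in>mspace m2. \<delta> x y + \<epsilon> y z)"
proof -
  note a = gh_coupleD[OF c12] and b = gh_coupleD[OF c23]
  let ?k = "\<lambda>x z. INF y\<in>mspace m2. \<delta> x y + \<epsilon> y z"
  have le: "?k x z \<le> \<delta> x y + \<epsilon> y z"
    if "x \<in> mspace m1" "y \<in> mspace m2" "z \<in> mspace m3" for x y z
    using that a(1) b(1) by (intro cINF_lower bdd_belowI2[where m = 0]) auto
  have ge: "\<exists>y\<in>mspace m2. \<delta> x y + \<epsilon> y z < ?k x z + e"
    if "0 < e" "x \<in> mspace m1" "z \<in> mspace m3" for x z e
  proof -
    have "?k x z < ?k x z + e" using that by simp
    then show ?thesis
      using that ne a(1) b(1) by (subst (asm) cINF_less_iff) (auto intro!: bdd_belowI2[where m = 0])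
  qed
  show ?thesis
    unfolding gh_couple_def
  proof (intro conjI ballI)
    fix x z assume "x \<in> mspace m1" "z \<in> mspace m3"
    then show "0 \<le> ?k x z" using ne a(1) b(1) by (intro cINF_greatest) auto
  next
    fix x x' z assume x: "x \<in> mspace m1" "x' \<in> mspace m1" and z: "z \<in> mspace m3"
    show "mdist m1 x x' \<le> ?k x z + ?k x' z"
    proof (rule field_le_epsilon)
      fix e :: real assume "0 < e"
      then have e: "0 < e / 2" by simp
      obtain y where y: "y \<in> mspace m2" "\<delta> x y + \<epsilon> y z < ?k x z + e / 2"
        using ge[OF e x(1) z] by blast
      obtain y' where y': "y' \<in> mspace m2" "\<delta> x' y' + \<epsilon> y' z < ?k x' z + e / 2"
        using ge[OF e x(2) z] by blast
      have "mdist m1 x x' \<le> \<delta> x y + \<delta> x' y" using a(2) x y by blast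
      also have "\<delta> x' y \<le> \<delta> x' y' + mdist m2 y' y" using a(5) x y y' by blast
      also have "mdist m2 y' y \<le> \<epsilon> y' z + \<epsilon> y z" using b(2) z y y' by blast
      finally show "mdist m1 x x' \<le> ?k x z + ?k x' z + e" using y y' by simp
    qed
    show "?k x z \<le> mdist m1 x x' + ?k x' z"
    proof (rule field_le_epsilon)
      fix e :: real assume e: "0 < e"
      obtain y where y: "y \<in> mspace m2" "\<delta> x' y + \<epsilon> y z < ?k x' z + e"
        using ge[OF e x(2) z] by blast
      have "?k x z \<le> \<delta> x y + \<epsilon> y z" using le x y z by blast
      also have "\<delta> x y \<le> mdist m1 x x' + \<delta> x' y" using a(4) x y by blast
      finally show "?k x z \<le> mdist m1 x x' + ?k x' z + e" using y by simp
    qed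
  next
    fix x z z' assume x: "x \<in> mspace m1" and z: "z \<in> mspace m3" "z' \<in> mspace m3"
    show "mdist m3 z z' \<le> ?k x z + ?k x z'"
    proof (rule field_le_epsilon)
      fix e :: real assume "0 < e"
      then have e: "0 < e / 2" by simp
      obtain y where y: "y \<in> mspace m2" "\<delta> x y + \<epsilon> y z < ?k x z + e / 2"
        using ge[OF e x z(1)] by blast
      obtain y' where y': "y' \<in> mspace m2" "\<delta> x y' + \<epsilon> y' z' < ?k x z' + e / 2"
        using ge[OF e x z(2)] by blast
      have "mdist m3 z z' \<le> \<epsilon> y z + \<epsilon> y z'" using b(3) z y by blast
      also have "\<epsilon> y z' \<le> mdist m2 y y' + \<epsilon> y' z'" using b(4) z y y' by blast
      also have "mdist m2 y y' \<le> \<delta> x y + \<delta> x y'" using a(3) x y y' by blast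
      finally show "mdist m3 z z' \<le> ?k x z + ?k x z' + e" using y y' by simp
    qed
    show "?k x z \<le> ?k x z' + mdist m3 z' z"
    proof (rule field_le_epsilon)
      fix e :: real assume e: "0 < e"
      obtain y where y: "y \<in> mspace m2" "\<delta> x y + \<epsilon> y z' < ?k x z' + e"
        using ge[OF e x z(2)] by blast
      have "?k x z \<le> \<delta> x y + \<epsilon> y z" using le x y z by blast
      also have "\<epsilon> y z \<le> \<epsilon> y z' + mdist m3 z' z" using b(5) z y by blast
      finally show "?k x z \<le> ?k x z' + mdist m3 z' z + e" using y by simp
    qed
  next
    fix x assume x: "x \<in> mspace m1"
    then obtain y where y: "y \<in> mspace m2" "\<delta> x y < r" using a(6) by blast
    then obtain z where z: "z \<in> mspace m3" "\<epsilon> y z < s" using b(6) by blast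
    show "\<exists>z\<in>mspace m3. ?k x z < r + s"
      using le[OF x y(1) z(1)] y z by (intro bexI[of _ z]) auto
  next
    fix z assume z: "z \<in> mspace m3"
    then obtain y where y: "y \<in> mspace m2" "\<epsilon> y z < s" using b(7) by blast
    then obtain x where x: "x \<in> mspace m1" "\<delta> x y < r" using a(7) by blast
    show "\<exists>x\<in>mspace m1. ?k x z < r + s"
      using le[OF x(1) y(1) z] y x by (intro bexI[of _ x]) auto
  qed
qed

lemma gh_dist_triangle:
  assumes m: "nonempty_compact m1" "nonempty_compact m2" "nonempty_compact m3"
  shows "gh_dist m1 m3 \<le> gh_dist m1 m2 + gh_dist m2 m3"
proof (rule field_le_epsilon)
  fix e :: real assume e: "0 < e"
  obtain \<delta> where \<delta>: "gh_couple m1 m2 (gh_dist m1 m2 + e / 2) \<delta>"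
    using gh_dist_less_imp_couple[OF m(1,2)] e by (metis half_gt_zero less_add_same_cancel1)
  obtain \<epsilon> where \<epsilon>: "gh_couple m2 m3 (gh_dist m2 m3 + e / 2) \<epsilon>"
    using gh_dist_less_imp_couple[OF m(2,3)] e by (metis half_gt_zero less_add_same_cancel1)
  have "gh_couple m1 m3 (gh_dist m1 m2 + e / 2 + (gh_dist m2 m3 + e / 2))
      (\<lambda>x z. INF y\<in>mspace m2. \<delta> x y + \<epsilon> y z)"
    using m by (intro gh_couple_trans[OF \<delta> \<epsilon>]) (auto simp: nonempty_compact_def)
  from gh_couple_imp_gh_dist_le[OF m(1,3) this]
  show "gh_dist m1 m3 \<le> gh_dist m1 m2 + gh_dist m2 m3 + e" by simp
qed

lemma isometric_imp_gh_dist_0: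
  assumes m: "nonempty_compact m1" "nonempty_compact m2" and "isometric_to m1 m2"
  shows "gh_dist m1 m2 = 0"
proof -
  obtain \<phi> where \<phi>: "isometric_embedding m1 m2 \<phi>" "\<phi> ` mspace m1 = mspace m2"
    using assms by (auto simp: isometric_to_def)
  have i: "\<phi> x \<in> mspace m2" if "x \<in> mspace m1" for x
    using \<phi> that by auto
  have d: "mdist m1 x x' = mdist m2 (\<phi> x) (\<phi> x')" if "x \<in> mspace m1" "x' \<in> mspace m1" for x x'
    using \<phi> that by (auto simp: isometric_embedding_def)
  have "gh_dist m1 m2 \<le> r" if r: "0 < r" for r
  proof (rule gh_couple_imp_gh_dist_le[OF m])
    show "gh_couple m1 m2 r (\<lambda>x y. mdist m2 (\<phi> x) y)"
      unfolding gh_couple_def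
    proof (intro conjI ballI)
      fix x assume x: "x \<in> mspace m1"
      then show "\<exists>y\<in>mspace m2. mdist m2 (\<phi> x) y < r"
        using i r by (intro bexI[of _ "\<phi> x"]) (auto simp: mdist_self)
    next
      fix y assume y: "y \<in> mspace m2"
      then obtain x where "x \<in> mspace m1" "y = \<phi> x" using \<phi> by auto
      then show "\<exists>x\<in>mspace m1. mdist m2 (\<phi> x) y < r"
        using i r by (intro bexI[of _ "x"]) (auto simp: mdist_self)
    next
      fix x x' y assume "x \<in> mspace m1" "x' \<in> mspace m1" "y \<in> mspace m2"
      then show "mdist m1 x x' \<le> mdist m2 (\<phi> x) y + mdist m2 (\<phi> x') y"
        and "mdist m2 (\<phi> x) y \<le> mdist m1 x x' + mdist m2 (\<phi> x') y"
        using mdist_triangle[of "\<phi> x" m2 y "\<phi> x'"] mdist_triangle[of "\<phi> x" m2 "\<phi> x'" y]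
        by (auto simp: d i mdist_commute[of m2 y])
    next
      fix x y y' assume "x \<in> mspace m1" "y \<in> mspace m2" "y' \<in> mspace m2"
      then show "mdist m2 y y' \<le> mdist m2 (\<phi> x) y + mdist m2 (\<phi> x) y'"
        and "mdist m2 (\<phi> x) y \<le> mdist m2 (\<phi> x) y' + mdist m2 y' y"
        using mdist_triangle[of y m2 "\<phi> x" y'] mdist_triangle[of "\<phi> x" m2 y' y]
        by (auto simp: i mdist_commute[of m2 y "\<phi> x"])
    qed auto
  qed
  then have "gh_dist m1 m2 \<le> 0" by (rule dense_ge)
  with gh_dist_nonneg[OF m] show ?thesis by simp
qed

lemma gh_dist_0_imp_embedding:
  assumes m: "nonempty_compact m1" "nonempty_compact m2" and 0: "gh_dist m1 m2 = 0"
  shows "\<exists>\<phi>. isometric_embedding m1 m2 \<phi>"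
proof -
  let ?X = "product_topology (\<lambda>_. mtopology_of m2) (mspace m1)"
  define C where "C n = {f \<in> topspace ?X. \<forall>x\<in>mspace m1. \<forall>x'\<in>mspace m1.
    \<bar>mdist m2 (f x) (f x') - mdist m1 x x'\<bar> \<le> 2 / real (Suc n)}" for n
  have "(\<Inter>n. C n) \<noteq> {}"
  proof (rule compact_space_imp_nest)
    show "compact_space ?X"
      using m by (simp add: compact_space_product_topology nonempty_compact_def)
    show "closedin ?X (C n)" for n
    proof -
      have c: "continuous_map ?X (mtopology_of m2) (\<lambda>f. f x)" if "x \<in> mspace m1" for x
        using that by (rule continuous_map_product_projection)
      have "closedin ?X {f \<in> topspace ?X. \<bar>mdist m2 (f x) (f x') - mdist m1 x x'\<bar> \<in> {..2 / real (Suc n)}}"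
        if "x \<in> mspace m1" "x' \<in> mspace m1" for x x'
        by (rule closedin_continuous_map_preimage[where Y = euclidean])
          (auto intro!: continuous_intros c that)
      moreover have "C n = topspace ?X \<inter> (\<Inter>x\<in>mspace m1. \<Inter>x'\<in>mspace m1.
          {f \<in> topspace ?X. \<bar>mdist m2 (f x) (f x') - mdist m1 x x'\<bar> \<in> {..2 / real (Suc n)}})"
        by (auto simp: C_def)
      moreover have "mspace m1 \<noteq> {}" using m by (auto simp: nonempty_compact_def)
      ultimately show ?thesis
        by (simp only:) (intro closedin_Int closedin_topspace closedin_INT)
    qed
    show "C n \<noteq> {}" for n
    proof -
      obtain \<delta> where "gh_couple m1 m2 (1 / real (Suc n)) \<delta>"
        using gh_dist_less_imp_couple[OF m, of "1 / real (Suc n)"] 0 by auto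
      note c = gh_coupleD[OF this]
      obtain f where f: "\<And>x. x \<in> mspace m1 \<Longrightarrow> f x \<in> mspace m2 \<and> \<delta> x (f x) < 1 / real (Suc n)"
        using c(6) by metis
      have "\<bar>mdist m2 (f x) (f x') - mdist m1 x x'\<bar> \<le> 2 / real (Suc n)"
        if x: "x \<in> mspace m1" "x' \<in> mspace m1" for x x'
      proof -
        have "2 / real (Suc n) = 1 / real (Suc n) + 1 / real (Suc n)" by simp
        moreover have "mdist m2 (f x) (f x') \<le> \<delta> x (f x) + \<delta> x (f x')"
          using c(3) f x by blast
        moreover have "\<delta> x (f x') \<le> mdist m1 x x' + \<delta> x' (f x')"
          using c(4) f x by blast
        moreover have "mdist m1 x x' \<le> \<delta> x (f x) + \<delta> x' (f x)"
          using c(2) f x by blast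
        moreover have "\<delta> x' (f x) \<le> \<delta> x' (f x') + mdist m2 (f x') (f x)"
          using c(5) f x by blast
        moreover have "mdist m2 (f x') (f x) = mdist m2 (f x) (f x')" by (rule mdist_commute)
        moreover have "\<delta> x (f x) < 1 / real (Suc n)" "\<delta> x' (f x') < 1 / real (Suc n)"
          using f x by auto
        ultimately show ?thesis by linarith
      qed
      then have "restrict f (mspace m1) \<in> C n"
        using f by (auto simp: C_def)
      then show ?thesis by blast
    qed
    show "decseq C"
    proof (rule decseq_SucI)
      fix n
      have "2 / real (Suc (Suc n)) \<le> 2 / real (Suc n)" by (intro divide_left_mono) auto
      then show "C (Suc n) \<subseteq> C n" unfolding C_def by fastforce
    qed
  qed
  then obtain f where f: "\<And>n. f \<in> C n" by auto
  have "mdist m2 (f x) (f x') = mdist m1 x x'" if "x \<in> mspace m1" "x' \<in> mspace m1" for x x'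
  proof -
    have "\<bar>mdist m2 (f x) (f x') - mdist m1 x x'\<bar> \<le> e" if e: "0 < e" for e
    proof -
      obtain n where n: "1 / real (Suc n) < e / 2" using half_gt_zero[OF e] by (rule nat_approx_posE)
      have "2 / real (Suc n) = 2 * (1 / real (Suc n))" by simp
      with n have "2 / real (Suc n) \<le> e" by linarith
      moreover have "\<bar>mdist m2 (f x) (f x') - mdist m1 x x'\<bar> \<le> 2 / real (Suc n)"
        using f[of n] \<open>x \<in> _\<close> \<open>x' \<in> _\<close> unfolding C_def by blast
      ultimately show ?thesis by linarith
    qed
    then have "\<bar>mdist m2 (f x) (f x') - mdist m1 x x'\<bar> \<le> 0" by (rule dense_ge)
    then show ?thesis by simp
  qed
  moreover have "f \<in> mspace m1 \<rightarrow> mspace m2"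
    using f[of 0] by (auto simp: C_def)
  ultimately show ?thesis unfolding isometric_embedding_def by blast
qed

lemma compact_isometric_self_embedding_surj:
  assumes m: "nonempty_compact m" and f: "isometric_embedding m m f"
  shows "f ` mspace m = mspace m"
proof (rule ccontr)
  interpret Metric_space "mspace m" "mdist m" by simp
  have fin: "f x \<in> mspace m" if "x \<in> mspace m" for x
    using f that by (auto simp: isometric_embedding_def)
  assume "f ` mspace m \<noteq> mspace m"
  then obtain a where a: "a \<in> mspace m" "a \<notin> f ` mspace m" using fin by auto
  have comp: "compact_space mtopology"
    using m by (simp add: nonempty_compact_def mtopology_of_def)
  have iter: "(f ^^ n) x \<in> mspace m" if "x \<in> mspace m" for n x
    using that fin by (induction n) auto
  have shift: "mdist m ((f ^^ n) x) ((f ^^ n) y) = mdist m x y"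
    if "x \<in> mspace m" "y \<in> mspace m" for n x y
    using that f iter by (induction n) (auto simp: isometric_embedding_def)
  have "\<exists>x\<in>mspace m. mdist m a (f x) < e" if e: "0 < e" for e
  proof -
    have "mtotally_bounded (mspace m)"
      using comp by (simp add: compact_space_eq_mcomplete_mtotally_bounded)
    then obtain r :: "nat \<Rightarrow> nat" where r: "strict_mono r" "MCauchy ((\<lambda>n. (f ^^ n) a) \<circ> r)"
      using iter a unfolding mtotally_bounded_sequentially by (metis image_subsetI)
    then obtain N where "\<And>i j. i \<ge> N \<Longrightarrow> j \<ge> N \<Longrightarrow> mdist m ((f ^^ r i) a) ((f ^^ r j) a) < e"
      using e unfolding MCauchy_def comp_def by metis
    then have *: "mdist m ((f ^^ r N) a) ((f ^^ r (Suc N)) a) < e" by simp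
    have "r N < r (Suc N)" using r by (simp add: strict_mono_Suc_iff)
    then obtain k where k: "r (Suc N) = r N + Suc k" using less_iff_Suc_add by auto
    have "(f ^^ r (Suc N)) a = (f ^^ r N) (f ((f ^^ k) a))"
      unfolding k funpow_add comp_def by simp
    with * have "mdist m a (f ((f ^^ k) a)) < e"
      using shift a iter fin by simp
    then show ?thesis using a iter by blast
  qed
  then have "\<exists>x\<in>mspace m. mdist m a (f x) < 1 / real (Suc n)" for n by simp
  then obtain x where x: "\<And>n. x n \<in> mspace m" "\<And>n. mdist m a (f (x n)) < 1 / real (Suc n)"
    by metis
  then obtain l r where l: "l \<in> mspace m" "strict_mono r" "limitin mtopology (x \<circ> r) l sequentially"
    using comp unfolding compact_space_sequentially by (metis image_subsetI)
  have "mdist m a (f l) \<le> e" if e: "0 < e" for e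
  proof -
    obtain N where N: "\<And>n. n \<ge> N \<Longrightarrow> mdist m (x (r n)) l < e / 2"
      using l(3) half_gt_zero[OF e] unfolding limit_metric_sequentially comp_def by blast
    obtain k where k: "1 / real (Suc k) < e / 2" using half_gt_zero[OF e] by (rule nat_approx_posE)
    let ?n = "max N k"
    have "k \<le> r ?n" using seq_suble[OF l(2), of ?n] by simp
    then have "1 / real (Suc (r ?n)) \<le> 1 / real (Suc k)" by (intro divide_left_mono) auto
    moreover have "mdist m a (f l) \<le> mdist m a (f (x (r ?n))) + mdist m (f (x (r ?n))) (f l)"
      using a x l fin by (intro mdist_triangle) auto
    moreover have "mdist m (f (x (r ?n))) (f l) = mdist m (x (r ?n)) l"
      using f x l by (auto simp: isometric_embedding_def)
    ultimately show ?thesis using N[of ?n] k x(2)[of "r ?n"] by simp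
  qed
  then have "mdist m a (f l) \<le> 0" by (rule dense_ge)
  then have "mdist m a (f l) = 0" by (simp add: antisym)
  then have "a = f l" using a l fin by simp
  with a l show False by auto
qed

lemma gh_dist_0_iff:
  assumes m: "nonempty_compact m1" "nonempty_compact m2"
  shows "gh_dist m1 m2 = 0 \<longleftrightarrow> isometric_to m1 m2"
proof
  assume 0: "gh_dist m1 m2 = 0"
  obtain \<phi> where \<phi>: "isometric_embedding m1 m2 \<phi>"
    using gh_dist_0_imp_embedding[OF m 0] by blast
  obtain \<psi> where \<psi>: "isometric_embedding m2 m1 \<psi>"
    using gh_dist_0_imp_embedding[OF m(2,1)] 0 gh_dist_commute[OF m] by auto
  have "(\<phi> \<circ> \<psi>) ` mspace m2 = mspace m2"
    using compact_isometric_self_embedding_surj[OF m(2) isometric_embedding_trans[OF \<psi> \<phi>]] .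
  moreover have "\<psi> ` mspace m2 \<subseteq> mspace m1" "\<phi> ` mspace m1 \<subseteq> mspace m2"
    using \<phi> \<psi> by (auto simp: isometric_embedding_def)
  ultimately have "\<phi> ` mspace m1 = mspace m2" by (metis image_comp image_mono subset_antisym)
  then show "isometric_to m1 m2" using \<phi> by (auto simp: isometric_to_def)
qed (rule isometric_imp_gh_dist_0[OF m])

subsection \<open>The space\<close>

lemma nonempty_compact_isometric:
  assumes "isometric_to m1 m2" "nonempty_compact m1"
  shows "nonempty_compact m2"
proof -
  obtain \<phi> where \<phi>: "isometric_embedding m1 m2 \<phi>" "\<phi> ` mspace m1 = mspace m2"
    using assms by (auto simp: isometric_to_def)
  have "Metric_space12 (mspace m1) (mdist m1) (mspace m2) (mdist m2)"
    by (simp add: Metric_space12_def)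
  then have "homeomorphic_map (mtopology_of m1) (mtopology_of m2) \<phi>"
    unfolding mtopology_of_def using \<phi>
    by (intro Metric_space12.isometry_imp_homeomorphic_map) (auto simp: isometric_embedding_def)
  then have "mtopology_of m1 homeomorphic_space mtopology_of m2"
    by (rule homeomorphic_map_imp_homeomorphic_space)
  then show ?thesis
    using assms \<phi> by (auto simp: nonempty_compact_def homeomorphic_compact_space)
qed

lemma ex_isometric_real_metric:
  assumes m: "nonempty_compact m"
  shows "\<exists>m' :: real metric. isometric_to m m'"
proof -
  interpret Metric_space "mspace m" "mdist m" by simp
  have "mtotally_bounded (mspace m)"
    using m by (simp add: nonempty_compact_def mtopology_of_def compact_space_eq_mcomplete_mtotally_bounded)
  then have "\<exists>K. finite K \<and> K \<subseteq> mspace m \<and> mspace m \<subseteq> (\<Union>x\<in>K. mball x (1 / real (Suc n)))" for n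
    unfolding mtotally_bounded_def by (meson divide_pos_pos of_nat_0_less_iff zero_less_Suc zero_less_one)
  then obtain K where K: "\<And>n. finite (K n)" "\<And>n. K n \<subseteq> mspace m"
    "\<And>n. mspace m \<subseteq> (\<Union>x\<in>K n. mball x (1 / real (Suc n)))" by metis
  define E where "E = Sigma UNIV K"
  have "countable E" unfolding E_def using K(1) by (intro countable_SIGMA) (auto simp: countable_finite)
  define F where "F x = to_nat_on E ` {(n, k) \<in> E. mdist m k x < 1 / real (Suc n)}" for x
  have inj: "inj_on F (mspace m)"
  proof (rule inj_onI)
    fix x y assume x: "x \<in> mspace m" and y: "y \<in> mspace m" and "F x = F y"
    then have eq: "{(n, k) \<in> E. mdist m k x < 1 / real (Suc n)} = {(n, k) \<in> E. mdist m k y < 1 / real (Suc n)}"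
      unfolding F_def using \<open>countable E\<close> by (subst (asm) inj_on_image_eq_iff[of _ E]) auto
    have "mdist m x y \<le> e" if e: "0 < e" for e
    proof -
      obtain n where n: "1 / real (Suc n) < e / 2" using half_gt_zero[OF e] by (rule nat_approx_posE)
      obtain k where k: "k \<in> K n" "mdist m k x < 1 / real (Suc n)" using K(3)[of n] x by auto
      then have "mdist m k y < 1 / real (Suc n)" using eq by (auto simp: E_def)
      moreover have "mdist m x y \<le> mdist m x k + mdist m k y"
        using x y k K(2) by (intro mdist_triangle) auto
      ultimately show ?thesis using n k by (simp add: mdist_commute[of m x k])
    qed
    then have "mdist m x y \<le> 0" by (rule dense_ge)
    then have "mdist m x y = 0" by (simp add: antisym)
    then show "x = y" using x y by simp
  qed
  obtain g :: "nat set \<Rightarrow> real" where g: "inj g"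
    using nat_sets_lepoll_reals01 by (auto simp: lepoll_def)
  define h where "h = g \<circ> F"
  have h: "inj_on h (mspace m)"
    unfolding h_def using inj g by (intro comp_inj_on) (auto intro: inj_on_subset)
  let ?i = "inv_into (mspace m) h"
  define d where "d u v = mdist m (?i u) (?i v)" for u v
  interpret H: Metric_space "h ` mspace m" d
    by standard (use h in \<open>auto simp: d_def mdist_commute intro: mdist_triangle\<close>)
  have "isometric_embedding m (metric (h ` mspace m, d)) h"
    using h by (auto simp: isometric_embedding_def d_def)
  then show ?thesis by (auto simp: isometric_to_def intro!: exI)
qed

text \<open>A compact metric space has at most the cardinality of the continuum, hence is isometric
  to a metric space whose carrier is a set of reals (lemma \<open>ex_isometric_real_metric\<close>). So
  the isometry classes of all non-empty compact metric spaces form a quotient of the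
  non-empty compact spaces in \<open>real metric\<close>.\<close>

definition gh_rel :: "real metric \<Rightarrow> real metric \<Rightarrow> bool"
  where "gh_rel m1 m2 \<longleftrightarrow> nonempty_compact m1 \<and> nonempty_compact m2 \<and> isometric_to m1 m2"

lemma nonempty_compact_singleton: "nonempty_compact (submetric euclidean_metric {0 :: real})"
  by (simp add: nonempty_compact_def mtopology_of_submetric compact_space_subtopology)

quotient_type gh_space = "real metric" / partial: gh_rel
proof (rule part_equivpI)
  show "\<exists>m. gh_rel m m"
    using nonempty_compact_singleton isometric_to_refl by (auto simp: gh_rel_def)
  show "symp gh_rel"
    by (auto simp: gh_rel_def symp_def isometric_to_sym)
  show "transp gh_rel"
    by (auto simp: gh_rel_def transp_def intro: isometric_to_trans)
qed

text \<open>The isometry class of a non-empty compact metric space over an arbitrary type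
  (unspecified for other arguments); see \<open>gh_class_eq_iff\<close> and \<open>dist_gh_class\<close>.\<close>

definition gh_class :: "'a metric \<Rightarrow> gh_space"
  where "gh_class m = abs_gh_space (SOME m'. isometric_to m m')"

lemma gh_rel_rep: "gh_rel (rep_gh_space X) (rep_gh_space X)"
  using Quotient3_gh_space by (metis Quotient3_def)

lemma nonempty_compact_rep: "nonempty_compact (rep_gh_space X)"
  using gh_rel_rep by (simp add: gh_rel_def)

lemma isometric_rep_gh_class:
  assumes "nonempty_compact m" shows "isometric_to m (rep_gh_space (gh_class m))"
proof -
  define m' :: "real metric" where "m' = (SOME m'. isometric_to m m')"
  have m': "isometric_to m m'"
    unfolding m'_def using ex_isometric_real_metric[OF assms] by (rule someI_ex)
  then have "gh_rel m' m'"
    using nonempty_compact_isometric assms isometric_to_refl by (auto simp: gh_rel_def)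
  then have "gh_rel (rep_gh_space (abs_gh_space m')) m'"
    using Quotient3_gh_space by (meson Quotient3_rep_abs)
  then show ?thesis
    using m' isometric_to_sym isometric_to_trans by (metis gh_class_def gh_rel_def m'_def)
qed

lemma gh_class_eq_iff:
  assumes "nonempty_compact m1" "nonempty_compact m2"
  shows "gh_class m1 = gh_class m2 \<longleftrightarrow> isometric_to m1 m2"
proof
  assume "gh_class m1 = gh_class m2"
  then show "isometric_to m1 m2"
    using isometric_rep_gh_class[OF assms(1)] isometric_rep_gh_class[OF assms(2)]
      isometric_to_sym isometric_to_trans by metis
next
  assume "isometric_to m1 m2"
  then have "gh_rel (rep_gh_space (gh_class m1)) (rep_gh_space (gh_class m2))"
    using isometric_rep_gh_class[OF assms(1)] isometric_rep_gh_class[OF assms(2)]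
      isometric_to_sym isometric_to_trans nonempty_compact_rep unfolding gh_rel_def by metis
  then show "gh_class m1 = gh_class m2"
    using Quotient3_rel_rep[OF Quotient3_gh_space] by blast
qed

instantiation gh_space :: metric_space
begin

definition dist_gh_space :: "gh_space \<Rightarrow> gh_space \<Rightarrow> real"
  where "dist_gh_space X Y = gh_dist (rep_gh_space X) (rep_gh_space Y)"
definition uniformity_gh_space :: "(gh_space \<times> gh_space) filter"
  where "uniformity_gh_space = (INF e\<in>{0<..}. principal {(x, y). dist x y < e})"
definition open_gh_space :: "gh_space set \<Rightarrow> bool"
  where "open_gh_space U = (\<forall>x\<in>U. eventually (\<lambda>(x', y). x' = x \<longrightarrow> y \<in> U) uniformity)"

instance
proof
  fix X Y Z :: gh_space
  note nc = nonempty_compact_rep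
  show "dist X Y = 0 \<longleftrightarrow> X = Y"
    unfolding dist_gh_space_def gh_dist_0_iff[OF nc nc]
    using Quotient3_rel_rep[OF Quotient3_gh_space, of X Y] nc by (simp add: gh_rel_def)
  show "dist X Y \<le> dist X Z + dist Y Z"
    unfolding dist_gh_space_def
    using gh_dist_triangle[OF nc[of X] nc[of Z] nc[of Y]] gh_dist_commute[OF nc nc, of Y Z] by simp
qed (fact uniformity_gh_space_def open_gh_space_def)+

end

lemma dist_gh_class:
  assumes "nonempty_compact m1" "nonempty_compact m2"
  shows "dist (gh_class m1) (gh_class m2) = gh_dist m1 m2"
proof -
  note nc = nonempty_compact_rep
  note i = isometric_rep_gh_class[OF assms(1)] isometric_rep_gh_class[OF assms(2)]
  have 0: "gh_dist m1 (rep_gh_space (gh_class m1)) = 0" "gh_dist (rep_gh_space (gh_class m1)) m1 = 0"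
    "gh_dist m2 (rep_gh_space (gh_class m2)) = 0" "gh_dist (rep_gh_space (gh_class m2)) m2 = 0"
    using i assms nc by (simp_all add: gh_dist_0_iff isometric_to_sym)
  show ?thesis
    unfolding dist_gh_space_def
    using gh_dist_triangle[OF assms(1) nc assms(2), of "gh_class m1"]
      gh_dist_triangle[OF nc nc assms(2), of "gh_class m1" "gh_class m2"]
      gh_dist_triangle[OF nc assms(1) nc, of "gh_class m1" "gh_class m2"]
      gh_dist_triangle[OF assms nc, of "gh_class m2"] 0 by linarith
qed

section \<open>Convergence notions\<close>

text \<open>Vague convergence of measures on \<open>{0<..} :: ennreal set\<close>, i.e. on \<open>(0,\<infinity>]\<close>. A compact
  subset of \<open>(0,\<infinity>]\<close> may contain \<open>\<infinity>\<close> but stays away from \<open>0\<close>. All measures here have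
  \<open>{0<..}\<close> as their space, so values of the test functions at \<open>0\<close> are irrelevant.\<close>

definition vague_conv :: "(nat \<Rightarrow> ennreal measure) \<Rightarrow> ennreal measure \<Rightarrow> bool"
  where "vague_conv \<mu> \<nu> \<longleftrightarrow>
    (\<forall>f :: ennreal \<Rightarrow> real.
       continuous_on {0<..} f \<and>
       (\<exists>K. compact K \<and> K \<subseteq> {0<..} \<and> (\<forall>x\<in>{0<..} - K. f x = 0)) \<longrightarrow>
       (\<lambda>d. \<integral>x. f x \<partial>\<mu> d) \<longlonglongrightarrow> (\<integral>x. f x \<partial>\<nu>))"

text \<open>Convergence in distribution of random elements that may be defined on different
  probability spaces; measurability of all random elements is part of the claim.\<close>

definition conv_in_distribution ::
    "(nat \<Rightarrow> 'a measure) \<Rightarrow> (nat \<Rightarrow> 'a \<Rightarrow> 'x :: topological_space) \<Rightarrow> 'b measure \<Rightarrow> ('b \<Rightarrow> 'x) \<Rightarrow> bool"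
  where "conv_in_distribution M Z M' Z' \<longleftrightarrow>
    (\<forall>d. Z d \<in> borel_measurable (M d)) \<and> Z' \<in> borel_measurable M' \<and>
    (\<forall>f :: 'x \<Rightarrow> real. continuous_on UNIV f \<and> bounded (range f) \<longrightarrow>
       (\<lambda>d. \<integral>\<omega>. f (Z d \<omega>) \<partial>M d) \<longlonglongrightarrow> (\<integral>\<omega>. f (Z' \<omega>) \<partial>M'))"

section \<open>Crinkled subordinators\<close>

definition poisson_random_measure :: "'w measure \<Rightarrow> 's measure \<Rightarrow> ('w \<Rightarrow> 's measure) \<Rightarrow> bool"
  where "poisson_random_measure W \<mu> P \<longleftrightarrow>
    (\<forall>\<omega>\<in>space W. sets (P \<omega>) = sets \<mu>) \<and>
    (\<forall>B\<in>sets \<mu>. (\<lambda>\<omega>. emeasure (P \<omega>) B) \<in> borel_measurable W) \<and>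
    (\<forall>B\<in>sets \<mu>. emeasure \<mu> B < \<infinity> \<longrightarrow>
       (\<forall>j::nat. measure W {\<omega> \<in> space W. emeasure (P \<omega>) B = of_nat j}
          = measure \<mu> B ^ j / fact j * exp (- measure \<mu> B))) \<and>
    (\<forall>B\<in>sets \<mu>. emeasure \<mu> B = \<infinity> \<longrightarrow> (AE \<omega> in W. emeasure (P \<omega>) B = \<infinity>)) \<and>
    (\<forall>(m::nat) B. (\<forall>i<m. B i \<in> sets \<mu>) \<and> disjoint_family_on B {..<m} \<longrightarrow>
       prob_space.indep_vars W (\<lambda>_. borel) (\<lambda>i \<omega>. emeasure (P \<omega>) (B i)) {..<m})"

text \<open>The points \<open>(x k \<omega>, y k \<omega>)\<close>, \<open>k \<in> I \<omega>\<close>, are a measurable enumeration of the atoms of a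
  Poisson random measure on \<open>[0,\<infinity>) \<times> (0,\<infinity>]\<close> with intensity Lebesgue \<open>\<times> \<nu>\<close>. The random index
  set \<open>I \<omega>\<close> is needed because there may be only finitely many atoms (none if \<open>\<nu> = 0\<close>). The
  random measure \<open>\<Sum>\<^sub>k \<delta>(x\<^sub>k, y\<^sub>k)\<close> is the image of counting measure on \<open>I \<omega>\<close>.\<close>

definition poisson_atoms ::
    "'w measure \<Rightarrow> ennreal measure \<Rightarrow> ('w \<Rightarrow> nat set) \<Rightarrow> (nat \<Rightarrow> 'w \<Rightarrow> real) \<Rightarrow> (nat \<Rightarrow> 'w \<Rightarrow> ennreal) \<Rightarrow> bool"
  where "poisson_atoms W \<nu> I x y \<longleftrightarrow>
    (\<forall>k. {\<omega> \<in> space W. k \<in> I \<omega>} \<in> sets W) \<and>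
    (\<forall>k. x k \<in> borel_measurable W) \<and> (\<forall>k. y k \<in> borel_measurable W) \<and>
    (\<forall>\<omega>\<in>space W. \<forall>k\<in>I \<omega>. 0 \<le> x k \<omega> \<and> 0 < y k \<omega>) \<and>
    poisson_random_measure W (restrict_space lborel {0..} \<Otimes>\<^sub>M \<nu>)
      (\<lambda>\<omega>. distr (count_space (I \<omega>)) (restrict_space lborel {0..} \<Otimes>\<^sub>M \<nu>) (\<lambda>k. (x k \<omega>, y k \<omega>)))"

text \<open>Almost surely the series converges and all \<open>y k \<omega>\<close> are finite if \<open>\<nu>\<close> integrates
  \<open>min 1 x\<close> over \<open>(0,\<infinity>)\<close> and has no mass at \<open>\<infinity>\<close>.\<close>

definition crinkled_subordinator ::
    "('w \<Rightarrow> nat set) \<Rightarrow> (nat \<Rightarrow> 'w \<Rightarrow> real) \<Rightarrow> (nat \<Rightarrow> 'w \<Rightarrow> ennreal) \<Rightarrow> real \<Rightarrow> 'w \<Rightarrow> l2"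
  where "crinkled_subordinator I x y t \<omega> =
    (\<Sum>\<^sub>\<infinity>k\<in>{k \<in> I \<omega>. x k \<omega> \<le> t}. sqrt (enn2real (y k \<omega>)) *\<^sub>R l2_basis k)"

definition crinkled_range ::
    "('w \<Rightarrow> nat set) \<Rightarrow> (nat \<Rightarrow> 'w \<Rightarrow> real) \<Rightarrow> (nat \<Rightarrow> 'w \<Rightarrow> ennreal) \<Rightarrow> real \<Rightarrow> 'w \<Rightarrow> l2 set"
  where "crinkled_range I x y T \<omega> = closure ((\<lambda>t. crinkled_subordinator I x y t \<omega>) ` {0..T})"

section \<open>Random walks\<close>

text \<open>The steps are indexed from \<open>0\<close>, so that \<open>partial_sum \<xi> k\<close> is the sum of the first \<open>k\<close> steps.\<close>

definition partial_sum :: "(nat \<Rightarrow> 'w \<Rightarrow> l2) \<Rightarrow> nat \<Rightarrow> 'w \<Rightarrow> l2"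
  where "partial_sum \<xi> k \<omega> = (\<Sum>i<k. \<xi> i \<omega>)"

text \<open>The compact metric space \<open>(A, \<rho>\<^sub>2)\<close> as a point of the Gromov--Hausdorff space. A crinkled
  range is compact only almost surely, so it defines a random element of that space only up
  to null sets; its measurability is therefore meant with respect to the completed measure.\<close>

definition gh_of_set :: "l2 set \<Rightarrow> gh_space"
  where "gh_of_set A = gh_class (submetric euclidean_metric A)"

end

theory Submission
  imports Defs "HOL-Real_Asymp.Real_Asymp"
begin

text \<open>Cut \<open>[0, T]\<close> into \<open>q\<close> time blocks and the squared step lengths above a small level \<open>s\<close> into
  fine cells. With high probability every block contains at most one large step, so that the large
  steps are described, up to a small error, by a word \<open>\<kappa>\<close> over the finite alphabet of cells. The
  probability of each word is a finite product, and it converges to the corresponding probability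
  for the atoms of the Poisson random measure, because \<open>n P(\<parallel>X\<parallel>\<^sup>2 > u a(n))\<close> tends to the tail of \<open>\<nu>\<close> at
  its continuity points. Given \<open>\<kappa>\<close>, both random metric spaces are close to the deterministic set of
  partial sums of orthogonal vectors with the squared lengths prescribed by \<open>\<kappa>\<close>: on the limit side
  this is the definition of the crinkled subordinator; for the walk it follows from near orthogonality
  of the large steps, which is an assumption on pairs only but suffices since the number of large steps
  is tight. Steps below \<open>s\<close> are uniformly negligible by Kolmogorov's maximal inequality, jumps
  below \<open>s\<close> by Campbell's formula. Hence expectations of bounded Lipschitz functions converge.\<close>

section \<open>Convergence in distribution by finite approximation\<close>

text \<open>The walk has no limit inside l2, since nothing fixes the directions of its large steps.
  Only mutual distances can converge, so both sides are compared, through a correspondence of small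
  distortion, with one deterministic space per word. Squared distances between partial sums are sums
  of squared lengths plus inner products; hence sizes and order of the jumps determine the limit,
  and recording their times by block suffices because a range forgets the speed at which it is
  traversed. Tightness is built in: finitely many words carry limit probability at least 1 - e, and
  convergence of each word probability hands this mass to the walk. The order of the choices
  untangles the errors: the level s, then the number q of blocks, then a ceiling on the jump sizes,
  and last the tolerance \<epsilon> for inner products. Condition (b) gives no rate and speaks of
  fixed s and \<epsilon> only; with at most one large step per block, of squared length below the
  ceiling, a fixed \<epsilon> is enough.\<close>

lemma conv_in_distribution_lipschitzI:
  fixes Z :: "nat \<Rightarrow> 'a \<Rightarrow> 'x :: metric_space"
  assumes M: "\<And>d. prob_space (M d)" and M': "prob_space M'"
    and Z: "\<And>d. Z d \<in> borel_measurable (M d)" and Z': "Z' \<in> borel_measurable M'"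
    and lip: "\<And>(f :: 'x \<Rightarrow> real) L C. L-lipschitz_on UNIV f \<Longrightarrow> (\<And>z. \<bar>f z\<bar> \<le> C) \<Longrightarrow>
       (\<lambda>d. \<integral>\<omega>. f (Z d \<omega>) \<partial>M d) \<longlonglongrightarrow> (\<integral>\<omega>. f (Z' \<omega>) \<partial>M')"
  shows "conv_in_distribution M Z M' Z'"
proof -
  have int: "integrable (M d) (\<lambda>\<omega>. f (Z d \<omega>))"
    if "f \<in> borel_measurable borel" "\<And>z. \<bar>f z\<bar> \<le> C" for f :: "'x \<Rightarrow> real" and C d
  proof -
    interpret prob_space "M d" by (rule M)
    show ?thesis
      by (rule integrable_const_bound[where B = C]) (use that measurable_compose[OF Z] in auto)
  qed
  have int': "integrable M' (\<lambda>\<omega>. f (Z' \<omega>))"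
    if "f \<in> borel_measurable borel" "\<And>z. \<bar>f z\<bar> \<le> C" for f :: "'x \<Rightarrow> real" and C
  proof -
    interpret prob_space M' by (rule M')
    show ?thesis
      by (rule integrable_const_bound[where B = C]) (use that measurable_compose[OF Z'] in auto)
  qed
  \<comment> \<open>A bounded continuous \<open>f\<close> is the increasing limit of the Lipschitz functions
    \<open>\<lambda>z. INF w. f w + k * dist z w\<close>.\<close>
  have lower: "\<forall>\<^sub>F d in sequentially. (\<integral>\<omega>. f (Z' \<omega>) \<partial>M') - e < (\<integral>\<omega>. f (Z d \<omega>) \<partial>M d)"
    if cont: "continuous_on UNIV f" and C: "\<And>z. \<bar>f z\<bar> \<le> C" and e: "0 < e"
    for f :: "'x \<Rightarrow> real" and C e
  proof -
    define g where "g k z = (INF w. f w + real k * dist z w)" for k :: nat and z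
    have bb: "bdd_below (range (\<lambda>w. f w + real k * dist z w))" for k z
    proof (rule bdd_belowI2)
      show "- C \<le> f w + real k * dist z w" for w
        using abs_le_D2[OF C[of w]] mult_nonneg_nonneg[OF of_nat_0_le_iff zero_le_dist, of k z w] by linarith
    qed
    have gf: "g k z \<le> f z" for k z
      unfolding g_def using cINF_lower[OF bb, of z k z] by simp
    have gC: "- C \<le> g k z" for k z
      unfolding g_def
    proof (rule cINF_greatest)
      show "- C \<le> f w + real k * dist z w" for w
        using abs_le_D2[OF C[of w]] mult_nonneg_nonneg[OF of_nat_0_le_iff zero_le_dist, of k z w] by linarith
    qed auto
    have g_abs: "\<bar>g k z\<bar> \<le> C" for k z
      using gf[of k z] gC[of k z] C[of z] by (auto simp: abs_le_iff)
    have g_step: "g k z \<le> g k z' + real k * dist z z'" for k z z'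
    proof -
      have "g k z - real k * dist z z' \<le> g k z'"
        unfolding g_def[of k z']
      proof (rule cINF_greatest)
        fix w
        have "g k z \<le> f w + real k * dist z w"
          unfolding g_def by (rule cINF_lower[OF bb]) simp
        also have "real k * dist z w \<le> real k * (dist z z' + dist z' w)"
          by (intro mult_left_mono dist_triangle) auto
        finally show "g k z - real k * dist z z' \<le> f w + real k * dist z' w"
          by (simp add: algebra_simps)
      qed auto
      then show ?thesis by simp
    qed
    have g_lip: "(real k)-lipschitz_on UNIV (g k)" for k
    proof (rule lipschitz_onI)
      show "dist (g k z) (g k z') \<le> real k * dist z z'" for z z'
        using g_step[of k z z'] g_step[of k z' z] by (simp add: dist_real_def dist_commute abs_le_iff)
    qed simp
    have g_meas: "g k \<in> borel_measurable borel" for k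
      using lipschitz_on_continuous_on[OF g_lip] by (rule borel_measurable_continuous_onI)
    have g_lim: "(\<lambda>k. g k z) \<longlonglongrightarrow> f z" for z
    proof (rule tendstoI)
      fix e :: real assume e: "0 < e"
      obtain \<delta> where \<delta>: "0 < \<delta>" "\<And>w. dist w z < \<delta> \<Longrightarrow> dist (f w) (f z) < e / 2"
        using cont e unfolding continuous_on_iff by (metis UNIV_I half_gt_zero)
      \<comment> \<open>Once 2 C < K \<delta>, the penalty outside the \<delta>-ball outweighs the
        whole oscillation of f.\<close>
      obtain K :: nat where K: "2 * C / \<delta> < real K" using reals_Archimedean2 by blast
      have "dist (g k z) (f z) < e" if "k \<ge> K" for k
      proof -
        have "f z - e / 2 \<le> g k z"
          unfolding g_def
        proof (rule cINF_greatest)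
          fix w
          show "f z - e / 2 \<le> f w + real k * dist z w"
          proof (cases "dist w z < \<delta>")
            case True
            then have "f z - e / 2 \<le> f w" using \<delta>(2)[OF True] by (simp only: dist_real_def abs_less_iff) linarith
            also have "\<dots> \<le> f w + real k * dist z w" by simp
            finally show ?thesis .
          next
            case False
            have "2 * C < real K * \<delta>" using K \<delta> by (simp add: field_simps)
            also have "\<dots> \<le> real k * dist z w"
              using that False \<delta> by (intro mult_mono) (auto simp: dist_commute)
            finally show ?thesis using abs_le_D1[OF C[of z]] abs_le_D2[OF C[of w]] e by simp
          qed
        qed auto
        then show ?thesis using gf[of k z] e by (simp add: dist_real_def)
      qed
      then show "\<forall>\<^sub>F k in sequentially. dist (g k z) (f z) < e"
        unfolding eventually_sequentially by blast
    qed
    have f_meas: "f \<in> borel_measurable borel" using cont by (rule borel_measurable_continuous_onI)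
    interpret M': prob_space M' by (rule M')
    have "(\<lambda>k. \<integral>\<omega>. g k (Z' \<omega>) \<partial>M') \<longlonglongrightarrow> (\<integral>\<omega>. f (Z' \<omega>) \<partial>M')"
    proof (rule integral_dominated_convergence[where w = "\<lambda>_. C"])
      show "(\<lambda>\<omega>. f (Z' \<omega>)) \<in> borel_measurable M'" "\<And>k. (\<lambda>\<omega>. g k (Z' \<omega>)) \<in> borel_measurable M'"
        using measurable_compose[OF Z'] f_meas g_meas by auto
    qed (use g_lim g_abs in auto)
    then have "\<forall>\<^sub>F k in sequentially. (\<integral>\<omega>. f (Z' \<omega>) \<partial>M') - e < (\<integral>\<omega>. g k (Z' \<omega>) \<partial>M')"
      by (rule order_tendstoD) (use e in simp)
    then obtain k where k: "(\<integral>\<omega>. f (Z' \<omega>) \<partial>M') - e < (\<integral>\<omega>. g k (Z' \<omega>) \<partial>M')"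
      by (auto simp: eventually_sequentially)
    have "\<forall>\<^sub>F d in sequentially. (\<integral>\<omega>. f (Z' \<omega>) \<partial>M') - e < (\<integral>\<omega>. g k (Z d \<omega>) \<partial>M d)"
      using lip[OF g_lip g_abs] k by (rule order_tendstoD)
    moreover have "(\<integral>\<omega>. g k (Z d \<omega>) \<partial>M d) \<le> (\<integral>\<omega>. f (Z d \<omega>) \<partial>M d)" for d
      by (intro integral_mono int[OF g_meas g_abs] int[OF f_meas C] gf)
    ultimately show ?thesis by (auto elim!: eventually_mono intro: less_le_trans)
  qed
  show ?thesis
    unfolding conv_in_distribution_def
  proof (intro conjI allI impI Z Z')
    fix f :: "'x \<Rightarrow> real" assume f: "continuous_on UNIV f \<and> bounded (range f)"
    then obtain C where C: "\<And>z. \<bar>f z\<bar> \<le> C" by (auto simp: bounded_iff)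
    show "(\<lambda>d. \<integral>\<omega>. f (Z d \<omega>) \<partial>M d) \<longlonglongrightarrow> (\<integral>\<omega>. f (Z' \<omega>) \<partial>M')"
    proof (rule tendstoI)
      fix e :: real assume e: "0 < e"
      \<comment> \<open>The upper bound is the lower bound \<open>lower\<close> applied to
        -f.\<close>
      have "continuous_on UNIV (\<lambda>z. - f z)" using f by (intro continuous_intros) auto
      from lower[OF this _ e, of C] C
      have "\<forall>\<^sub>F d in sequentially. (\<integral>\<omega>. f (Z d \<omega>) \<partial>M d) < (\<integral>\<omega>. f (Z' \<omega>) \<partial>M') + e"
        by (auto elim!: eventually_mono)
      with lower[OF conjunct1[OF f] C e]
      show "\<forall>\<^sub>F d in sequentially. dist (\<integral>\<omega>. f (Z d \<omega>) \<partial>M d) (\<integral>\<omega>. f (Z' \<omega>) \<partial>M') < e"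
        by eventually_elim (simp add: dist_real_def abs_less_iff)
    qed
  qed
qed

text \<open>f (Z) is compared with the step function that equals f (g \<kappa>) on A \<kappa> and 0
  elsewhere. On A \<kappa> and B the Lipschitz bound gives L e; missing every A \<kappa>, or missing
  B, costs at most 2 C each.\<close>

lemma (in prob_space) expectation_finite_approx:
  fixes Z :: "'a \<Rightarrow> 'x :: metric_space" and f :: "'x \<Rightarrow> real"
  assumes Z: "Z \<in> borel_measurable M" and f: "L-lipschitz_on UNIV f" "\<And>z. \<bar>f z\<bar> \<le> C"
    and K: "finite K" and A: "\<And>\<kappa>. \<kappa> \<in> K \<Longrightarrow> A \<kappa> \<in> events" and disj: "disjoint_family_on A K"
    and B: "B \<in> events" and e: "0 \<le> e"
    and close: "\<And>\<kappa> \<omega>. \<kappa> \<in> K \<Longrightarrow> \<omega> \<in> A \<kappa> \<Longrightarrow> \<omega> \<in> B \<Longrightarrow> dist (Z \<omega>) (g \<kappa>) \<le> e"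
  shows "\<bar>expectation (\<lambda>\<omega>. f (Z \<omega>)) - (\<Sum>\<kappa>\<in>K. prob (A \<kappa>) * f (g \<kappa>))\<bar>
    \<le> L * e + 2 * C * ((1 - (\<Sum>\<kappa>\<in>K. prob (A \<kappa>))) + (1 - prob B))"
proof -
  have L: "0 \<le> L" using f by (auto simp: lipschitz_on_def)
  have C: "0 \<le> C" using f(2) abs_ge_zero order_trans by blast
  have f_meas: "f \<in> borel_measurable borel"
    using lipschitz_on_continuous_on[OF f(1)] by (rule borel_measurable_continuous_onI)
  have int: "integrable M (\<lambda>\<omega>. f (Z \<omega>))"
    by (rule integrable_const_bound[where B = C]) (use f measurable_compose[OF Z f_meas] in auto)
  let ?h = "\<lambda>\<omega>. \<Sum>\<kappa>\<in>K. indicator (A \<kappa>) \<omega> * f (g \<kappa>)"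
  let ?U = "\<Union>\<kappa>\<in>K. A \<kappa>"
  have U: "?U \<in> events" using K A by auto
  have inth: "integrable M ?h"
    using A by (intro Bochner_Integration.integrable_sum integrable_mult_left) (auto simp: emeasure_eq_measure)
  have pU: "prob ?U = (\<Sum>\<kappa>\<in>K. prob (A \<kappa>))"
    using finite_measure_finite_Union[OF K _ disj] A by auto
  have h_eq: "?h \<omega> = f (g \<kappa>)" if "\<kappa> \<in> K" "\<omega> \<in> A \<kappa>" for \<omega> \<kappa>
  proof -
    have "?h \<omega> = (\<Sum>\<kappa>'\<in>K. if \<kappa>' = \<kappa> then f (g \<kappa>) else 0)"
      using that disj by (intro sum.cong) (auto simp: disjoint_family_on_def indicator_def)
    then show ?thesis using that K by simp
  qed
  have bound: "\<bar>f (Z \<omega>) - ?h \<omega>\<bar> \<le> L * e + 2 * C * (indicator (space M - ?U) \<omega> + indicator (space M - B) \<omega>)"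
    if \<omega>: "\<omega> \<in> space M" for \<omega>
  proof (cases "\<omega> \<in> ?U")
    case True
    then obtain \<kappa> where \<kappa>: "\<kappa> \<in> K" "\<omega> \<in> A \<kappa>" by auto
    show ?thesis
    proof (cases "\<omega> \<in> B")
      case B: True
      have "\<bar>f (Z \<omega>) - f (g \<kappa>)\<bar> \<le> L * dist (Z \<omega>) (g \<kappa>)"
        using lipschitz_onD[OF f(1), of "Z \<omega>" "g \<kappa>"] by (simp add: dist_real_def)
      also have "\<dots> \<le> L * e" using close[OF \<kappa> B] L by (intro mult_left_mono)
      finally show ?thesis using C by (simp add: h_eq[OF \<kappa>] add_increasing2)
    next
      case False
      then have "\<bar>f (Z \<omega>) - f (g \<kappa>)\<bar> \<le> 2 * C"
        using f(2)[of "Z \<omega>"] f(2)[of "g \<kappa>"] by (simp add: abs_le_iff)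
      also have "\<dots> \<le> L * e + 2 * C * (indicator (space M - ?U) \<omega> + indicator (space M - B) \<omega>)"
        using False \<omega> L e C by (auto simp: indicator_def)
      finally show ?thesis by (simp add: h_eq[OF \<kappa>])
    qed
  next
    case False
    then have h0: "?h \<omega> = 0" by (intro sum.neutral) (auto simp: indicator_def)
    have "\<bar>f (Z \<omega>)\<bar> \<le> 2 * C" using f(2)[of "Z \<omega>"] C by linarith
    also have "\<dots> \<le> L * e + 2 * C * (indicator (space M - ?U) \<omega> + indicator (space M - B) \<omega>)"
      using False \<omega> L e C by (auto simp: indicator_def)
    finally show ?thesis by (simp only: h0)
  qed
  have "expectation (\<lambda>\<omega>. f (Z \<omega>)) - (\<Sum>\<kappa>\<in>K. prob (A \<kappa>) * f (g \<kappa>))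
      = expectation (\<lambda>\<omega>. f (Z \<omega>) - ?h \<omega>)"
    using int inth A by (simp add: integral_diff integral_sum emeasure_eq_measure)
  also have "\<bar>\<dots>\<bar> \<le> expectation (\<lambda>\<omega>. \<bar>f (Z \<omega>) - ?h \<omega>\<bar>)"
    by (rule integral_abs_bound)
  also have "\<dots> \<le> expectation (\<lambda>\<omega>. L * e + 2 * C * (indicator (space M - ?U) \<omega> + indicator (space M - B) \<omega>))"
    using int inth bound U B by (intro integral_mono) (auto simp: emeasure_eq_measure)
  also have "\<dots> = L * e + 2 * C * (prob (space M - ?U) + prob (space M - B))"
    using U B by (simp add: emeasure_eq_measure prob_space)
  finally show ?thesis using U B by (simp add: prob_compl pU)
qed

text \<open>One finite index set and one map g serve the sequence and the limit alike. The mass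
  bound is asked of the limit events A' only: the events A d inherit it from the convergence of
  their finitely many probabilities. The hypothesis has elimination form so that all sets may be
  chosen after e.\<close>

lemma conv_in_distribution_finite_approxI:
  fixes Z :: "nat \<Rightarrow> 'a \<Rightarrow> 'x :: metric_space"
  assumes M: "\<And>d. prob_space (M d)" and M': "prob_space M'"
    and Z: "\<And>d. Z d \<in> borel_measurable (M d)" and Z': "Z' \<in> borel_measurable M'"
    and approx: "\<And>e thesis. 0 < e \<Longrightarrow>
      (\<And>(K :: 'k set) g A B A' B'. finite K \<Longrightarrow>
        (\<And>d \<kappa>. \<kappa> \<in> K \<Longrightarrow> A d \<kappa> \<in> sets (M d)) \<Longrightarrow> (\<And>d. disjoint_family_on (A d) K) \<Longrightarrow>
        (\<And>d. B d \<in> sets (M d)) \<Longrightarrow>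
        (\<And>d \<kappa> \<omega>. \<kappa> \<in> K \<Longrightarrow> \<omega> \<in> A d \<kappa> \<Longrightarrow> \<omega> \<in> B d \<Longrightarrow> dist (Z d \<omega>) (g \<kappa>) \<le> e) \<Longrightarrow>
        (\<And>\<kappa>. \<kappa> \<in> K \<Longrightarrow> A' \<kappa> \<in> sets M') \<Longrightarrow> disjoint_family_on A' K \<Longrightarrow> B' \<in> sets M' \<Longrightarrow>
        (\<And>\<kappa> \<omega>. \<kappa> \<in> K \<Longrightarrow> \<omega> \<in> A' \<kappa> \<Longrightarrow> \<omega> \<in> B' \<Longrightarrow> dist (Z' \<omega>) (g \<kappa>) \<le> e) \<Longrightarrow>
        (\<And>\<kappa>. \<kappa> \<in> K \<Longrightarrow> (\<lambda>d. measure (M d) (A d \<kappa>)) \<longlonglongrightarrow> measure M' (A' \<kappa>)) \<Longrightarrow>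
        1 - e \<le> (\<Sum>\<kappa>\<in>K. measure M' (A' \<kappa>)) \<Longrightarrow>
        (\<forall>\<^sub>F d in sequentially. 1 - e \<le> measure (M d) (B d)) \<Longrightarrow> 1 - e \<le> measure M' B' \<Longrightarrow> thesis)
      \<Longrightarrow> thesis"
  shows "conv_in_distribution M Z M' Z'"
proof (rule conv_in_distribution_lipschitzI[OF M M' Z Z'])
  fix f :: "'x \<Rightarrow> real" and L C assume f: "L-lipschitz_on UNIV f" "\<And>z. \<bar>f z\<bar> \<le> C"
  have L: "0 \<le> L" using f by (auto simp: lipschitz_on_def)
  have C: "0 \<le> C" using f(2) abs_ge_zero order_trans by blast
  show "(\<lambda>d. \<integral>\<omega>. f (Z d \<omega>) \<partial>M d) \<longlonglongrightarrow> (\<integral>\<omega>. f (Z' \<omega>) \<partial>M')"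
  proof (rule tendstoI)
    fix r :: real assume r: "0 < r"
    \<comment> \<open>The budget: L e + 6 C e on the sequence side, where the A d may miss mass 2 e
      and B d mass e; L e + 4 C e on the limit side; e for the difference of the finite sums; one e
      of slack.\<close>
    define e where "e = r / (2 * L + 10 * C + 2)"
    have e: "0 < e" using r L C by (simp add: e_def)
    show "\<forall>\<^sub>F d in sequentially. dist (\<integral>\<omega>. f (Z d \<omega>) \<partial>M d) (\<integral>\<omega>. f (Z' \<omega>) \<partial>M') < r"
    proof (rule approx[OF e])
      fix K :: "'k set" and g A B A' B' assume K: "finite K"
        and A: "\<And>d \<kappa>. \<kappa> \<in> K \<Longrightarrow> A d \<kappa> \<in> sets (M d)" "\<And>d. disjoint_family_on (A d) K"
        and B: "\<And>d. B d \<in> sets (M d)"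
        and close: "\<And>d \<kappa> \<omega>. \<kappa> \<in> K \<Longrightarrow> \<omega> \<in> A d \<kappa> \<Longrightarrow> \<omega> \<in> B d \<Longrightarrow> dist (Z d \<omega>) (g \<kappa>) \<le> e"
        and A': "\<And>\<kappa>. \<kappa> \<in> K \<Longrightarrow> A' \<kappa> \<in> sets M'" "disjoint_family_on A' K"
        and B': "B' \<in> sets M'"
        and close': "\<And>\<kappa> \<omega>. \<kappa> \<in> K \<Longrightarrow> \<omega> \<in> A' \<kappa> \<Longrightarrow> \<omega> \<in> B' \<Longrightarrow> dist (Z' \<omega>) (g \<kappa>) \<le> e"
        and lim: "\<And>\<kappa>. \<kappa> \<in> K \<Longrightarrow> (\<lambda>d. measure (M d) (A d \<kappa>)) \<longlonglongrightarrow> measure M' (A' \<kappa>)"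
        and sum: "1 - e \<le> (\<Sum>\<kappa>\<in>K. measure M' (A' \<kappa>))"
        and PB: "\<forall>\<^sub>F d in sequentially. 1 - e \<le> measure (M d) (B d)" and PB': "1 - e \<le> measure M' B'"
      let ?s = "\<lambda>d. \<Sum>\<kappa>\<in>K. measure (M d) (A d \<kappa>)" and ?s' = "\<Sum>\<kappa>\<in>K. measure M' (A' \<kappa>)"
      let ?t = "\<lambda>d. \<Sum>\<kappa>\<in>K. measure (M d) (A d \<kappa>) * f (g \<kappa>)" and ?t' = "\<Sum>\<kappa>\<in>K. measure M' (A' \<kappa>) * f (g \<kappa>)"
      have 1: "\<forall>\<^sub>F d in sequentially. ?s' - e < ?s d"
        using e by (intro order_tendstoD(1)[OF tendsto_sum[OF lim]]) auto
      have "?t \<longlonglongrightarrow> ?t'" by (intro tendsto_sum tendsto_mult_right lim)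
      then have 2: "\<forall>\<^sub>F d in sequentially. dist (?t d) ?t' < e" using e by (rule tendstoD)
      interpret M': prob_space M' by (rule M')
      have 3: "\<bar>(\<integral>\<omega>. f (Z' \<omega>) \<partial>M') - ?t'\<bar> \<le> L * e + 2 * C * ((1 - ?s') + (1 - measure M' B'))"
        by (rule M'.expectation_finite_approx[OF Z' f K A' B' less_imp_le[OF e] close'])
      also have "\<dots> \<le> L * e + 2 * C * (e + e)"
        using sum PB' C by (intro add_left_mono mult_left_mono add_mono) auto
      finally have 3: "\<bar>(\<integral>\<omega>. f (Z' \<omega>) \<partial>M') - ?t'\<bar> \<le> L * e + 4 * C * e" by simp
      show "\<forall>\<^sub>F d in sequentially. dist (\<integral>\<omega>. f (Z d \<omega>) \<partial>M d) (\<integral>\<omega>. f (Z' \<omega>) \<partial>M') < r"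
        using 1 2 PB
      proof eventually_elim
        case (elim d)
        interpret Md: prob_space "M d" by (rule M)
        have "\<bar>(\<integral>\<omega>. f (Z d \<omega>) \<partial>M d) - ?t d\<bar> \<le> L * e + 2 * C * ((1 - ?s d) + (1 - measure (M d) (B d)))"
          by (rule Md.expectation_finite_approx[OF Z f K A B less_imp_le[OF e] close])
        also have "\<dots> \<le> L * e + 2 * C * (2 * e + e)"
          using elim sum C by (intro add_left_mono mult_left_mono add_mono) auto
        finally have "\<bar>(\<integral>\<omega>. f (Z d \<omega>) \<partial>M d) - ?t d\<bar> \<le> L * e + 6 * C * e" by simp
        moreover have "\<bar>?t d - ?t'\<bar> < e" using elim by (simp add: dist_real_def)
        ultimately have "\<bar>(\<integral>\<omega>. f (Z d \<omega>) \<partial>M d) - (\<integral>\<omega>. f (Z' \<omega>) \<partial>M')\<bar> < (2 * L + 10 * C + 1) * e"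
          using 3 by (simp add: algebra_simps abs_less_iff abs_le_iff)
        also have "\<dots> \<le> (2 * L + 10 * C + 2) * e" using e by (intro mult_right_mono) auto
        also have "\<dots> = r" using L C by (simp add: e_def)
        finally show ?case by (simp add: dist_real_def)
      qed
    qed
  qed
qed

section \<open>Gromov--Hausdorff distances of near-orthogonal walks\<close>

lemma nonempty_compact_submetric:
  fixes A :: "'a :: metric_space set"
  assumes "compact A" "A \<noteq> {}"
  shows "nonempty_compact (submetric euclidean_metric A)"
  using assms by (simp add: nonempty_compact_def mtopology_of_submetric compact_space_subtopology)

lemma dist_gh_of_set:
  assumes "compact A" "A \<noteq> {}" "compact B" "B \<noteq> {}"
  shows "dist (gh_of_set A) (gh_of_set B) =
    gh_dist (submetric euclidean_metric A) (submetric euclidean_metric B)"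
  unfolding gh_of_set_def by (intro dist_gh_class nonempty_compact_submetric assms)

text \<open>The ambient distance, restricted to A and B, is itself a coupling.
  \<open>gh_couple\<close> asks for strict inequalities, hence the detour through r' > r.\<close>

lemma dist_gh_of_set_le_hausdorff:
  assumes A: "compact A" "A \<noteq> {}" and B: "compact B" "B \<noteq> {}"
    and AB: "\<And>a. a \<in> A \<Longrightarrow> \<exists>b\<in>B. dist a b \<le> r" and BA: "\<And>b. b \<in> B \<Longrightarrow> \<exists>a\<in>A. dist a b \<le> r"
  shows "dist (gh_of_set A) (gh_of_set B) \<le> r"
proof (rule dense_ge)
  fix r' assume r': "r < r'"
  show "dist (gh_of_set A) (gh_of_set B) \<le> r'"
    unfolding dist_gh_of_set[OF A B]
  proof (rule gh_couple_imp_gh_dist_le[OF nonempty_compact_submetric[OF A] nonempty_compact_submetric[OF B]])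
    show "gh_couple (submetric euclidean_metric A) (submetric euclidean_metric B) r' dist"
      unfolding gh_couple_def
    proof (intro conjI ballI)
      show "\<exists>y\<in>mspace (submetric euclidean_metric B). dist x y < r'"
        if "x \<in> mspace (submetric euclidean_metric A)" for x
        using AB[of x] that r' by (auto intro: le_less_trans)
      show "\<exists>x\<in>mspace (submetric euclidean_metric A). dist x y < r'"
        if "y \<in> mspace (submetric euclidean_metric B)" for y
        using BA[of y] that r' by (auto intro: le_less_trans)
    qed (auto intro: dist_triangle dist_triangle2 dist_triangle3)
  qed
qed

text \<open>The two point families are glued along the correspondence \<open>w j \<leftrightarrow> g j\<close>, whose distortion
  is at most \<open>\<eta>\<close>.\<close>

lemma dist_gh_of_set_le_distortion:
  fixes w g :: "nat \<Rightarrow> l2"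
  assumes J: "finite J" "J \<noteq> {}"
    and dis: "\<And>i j. i \<in> J \<Longrightarrow> j \<in> J \<Longrightarrow> \<bar>dist (w i) (w j) - dist (g i) (g j)\<bar> \<le> \<eta>"
  shows "dist (gh_of_set (w ` J)) (gh_of_set (g ` J)) \<le> \<eta>"
proof (rule dense_ge)
  fix r assume r: "\<eta> < r"
  have A: "compact (w ` J)" "w ` J \<noteq> {}" "compact (g ` J)" "g ` J \<noteq> {}"
    using J by (auto intro: finite_imp_compact)
  have \<eta>: "0 \<le> \<eta>" using J dis by (metis abs_ge_zero order_trans ex_in_conv)
  \<comment> \<open>Cheapest route from x to y across a bridge of length \<eta> from some w j to g
    j. Comparing two points of the same side uses two crossings, whose cost 2 \<eta> covers the
    distortion.\<close>
  define \<delta> where "\<delta> x y = Min ((\<lambda>j. dist x (w j) + \<eta> + dist (g j) y) ` J)" for x y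
  have le: "\<delta> x y \<le> dist x (w j) + \<eta> + dist (g j) y" if "j \<in> J" for x y j
    unfolding \<delta>_def using that J by (intro Min_le) auto
  have ex: "\<exists>j\<in>J. \<delta> x y = dist x (w j) + \<eta> + dist (g j) y" for x y
  proof -
    have "\<delta> x y \<in> (\<lambda>j. dist x (w j) + \<eta> + dist (g j) y) ` J"
      unfolding \<delta>_def using J by (intro Min_in) auto
    then show ?thesis by blast
  qed
  show "dist (gh_of_set (w ` J)) (gh_of_set (g ` J)) \<le> r"
    unfolding dist_gh_of_set[OF A]
  proof (rule gh_couple_imp_gh_dist_le[OF nonempty_compact_submetric[OF A(1,2)] nonempty_compact_submetric[OF A(3,4)]])
    have 1: "0 \<le> \<delta> x y" for x y using ex[of x y] \<eta> by auto
    have 2: "dist x x' \<le> \<delta> x y + \<delta> x' y" for x x' y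
    proof -
      obtain j where j: "j \<in> J" "\<delta> x y = dist x (w j) + \<eta> + dist (g j) y" using ex by blast
      obtain j' where j': "j' \<in> J" "\<delta> x' y = dist x' (w j') + \<eta> + dist (g j') y" using ex by blast
      have "dist x x' \<le> dist x (w j) + dist (w j) (w j') + dist x' (w j')"
        using dist_triangle[of x x' "w j"] dist_triangle[of "w j" x' "w j'"] dist_commute[of x' "w j'"] by linarith
      moreover have "dist (g j) (g j') \<le> dist (g j) y + dist (g j') y" by (rule dist_triangle2)
      ultimately show ?thesis using dis[OF j(1) j'(1)] j(2) j'(2) \<eta> by (simp add: abs_le_iff)
    qed
    have 3: "dist y y' \<le> \<delta> x y + \<delta> x y'" for x y y'
    proof -
      obtain j where j: "j \<in> J" "\<delta> x y = dist x (w j) + \<eta> + dist (g j) y" using ex by blast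
      obtain j' where j': "j' \<in> J" "\<delta> x y' = dist x (w j') + \<eta> + dist (g j') y'" using ex by blast
      have "dist y y' \<le> dist (g j) y + dist (g j) (g j') + dist (g j') y'"
        using dist_triangle[of y y' "g j"] dist_triangle[of "g j" y' "g j'"] dist_commute[of y "g j"] by linarith
      moreover have "dist (w j) (w j') \<le> dist x (w j) + dist x (w j')" by (rule dist_triangle3)
      ultimately show ?thesis using dis[OF j(1) j'(1)] j(2) j'(2) \<eta> by (simp add: abs_le_iff)
    qed
    have 4: "\<delta> x y \<le> dist x x' + \<delta> x' y" for x x' y
    proof -
      obtain j where j: "j \<in> J" "\<delta> x' y = dist x' (w j) + \<eta> + dist (g j) y" using ex by blast
      show ?thesis using le[OF j(1), of x y] j(2) dist_triangle[of x "w j" x'] by simp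
    qed
    have 5: "\<delta> x y \<le> \<delta> x y' + dist y' y" for x y y'
    proof -
      obtain j where j: "j \<in> J" "\<delta> x y' = dist x (w j) + \<eta> + dist (g j) y'" using ex by blast
      show ?thesis using le[OF j(1), of x y] j(2) dist_triangle[of "g j" y y'] by simp
    qed
    have 6: "\<delta> (w j) (g j) < r" if "j \<in> J" for j
      using le[OF that, of "w j" "g j"] r by simp
    show "gh_couple (submetric euclidean_metric (w ` J)) (submetric euclidean_metric (g ` J)) r \<delta>"
      unfolding gh_couple_def
    proof (intro conjI ballI)
      show "\<exists>y\<in>mspace (submetric euclidean_metric (g ` J)). \<delta> x y < r"
        if "x \<in> mspace (submetric euclidean_metric (w ` J))" for x
        using 6 that by auto
      show "\<exists>x\<in>mspace (submetric euclidean_metric (w ` J)). \<delta> x y < r"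
        if "y \<in> mspace (submetric euclidean_metric (g ` J))" for y
        using 6 that by auto
    qed (simp_all add: 1 2 3 4 5)
  qed
qed

lemma inner_l2_basis: "i \<noteq> j \<Longrightarrow> inner (l2_basis i) (l2_basis j) = 0"
proof -
  assume "i \<noteq> j"
  then have "(\<lambda>k. l2_nth (l2_basis i) k * l2_nth (l2_basis j) k) = (\<lambda>_. 0)" by auto
  then show ?thesis by (simp add: inner_l2_def)
qed

text \<open>Expand the square: there are card S diagonal terms, each off by at most \<delta>1, and
  fewer than (card S)^2 off-diagonal ones (none if S is empty), each at most \<delta>2.\<close>

lemma norm_sum_near_orthogonal:
  fixes W :: "'i \<Rightarrow> 'a :: real_inner" and r :: "'i \<Rightarrow> real" and \<delta>1 \<delta>2 :: real
  assumes S: "finite S"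
    and sq: "\<And>i. i \<in> S \<Longrightarrow> \<bar>(norm (W i))\<^sup>2 - r i\<bar> \<le> \<delta>1"
    and orth: "\<And>i j. i \<in> S \<Longrightarrow> j \<in> S \<Longrightarrow> i \<noteq> j \<Longrightarrow> \<bar>inner (W i) (W j)\<bar> \<le> \<delta>2" and "0 \<le> \<delta>2"
  shows "\<bar>(norm (\<Sum>i\<in>S. W i))\<^sup>2 - (\<Sum>i\<in>S. r i)\<bar> \<le> real (card S) * \<delta>1 + (real (card S))\<^sup>2 * \<delta>2"
proof -
  have "(norm (\<Sum>i\<in>S. W i))\<^sup>2 = (\<Sum>i\<in>S. \<Sum>j\<in>S. inner (W i) (W j))"
    by (simp add: power2_norm_eq_inner inner_sum_left inner_sum_right) (rule sum.swap)
  also have "\<dots> = (\<Sum>i\<in>S. (norm (W i))\<^sup>2 + (\<Sum>j\<in>S - {i}. inner (W i) (W j)))"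
    unfolding power2_norm_eq_inner by (intro sum.cong refl sum.remove S)
  finally have "(norm (\<Sum>i\<in>S. W i))\<^sup>2 - (\<Sum>i\<in>S. r i) =
      (\<Sum>i\<in>S. ((norm (W i))\<^sup>2 - r i) + (\<Sum>j\<in>S - {i}. inner (W i) (W j)))"
    by (simp add: sum.distrib sum_subtractf)
  also have "\<bar>\<dots>\<bar> \<le> (\<Sum>i\<in>S. \<delta>1 + real (card S) * \<delta>2)"
  proof (rule order_trans[OF sum_abs], intro sum_mono order_trans[OF abs_triangle_ineq] add_mono)
    fix i assume i: "i \<in> S"
    show "\<bar>(norm (W i))\<^sup>2 - r i\<bar> \<le> \<delta>1" by (rule sq[OF i])
    have "\<bar>\<Sum>j\<in>S - {i}. inner (W i) (W j)\<bar> \<le> (\<Sum>j\<in>S - {i}. \<delta>2)"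
      by (rule order_trans[OF sum_abs]) (intro sum_mono orth, use i in auto)
    also have "\<dots> \<le> real (card S) * \<delta>2"
      using \<open>0 \<le> \<delta>2\<close> S by (simp add: card_Diff1_le mult_right_mono)
    finally show "\<bar>\<Sum>j\<in>S - {i}. inner (W i) (W j)\<bar> \<le> real (card S) * \<delta>2" .
  qed
  also have "\<dots> = real (card S) * \<delta>1 + (real (card S))\<^sup>2 * \<delta>2" by (simp add: algebra_simps power2_eq_square)
  finally show ?thesis .
qed

section \<open>Staircases: the deterministic spaces attached to words\<close>

text \<open>The corner points of a path with orthogonal steps of squared lengths r 0, ..., r (q -
  1). Entries r i = 0, used for blocks without a large jump, merely repeat a point.\<close>

definition staircase :: "nat \<Rightarrow> (nat \<Rightarrow> real) \<Rightarrow> l2 set"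
  where "staircase q r = (\<lambda>m. \<Sum>i<m. sqrt (r i) *\<^sub>R l2_basis i) ` {..q}"

text \<open>Since |a - b| \<le> a + b, the square of a - b is at most the difference of the squares.
  This passes from squared distances to distances even where the distances are close to 0.\<close>

lemma abs_diff_le_sqrt:
  fixes a b c :: real
  assumes "0 \<le> a" "0 \<le> b" "\<bar>a\<^sup>2 - b\<^sup>2\<bar> \<le> c"
  shows "\<bar>a - b\<bar> \<le> sqrt c"
proof (rule real_le_rsqrt)
  have "\<bar>a - b\<bar>\<^sup>2 \<le> \<bar>a - b\<bar> * (a + b)"
    using assms by (simp only: power2_eq_square) (intro mult_left_mono, auto)
  also have "\<dots> = \<bar>a\<^sup>2 - b\<^sup>2\<bar>"
    using assms by (simp add: power2_eq_square square_diff_square_factored abs_mult mult.commute)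
  finally show "\<bar>a - b\<bar>\<^sup>2 \<le> c" using assms by simp
qed

text \<open>The m-th partial sum corresponds to the m-th corner. The difference of two partial sums
  is a sum over an interval of at most q indices, whose squared norm is nearly the sum of the r i;
  on the staircase side it is exactly that sum.\<close>

lemma dist_gh_staircase:
  fixes W :: "nat \<Rightarrow> l2" and r :: "nat \<Rightarrow> real" and \<delta>1 \<delta>2 :: real
  assumes sq: "\<And>i. i < q \<Longrightarrow> \<bar>(norm (W i))\<^sup>2 - r i\<bar> \<le> \<delta>1" and r: "\<And>i. i < q \<Longrightarrow> 0 \<le> r i"
    and orth: "\<And>i j. i < q \<Longrightarrow> j < q \<Longrightarrow> i \<noteq> j \<Longrightarrow> \<bar>inner (W i) (W j)\<bar> \<le> \<delta>2"
    and \<delta>: "0 \<le> \<delta>1" "0 \<le> \<delta>2"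
  shows "dist (gh_of_set ((\<lambda>m. \<Sum>i<m. W i) ` {..q})) (gh_of_set (staircase q r)) \<le> sqrt (real q * \<delta>1 + (real q)\<^sup>2 * \<delta>2)"
  unfolding staircase_def
proof (rule dist_gh_of_set_le_distortion)
  let ?g = "\<lambda>i. sqrt (r i) *\<^sub>R l2_basis i"
  have *: "\<bar>dist (\<Sum>i<m. W i) (\<Sum>i<l. W i) - dist (\<Sum>i<m. ?g i) (\<Sum>i<l. ?g i)\<bar> \<le> sqrt (real q * \<delta>1 + (real q)\<^sup>2 * \<delta>2)"
    if lm: "l \<le> m" "m \<le> q" for l m
  proof (rule abs_diff_le_sqrt)
    have d: "dist (\<Sum>i<m. f i) (\<Sum>i<l. f i) = norm (\<Sum>i\<in>{l..<m}. f i)" for f :: "nat \<Rightarrow> l2"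
      unfolding dist_norm using sum_diff_nat_ivl[of 0 l m f] lm by (simp add: atLeast0LessThan)
    have 1: "\<bar>(norm (\<Sum>i\<in>{l..<m}. W i))\<^sup>2 - (\<Sum>i\<in>{l..<m}. r i)\<bar>
        \<le> real (card {l..<m}) * \<delta>1 + (real (card {l..<m}))\<^sup>2 * \<delta>2"
      using lm \<delta> sq orth by (intro norm_sum_near_orthogonal) auto
    have 2: "\<bar>(norm (\<Sum>i\<in>{l..<m}. ?g i))\<^sup>2 - (\<Sum>i\<in>{l..<m}. r i)\<bar>
        \<le> real (card {l..<m}) * 0 + (real (card {l..<m}))\<^sup>2 * 0"
      using lm \<delta> r by (intro norm_sum_near_orthogonal) (auto simp: inner_l2_basis)
    have 3: "real (card {l..<m}) * \<delta>1 + (real (card {l..<m}))\<^sup>2 * \<delta>2 \<le> real q * \<delta>1 + (real q)\<^sup>2 * \<delta>2"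
      using lm \<delta> by (intro add_mono mult_right_mono of_nat_mono power_mono) auto
    show "\<bar>(dist (\<Sum>i<m. W i) (\<Sum>i<l. W i))\<^sup>2 - (dist (\<Sum>i<m. ?g i) (\<Sum>i<l. ?g i))\<^sup>2\<bar> \<le> real q * \<delta>1 + (real q)\<^sup>2 * \<delta>2"
      using 1 2 3 unfolding d by simp
  qed auto
  show "\<bar>dist (\<Sum>i<m. W i) (\<Sum>i<l. W i) - dist (\<Sum>i<m. ?g i) (\<Sum>i<l. ?g i)\<bar> \<le> sqrt (real q * \<delta>1 + (real q)\<^sup>2 * \<delta>2)"
    if "m \<in> {..q}" "l \<in> {..q}" for l m
    using *[of l m] *[of m l] that by (cases "l \<le> m") (auto simp: dist_commute)
qed auto

section \<open>Time blocks and the comparison of jump paths with staircases\<close>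

text \<open>Open on the left, so the blocks i < q partition (0, T] and time 0 belongs to none of
  them; all jump times considered are strictly positive.\<close>

definition time_block :: "real \<Rightarrow> nat \<Rightarrow> nat \<Rightarrow> real set"
  where "time_block T q i = {T * real i / real q <.. T * real (Suc i) / real q}"

lemma time_block_le:
  assumes "u \<in> time_block T q i" "i < q" "0 < T" shows "u \<le> T"
proof -
  have "u \<le> T * real (Suc i) / real q" using assms by (simp add: time_block_def)
  also have "\<dots> \<le> T * real q / real q"
    using assms by (intro divide_right_mono mult_left_mono) auto
  finally show ?thesis using assms by simp
qed

lemma disjoint_time_block:
  assumes "0 < T" "i \<noteq> j" shows "time_block T q i \<inter> time_block T q j = {}"
proof -
  have *: "time_block T q i \<inter> time_block T q j = {}" if "i < j" for i j
  proof -
    have "T * real (Suc i) / real q \<le> T * real j / real q"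
      using that assms by (intro divide_right_mono mult_left_mono) auto
    then show ?thesis by (auto simp: time_block_def)
  qed
  show ?thesis using *[of i j] *[of j i] assms(2) by (cases "i < j") auto
qed

lemma time_block_exists:
  assumes "0 < T" "0 < q" "0 < t" "t \<le> T"
  shows "\<exists>i<q. t \<in> time_block T q i"
proof -
  define c where "c = \<lceil>t * q / T\<rceil>"
  have c: "of_int c - 1 < t * q / T" "t * q / T \<le> of_int c"
    unfolding c_def by linarith+
  have "0 < t * q / T" using assms by simp
  then have c0: "0 < c" using c by linarith
  define i where "i = nat (c - 1)"
  have i: "real i = of_int c - 1" using c0 by (simp add: i_def)
  have "t * q / T \<le> q" using assms by (simp add: field_simps)
  then have "real i < real q" using c i by linarith
  moreover have "t \<in> time_block T q i"
    using c assms unfolding time_block_def by (simp add: i field_simps)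
  ultimately show ?thesis by auto
qed

lemma sum_time_blocks:
  fixes V :: "nat \<Rightarrow> 'a :: comm_monoid_add"
  assumes D: "finite D" and \<tau>: "\<And>k. k \<in> D \<Longrightarrow> 0 < \<tau> k" and T: "0 < T" and q: "0 < q"
  shows "(\<Sum>k\<in>{k\<in>D. \<tau> k \<le> T * real m / real q}. V k) =
    (\<Sum>i<m. \<Sum>k\<in>{k\<in>D. \<tau> k \<in> time_block T q i}. V k)"
proof (induction m)
  case 0
  have "{k\<in>D. \<tau> k \<le> T * real 0 / real q} = {}" using \<tau> by force
  then show ?case by (simp only: sum.empty lessThan_0)
next
  case (Suc m)
  have le: "T * real m / real q \<le> T * real (Suc m) / real q"
    using T q by (intro divide_right_mono mult_left_mono) auto
  have "{k\<in>D. \<tau> k \<le> T * real (Suc m) / real q} =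
      {k\<in>D. \<tau> k \<le> T * real m / real q} \<union> {k\<in>D. \<tau> k \<in> time_block T q m}"
    using le by (auto simp: time_block_def)
  then have "(\<Sum>k\<in>{k\<in>D. \<tau> k \<le> T * real (Suc m) / real q}. V k) =
     (\<Sum>k\<in>{k\<in>D. \<tau> k \<le> T * real m / real q}. V k) + (\<Sum>k\<in>{k\<in>D. \<tau> k \<in> time_block T q m}. V k)"
    using D by (simp only:) (intro sum.union_disjoint, auto simp: time_block_def)
  then show ?case by (simp add: Suc.IH)
qed

text \<open>Shared by the walk, whose range A is finite, and the subordinator, whose range A is the
  closure of the path. D indexes the large jumps V at times \<tau>, and \<eta> bounds what they
  leave out, uniformly in time. As no block holds two large jumps, the jump sum at any time is the
  sum over some number of complete blocks, which is a point of the near-orthogonal path compared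
  with the staircase.\<close>

lemma dist_gh_path_staircase:
  fixes V :: "nat \<Rightarrow> l2" and path :: "real \<Rightarrow> l2" and \<tau> r :: "nat \<Rightarrow> real" and \<eta> \<delta>1 \<delta>2 :: real
  assumes A: "compact A" "path ` {0..T} \<subseteq> A" "A \<subseteq> closure (path ` {0..T})"
    and D: "finite D" and \<tau>: "\<And>k. k \<in> D \<Longrightarrow> 0 < \<tau> k" and T: "0 < T" and q: "0 < q"
    and path: "\<And>t. 0 \<le> t \<Longrightarrow> t \<le> T \<Longrightarrow> norm (path t - (\<Sum>k\<in>{k\<in>D. \<tau> k \<le> t}. V k)) \<le> \<eta>"
    and blocks: "\<And>i. i < q \<Longrightarrow> {k\<in>D. \<tau> k \<in> time_block T q i} = {} \<and> r i = 0 \<or>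
      (\<exists>k. {k\<in>D. \<tau> k \<in> time_block T q i} = {k} \<and> \<bar>(norm (V k))\<^sup>2 - r i\<bar> \<le> \<delta>1)"
    and r: "\<And>i. i < q \<Longrightarrow> 0 \<le> r i"
    and orth: "\<And>k k'. k \<in> D \<Longrightarrow> k' \<in> D \<Longrightarrow> \<tau> k \<le> T \<Longrightarrow> \<tau> k' \<le> T \<Longrightarrow> k \<noteq> k' \<Longrightarrow> \<bar>inner (V k) (V k')\<bar> \<le> \<delta>2"
    and \<delta>: "0 \<le> \<delta>1" "0 \<le> \<delta>2"
  shows "dist (gh_of_set A) (gh_of_set (staircase q r)) \<le> \<eta> + sqrt (real q * \<delta>1 + (real q)\<^sup>2 * \<delta>2)"
proof -
  define Di where "Di i = {k\<in>D. \<tau> k \<in> time_block T q i}" for i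
  define W where "W i = (\<Sum>k\<in>Di i. V k)" for i
  have sumW: "(\<Sum>k\<in>{k\<in>D. \<tau> k \<le> T * real m / real q}. V k) = (\<Sum>i<m. W i)" for m
    using sum_time_blocks[OF D \<tau> T q] by (simp add: W_def Di_def)
  have cases: "Di i = {} \<and> r i = 0 \<or> (\<exists>k. Di i = {k} \<and> \<bar>(norm (V k))\<^sup>2 - r i\<bar> \<le> \<delta>1)" if "i < q" for i
    using blocks[OF that] by (simp add: Di_def)
  have 1: "dist (gh_of_set ((\<lambda>m. \<Sum>i<m. W i) ` {..q})) (gh_of_set (staircase q r)) \<le> sqrt (real q * \<delta>1 + (real q)\<^sup>2 * \<delta>2)"
  proof (rule dist_gh_staircase[OF _ r _ \<delta>])
    show "\<bar>(norm (W i))\<^sup>2 - r i\<bar> \<le> \<delta>1" if "i < q" for i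
      using cases[OF that] \<delta> by (auto simp: W_def)
    show "\<bar>inner (W i) (W j)\<bar> \<le> \<delta>2" if ij: "i < q" "j < q" "i \<noteq> j" for i j
    proof (cases "Di i = {} \<or> Di j = {}")
      case True
      then show ?thesis using \<delta> by (auto simp: W_def)
    next
      case False
      then obtain k k' where k: "Di i = {k}" "Di j = {k'}"
        using cases[OF ij(1)] cases[OF ij(2)] by auto
      have kD: "k \<in> Di i" "k' \<in> Di j" using k by auto
      have "k \<noteq> k'" using kD disjoint_time_block[OF T ij(3), of q] by (auto simp: Di_def)
      then have "\<bar>inner (V k) (V k')\<bar> \<le> \<delta>2"
        using kD ij(1,2) time_block_le[OF _ _ T] by (intro orth) (auto simp: Di_def)
      then show ?thesis by (simp add: W_def k)
    qed
  qed
  have near: "\<exists>m\<le>q. dist (path t) (\<Sum>i<m. W i) \<le> \<eta>" if t: "0 \<le> t" "t \<le> T" for t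
  proof -
    have "\<exists>m\<le>q. (\<Sum>k\<in>{k\<in>D. \<tau> k \<le> t}. V k) = (\<Sum>i<m. W i)"
    proof (cases "t = 0")
      case True
      then have "{k\<in>D. \<tau> k \<le> t} = {}" using \<tau> by force
      then show ?thesis by (intro exI[of _ 0]) (simp only: sum.empty, simp)
    next
      case False
      then obtain i where i: "i < q" "t \<in> time_block T q i" using time_block_exists[OF T q, of t] t by auto
      have *: "{k\<in>D. \<tau> k \<le> t} = {k\<in>D. \<tau> k \<le> T * real i / real q} \<union> {k\<in>Di i. \<tau> k \<le> t}"
        using i by (auto simp: Di_def time_block_def)
      have "(\<Sum>k\<in>{k\<in>D. \<tau> k \<le> t}. V k) = (\<Sum>i<i. W i) + (\<Sum>k\<in>{k\<in>Di i. \<tau> k \<le> t}. V k)"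
        unfolding * sumW[symmetric] using D
        by (intro sum.union_disjoint) (auto simp: Di_def time_block_def)
      \<comment> \<open>The only possible jump of the current block has happened or not, so the sum
        stops at block i or at its successor.\<close>
      moreover have "{k\<in>Di i. \<tau> k \<le> t} = {} \<or> {k\<in>Di i. \<tau> k \<le> t} = Di i"
        using cases[OF i(1)] by auto
      ultimately have "(\<Sum>k\<in>{k\<in>D. \<tau> k \<le> t}. V k) = (\<Sum>i<i. W i) \<or>
          (\<Sum>k\<in>{k\<in>D. \<tau> k \<le> t}. V k) = (\<Sum>i<Suc i. W i)"
        by (elim disjE) (simp_all only: sum.empty add_0_right sum.lessThan_Suc W_def simp_thms)
      then show ?thesis using i(1) by (meson Suc_leI less_imp_le)
    qed
    then show ?thesis using path[OF t] by (metis dist_norm)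
  qed
  have 2: "dist (gh_of_set A) (gh_of_set ((\<lambda>m. \<Sum>i<m. W i) ` {..q})) \<le> \<eta>"
  \<comment> \<open>Points of A are merely limits of path points, which costs an arbitrarily small
    e.\<close>
  proof (rule field_le_epsilon)
    fix e :: real assume e: "0 < e"
    show "dist (gh_of_set A) (gh_of_set ((\<lambda>m. \<Sum>i<m. W i) ` {..q})) \<le> \<eta> + e"
    proof (rule dist_gh_of_set_le_hausdorff)
      show "A \<noteq> {}" using A T by (auto simp: subset_iff)
      fix a assume "a \<in> A"
      then obtain t where t: "0 \<le> t" "t \<le> T" "dist (path t) a < e"
        using A(3) e by (force simp: closure_approachable)
      then obtain m where "m \<le> q" "dist (path t) (\<Sum>i<m. W i) \<le> \<eta>" using near by blast
      then show "\<exists>b\<in>(\<lambda>m. \<Sum>i<m. W i) ` {..q}. dist a b \<le> \<eta> + e"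
        using t(3) dist_triangle[of a "\<Sum>i<m. W i" "path t"]
        by (intro bexI[of _ "\<Sum>i<m. W i"]) (auto simp: dist_commute)
    next
      fix b assume "b \<in> (\<lambda>m. \<Sum>i<m. W i) ` {..q}"
      then obtain m where m: "m \<le> q" "b = (\<Sum>i<m. W i)" by auto
      have t: "0 \<le> T * real m / real q" "T * real m / real q \<le> T"
        using T q m by (auto simp: field_simps)
      then have "dist (path (T * real m / real q)) b \<le> \<eta>"
        using path[OF t] by (simp only: sumW m dist_norm)
      then show "\<exists>a\<in>A. dist a b \<le> \<eta> + e"
        using t A(2) e by (intro bexI[of _ "path (T * real m / real q)"]) auto
    qed (use A in \<open>auto intro: finite_imp_compact\<close>)
  qed
  show ?thesis
    using 1 2 dist_triangle[of "gh_of_set A" "gh_of_set (staircase q r)"] by (meson add_mono order_trans)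
qed

section \<open>Maximal inequality and pairs of steps\<close>

text \<open>The joint law is a product. Integrating over Y first leaves
  \<open>inner u (expectation Y)\<close>, which is 0 for every value u of H; boundedness supplies
  integrability.\<close>

lemma (in prob_space) expectation_inner_indep_mean_zero:
  fixes H Y :: "'a \<Rightarrow> 'b :: {real_inner, banach, second_countable_topology}"
  assumes ind: "indep_var borel H borel Y"
    and H: "\<And>\<omega>. norm (H \<omega>) \<le> c" and Y: "\<And>\<omega>. norm (Y \<omega>) \<le> C" and mean: "expectation Y = 0"
  shows "expectation (\<lambda>\<omega>. inner (H \<omega>) (Y \<omega>)) = 0"
proof -
  note * = ind[unfolded indep_var_distribution_eq]
  have [measurable]: "H \<in> borel_measurable M" "Y \<in> borel_measurable M" using * by auto
  have eq: "distr M (borel \<Otimes>\<^sub>M borel) (\<lambda>\<omega>. (H \<omega>, Y \<omega>)) = distr M borel H \<Otimes>\<^sub>M distr M borel Y"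
    using * by simp
  have iY: "integrable M Y" by (rule integrable_const_bound[where B = C]) (use Y in auto)
  have iH: "integrable M (\<lambda>\<omega>. inner (H \<omega>) (Y \<omega>))"
  proof (rule integrable_const_bound[where B = "c * C"])
    have "0 \<le> c" using H norm_ge_zero order_trans by blast
    then show "AE \<omega> in M. norm (inner (H \<omega>) (Y \<omega>)) \<le> c * C"
      using order_trans[OF Cauchy_Schwarz_ineq2 mult_mono[OF H Y]] by auto
  qed simp
  interpret H: prob_space "distr M borel H" by (rule prob_space_distr) simp
  interpret Y: prob_space "distr M borel Y" by (rule prob_space_distr) simp
  interpret pair: pair_prob_space "distr M borel H" "distr M borel Y" ..
  have "integrable (distr M (borel \<Otimes>\<^sub>M borel) (\<lambda>\<omega>. (H \<omega>, Y \<omega>))) (\<lambda>(u, v). inner u v)"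
    by (subst integrable_distr_eq) (use iH in auto)
  then have int: "integrable (distr M borel H \<Otimes>\<^sub>M distr M borel Y) (\<lambda>(u, v). inner u v)"
    by (simp only: eq)
  have inner0: "(\<integral>v. inner u v \<partial>distr M borel Y) = 0" for u
  proof -
    have "(\<integral>v. inner u v \<partial>distr M borel Y) = (\<integral>\<omega>. inner u (Y \<omega>) \<partial>M)"
      by (subst integral_distr) auto
    also have "\<dots> = inner u (expectation Y)" using iY by simp
    finally show ?thesis by (simp add: mean)
  qed
  have "expectation (\<lambda>\<omega>. inner (H \<omega>) (Y \<omega>)) =
      (\<integral>z. (\<lambda>(u, v). inner u v) z \<partial>distr M (borel \<Otimes>\<^sub>M borel) (\<lambda>\<omega>. (H \<omega>, Y \<omega>)))"
    by (subst integral_distr) auto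
  also have "\<dots> = (\<integral>u. (\<integral>v. inner u v \<partial>distr M borel Y) \<partial>distr M borel H)"
    unfolding eq using pair.integral_fst'[OF int] by simp
  finally show ?thesis by (simp add: inner0)
qed

section \<open>Kolmogorov's maximal inequality for vectors\<close>

text \<open>A function of a deterministic sequence rather than of \<omega>: its value at k reads
  only the entries below k, which makes it independent of step k when random steps are
  inserted.\<close>

primrec stopped_walk :: "real \<Rightarrow> (nat \<Rightarrow> 'b :: real_normed_vector) \<Rightarrow> nat \<Rightarrow> 'b"
  where "stopped_walk \<eta> y 0 = 0"
  | "stopped_walk \<eta> y (Suc k) =
      stopped_walk \<eta> y k + (if norm (stopped_walk \<eta> y k) < \<eta> then y k else 0)"

lemma stopped_walk_eq:
  "(\<And>k. k < N \<Longrightarrow> norm (\<Sum>i<k. y i) < \<eta>) \<Longrightarrow> stopped_walk \<eta> y N = (\<Sum>i<N. y i)"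
  by (induction N) (auto simp: less_Suc_eq)

text \<open>Up to the first index k0 at which the free walk reaches \<eta> both walks agree, and
  from then on the stopped one stays where it is. A crossing at any time up to N is thus visible at
  time N.\<close>

lemma stopped_walk_reached:
  assumes "k \<le> N" "\<eta> \<le> norm (\<Sum>i<k. y i)"
  shows "\<eta> \<le> norm (stopped_walk \<eta> y N)"
proof -
  define k0 where "k0 = (LEAST k. \<eta> \<le> norm (\<Sum>i<k. y i))"
  have k0: "\<eta> \<le> norm (\<Sum>i<k0. y i)" "k0 \<le> k"
    unfolding k0_def using assms(2) by (auto intro: LeastI Least_le)
  have "norm (\<Sum>i<j. y i) < \<eta>" if "j < k0" for j
    using not_less_Least[OF that[unfolded k0_def]] by simp
  then have "stopped_walk \<eta> y k0 = (\<Sum>i<k0. y i)" by (rule stopped_walk_eq)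
  then have reached: "\<eta> \<le> norm (stopped_walk \<eta> y k0)" using k0 by simp
  have frozen: "stopped_walk \<eta> y N = stopped_walk \<eta> y k0"
    if "k0 \<le> N" "\<eta> \<le> norm (stopped_walk \<eta> y k0)" for N
    using that by (induction N rule: dec_induct) auto
  show ?thesis unfolding frozen[OF order_trans[OF k0(2) assms(1)] reached] by (rule reached)
qed

lemma stopped_walk_cong:
  "(\<And>i. i < k \<Longrightarrow> y i = y' i) \<Longrightarrow> stopped_walk \<eta> y k = stopped_walk \<eta> y' k"
  by (induction k) auto

lemma norm_stopped_walk_le:
  assumes "\<And>i. norm (y i) \<le> C"
  shows "norm (stopped_walk \<eta> y k) \<le> real k * C"
proof (induction k)
  case (Suc k)
  have C: "0 \<le> C" using assms norm_ge_zero order_trans by blast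
  have "norm (stopped_walk \<eta> y (Suc k)) \<le> norm (stopped_walk \<eta> y k) + norm (y k)"
    by (auto intro: norm_triangle_ineq)
  also have "\<dots> \<le> real k * C + C" by (intro add_mono Suc.IH assms)
  finally show ?case by (simp add: algebra_simps)
qed simp

lemma measurable_stopped_walk [measurable (raw)]:
  fixes y :: "'c \<Rightarrow> nat \<Rightarrow> 'b :: {real_normed_vector, second_countable_topology}"
  assumes "\<And>i. i < k \<Longrightarrow> (\<lambda>\<omega>. y \<omega> i) \<in> borel_measurable M"
  shows "(\<lambda>\<omega>. stopped_walk \<eta> (y \<omega>) k) \<in> borel_measurable M"
  using assms
proof (induction k)
  case (Suc k)
  have [measurable]: "(\<lambda>\<omega>. stopped_walk \<eta> (y \<omega>) k) \<in> borel_measurable M"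
    "(\<lambda>\<omega>. y \<omega> k) \<in> borel_measurable M" using Suc by auto
  show ?case by simp
qed simp

text \<open>Kolmogorov's argument: freezing the walk when its norm first reaches \<open>\<eta>\<close> keeps the
  increments orthogonal, so the second moment of the frozen walk is still at most \<open>N * v\<close>.\<close>

lemma (in prob_space) maximal_inequality:
  fixes Y :: "nat \<Rightarrow> 'a \<Rightarrow> 'b :: {real_inner, banach, second_countable_topology}"
  assumes ind: "indep_vars (\<lambda>_. borel) Y UNIV" and C: "\<And>i \<omega>. norm (Y i \<omega>) \<le> C"
    and mean: "\<And>i. expectation (Y i) = 0" and var: "\<And>i. expectation (\<lambda>\<omega>. (norm (Y i \<omega>))\<^sup>2) \<le> v"
    and \<eta>: "0 < \<eta>"
  shows "prob {\<omega> \<in> space M. \<exists>k\<le>N. \<eta> \<le> norm (\<Sum>i<k. Y i \<omega>)} \<le> real N * v / \<eta>\<^sup>2"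
proof -
  have [measurable]: "Y i \<in> borel_measurable M" for i
    using ind by (auto simp: indep_vars_def2)
  define Z where "Z k \<omega> = stopped_walk \<eta> (\<lambda>i. Y i \<omega>) k" for k \<omega>
  have [measurable]: "Z k \<in> borel_measurable M" for k
    unfolding Z_def by measurable
  have C0: "0 \<le> C" using C norm_ge_zero order_trans by blast
  have Zb: "norm (Z k \<omega>) \<le> real k * C" for k \<omega>
    unfolding Z_def by (rule norm_stopped_walk_le) (rule C)
  have intZ: "integrable M (\<lambda>\<omega>. (norm (Z k \<omega>))\<^sup>2)" for k
    by (rule integrable_const_bound[where B = "(real k * C)\<^sup>2"]) (use Zb in \<open>auto intro!: power_mono\<close>)
  have intY: "integrable M (\<lambda>\<omega>. (norm (Y k \<omega>))\<^sup>2)" for k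
    by (rule integrable_const_bound[where B = "C\<^sup>2"]) (use C in \<open>auto intro!: power_mono\<close>)
  have step: "expectation (\<lambda>\<omega>. (norm (Z (Suc k) \<omega>))\<^sup>2) \<le> expectation (\<lambda>\<omega>. (norm (Z k \<omega>))\<^sup>2) + v" for k
  proof -
    \<comment> \<open>The position of the walk while it still moves, and 0 once it is frozen. In
      this way the cross term of the squared increment is
      \<open>inner (H \<omega>) (Y k \<omega>)\<close> in both cases, with H depending on the steps
      below k only.\<close>
    define h where "h y = (if norm (stopped_walk \<eta> y k) < \<eta> then stopped_walk \<eta> y k else 0)"
      for y :: "nat \<Rightarrow> 'b"
    define H where "H \<omega> = h (\<lambda>i. Y i \<omega>)" for \<omega>
    have H: "H \<omega> = h (restrict (\<lambda>i. Y i \<omega>) {..<k})" for \<omega>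
      unfolding H_def h_def by (simp cong: stopped_walk_cong if_cong)
    have "indep_var (PiM {..<k} (\<lambda>_. borel)) (\<lambda>\<omega>. restrict (\<lambda>i. Y i \<omega>) {..<k})
        (PiM {k} (\<lambda>_. borel)) (\<lambda>\<omega>. restrict (\<lambda>i. Y i \<omega>) {k})"
      using indep_var_restrict[OF ind, of "{..<k}" "{k}"] by simp
    then have "indep_var borel (h \<circ> (\<lambda>\<omega>. restrict (\<lambda>i. Y i \<omega>) {..<k}))
        borel ((\<lambda>f. f k) \<circ> (\<lambda>\<omega>. restrict (\<lambda>i. Y i \<omega>) {k}))"
    proof (rule indep_var_compose)
      have [measurable]: "(\<lambda>y :: nat \<Rightarrow> 'b. stopped_walk \<eta> y k) \<in> borel_measurable (PiM {..<k} (\<lambda>_. borel))"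
        by (rule measurable_stopped_walk) simp
      show "h \<in> borel_measurable (PiM {..<k} (\<lambda>_. borel))"
        unfolding h_def by measurable
    qed simp
    moreover have "h \<circ> (\<lambda>\<omega>. restrict (\<lambda>i. Y i \<omega>) {..<k}) = H"
      "(\<lambda>f. f k) \<circ> (\<lambda>\<omega>. restrict (\<lambda>i. Y i \<omega>) {k}) = Y k"
      by (auto simp: H)
    ultimately have indH: "indep_var borel H borel (Y k)" by simp
    then have [measurable]: "H \<in> borel_measurable M" by (auto simp: indep_var_distribution_eq)
    have Hb: "norm (H \<omega>) \<le> real k * C" for \<omega>
      using Zb[of k \<omega>] C0 by (auto simp: H_def h_def Z_def)
    have zero: "expectation (\<lambda>\<omega>. inner (H \<omega>) (Y k \<omega>)) = 0"
      by (rule expectation_inner_indep_mean_zero[OF indH Hb C mean])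
    have intH: "integrable M (\<lambda>\<omega>. inner (H \<omega>) (Y k \<omega>))"
    proof (rule integrable_const_bound[where B = "real k * C * C"])
      show "AE \<omega> in M. norm (inner (H \<omega>) (Y k \<omega>)) \<le> real k * C * C"
        using order_trans[OF Cauchy_Schwarz_ineq2 mult_mono[OF Hb C]] C0 by auto
    qed simp
    \<comment> \<open>An equality while the walk moves; after freezing, the square of Y k is added
      on the right for free.\<close>
    have "(norm (Z (Suc k) \<omega>))\<^sup>2 \<le> (norm (Z k \<omega>))\<^sup>2 + (2 * inner (H \<omega>) (Y k \<omega>) + (norm (Y k \<omega>))\<^sup>2)" for \<omega>
      by (simp add: Z_def H_def h_def power2_norm_eq_inner inner_add inner_commute)
    then have "expectation (\<lambda>\<omega>. (norm (Z (Suc k) \<omega>))\<^sup>2)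
        \<le> expectation (\<lambda>\<omega>. (norm (Z k \<omega>))\<^sup>2 + (2 * inner (H \<omega>) (Y k \<omega>) + (norm (Y k \<omega>))\<^sup>2))"
      using intZ intY intH by (intro integral_mono) auto
    also have "\<dots> = expectation (\<lambda>\<omega>. (norm (Z k \<omega>))\<^sup>2) + expectation (\<lambda>\<omega>. (norm (Y k \<omega>))\<^sup>2)"
      using intZ intY intH by (simp add: zero)
    finally show ?thesis using var[of k] by simp
  qed
  have E: "expectation (\<lambda>\<omega>. (norm (Z k \<omega>))\<^sup>2) \<le> real k * v" for k
  proof (induction k)
    case (Suc k)
    then show ?case using step[of k] by (simp add: algebra_simps)
  qed (simp add: Z_def)
  have "prob {\<omega> \<in> space M. \<exists>k\<le>N. \<eta> \<le> norm (\<Sum>i<k. Y i \<omega>)} \<le> prob {\<omega> \<in> space M. \<eta>\<^sup>2 \<le> (norm (Z N \<omega>))\<^sup>2}"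
    using \<eta> by (intro finite_measure_mono) (auto simp: Z_def intro!: power_mono stopped_walk_reached)
  also have "\<dots> \<le> expectation (\<lambda>\<omega>. (norm (Z N \<omega>))\<^sup>2) / \<eta>\<^sup>2"
    using \<eta> by (intro integral_Markov_inequality_measure[where A = "space M"] intZ) auto
  also have "\<dots> \<le> real N * v / \<eta>\<^sup>2" using E[of N] by (intro divide_right_mono) auto
  finally show ?thesis .
qed

text \<open>Union bound over at most N^2 ordered pairs. Every pair of distinct steps has the product
  law \<mu> \<times> \<mu>, so the pair (0, 1) represents all of them.\<close>

lemma (in prob_space) prob_pairs_le:
  fixes \<xi> :: "nat \<Rightarrow> 'a \<Rightarrow> 'b :: {second_countable_topology, topological_space}"
  assumes ind: "indep_vars (\<lambda>_. borel) \<xi> UNIV" and id: "\<And>i. distr M borel (\<xi> i) = \<mu>"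
    and \<Phi>: "Measurable.pred (borel \<Otimes>\<^sub>M borel) (case_prod \<Phi>)"
  shows "prob {\<omega> \<in> space M. \<exists>i<N. \<exists>j<N. i \<noteq> j \<and> \<Phi> (\<xi> i \<omega>) (\<xi> j \<omega>)}
    \<le> (real N)\<^sup>2 * prob {\<omega> \<in> space M. \<Phi> (\<xi> 0 \<omega>) (\<xi> 1 \<omega>)}"
proof -
  have [measurable]: "\<xi> i \<in> borel_measurable M" for i
    using ind by (auto simp: indep_vars_def2)
  have pair: "prob {\<omega> \<in> space M. \<Phi> (\<xi> i \<omega>) (\<xi> j \<omega>)} = measure (\<mu> \<Otimes>\<^sub>M \<mu>) {z. case_prod \<Phi> z}"
    if "i \<noteq> j" for i j
  proof -
    have "indep_var borel ((\<lambda>f. f i) \<circ> (\<lambda>\<omega>. restrict (\<lambda>i. \<xi> i \<omega>) {i}))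
        borel ((\<lambda>f. f j) \<circ> (\<lambda>\<omega>. restrict (\<lambda>i. \<xi> i \<omega>) {j}))"
      by (rule indep_var_compose[OF indep_var_restrict[OF ind, of "{i}" "{j}"]]) (use that in auto)
    then have "indep_var borel (\<xi> i) borel (\<xi> j)" by (simp add: comp_def)
    then have eq: "\<mu> \<Otimes>\<^sub>M \<mu> = distr M (borel \<Otimes>\<^sub>M borel) (\<lambda>\<omega>. (\<xi> i \<omega>, \<xi> j \<omega>))"
      by (simp add: indep_var_distribution_eq id)
    show ?thesis unfolding eq
      using \<Phi> by (subst measure_distr) (auto simp: vimage_def Int_def pred_def space_pair_measure conj_commute)
  qed
  have [measurable]: "Measurable.pred M (\<lambda>\<omega>. \<Phi> (\<xi> i \<omega>) (\<xi> j \<omega>))" for i j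
    using measurable_compose[OF _ \<Phi>, of "\<lambda>\<omega>. (\<xi> i \<omega>, \<xi> j \<omega>)" M] by simp
  let ?I = "{(i, j). i < N \<and> j < N \<and> i \<noteq> j}"
  have fin: "finite ?I" by (rule finite_subset[of _ "{..<N} \<times> {..<N}"]) auto
  have "card ?I \<le> card ({..<N} \<times> {..<N})" by (rule card_mono) auto
  then have card: "real (card ?I) \<le> (real N)\<^sup>2"
    unfolding card_cartesian_product power2_eq_square of_nat_mult[symmetric] of_nat_le_iff by simp
  have "prob {\<omega> \<in> space M. \<exists>i<N. \<exists>j<N. i \<noteq> j \<and> \<Phi> (\<xi> i \<omega>) (\<xi> j \<omega>)}
      = prob (\<Union>z\<in>?I. {\<omega> \<in> space M. \<Phi> (\<xi> (fst z) \<omega>) (\<xi> (snd z) \<omega>)})"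
    by (intro arg_cong[where f = prob]) force
  also have "\<dots> \<le> (\<Sum>z\<in>?I. prob {\<omega> \<in> space M. \<Phi> (\<xi> (fst z) \<omega>) (\<xi> (snd z) \<omega>)})"
    using fin by (intro finite_measure_subadditive_finite) auto
  also have "\<dots> = (\<Sum>z\<in>?I. prob {\<omega> \<in> space M. \<Phi> (\<xi> 0 \<omega>) (\<xi> 1 \<omega>)})"
    by (intro sum.cong refl) (auto simp: pair)
  also have "\<dots> \<le> (real N)\<^sup>2 * prob {\<omega> \<in> space M. \<Phi> (\<xi> 0 \<omega>) (\<xi> 1 \<omega>)}"
    using card by (simp add: mult_right_mono)
  finally show ?thesis .
qed

section \<open>Tails of the jump measure\<close>

lemma ennreal_le_imp_pos: "0 < t \<Longrightarrow> ennreal t \<le> x \<Longrightarrow> 0 < x"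
  using less_le_trans[of 0 "ennreal t" x] by simp

lemma ennreal_dense_real:
  assumes "ennreal t < z" "0 \<le> t"
  obtains r where "t < r" "ennreal r < z"
proof (cases z)
  case (real y)
  then have "t < y" using assms by (simp add: ennreal_less_iff)
  then obtain r where "t < r" "r < y" using dense by blast
  then show ?thesis using real that assms by (simp add: ennreal_less_iff)
next
  case top
  then show ?thesis using that[of "t + 1"] by simp
qed

locale subordinator_measure =
  fixes \<nu> :: "ennreal measure"
  assumes sets_\<nu>: "sets \<nu> = sets (restrict_space borel {0<..})"
    and \<nu>_int: "(\<integral>\<^sup>+z\<in>{0<..<\<infinity>}. min 1 z \<partial>\<nu>) < \<infinity>"
    and \<nu>_top: "emeasure \<nu> {\<infinity>} = 0"
begin

lemmas \<nu>_top' = \<nu>_top[unfolded infinity_ennreal_def]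

lemma space_\<nu>: "space \<nu> = {0<..}"
  using sets_eq_imp_space_eq[OF sets_\<nu>] by (simp add: space_restrict_space)

lemma in_sets_\<nu>: "A \<in> sets \<nu> \<longleftrightarrow> A \<subseteq> {0<..} \<and> A \<in> sets borel"
  unfolding sets_\<nu> by (subst sets_restrict_space_iff) auto

lemma borel_measurable_\<nu>:
  "f \<in> borel_measurable borel \<Longrightarrow> f \<in> borel_measurable \<nu>"
  unfolding measurable_cong_sets[OF sets_\<nu> refl] by (rule measurable_restrict_space1)

lemma greaterThan_in_sets: "{ennreal t<..} \<in> sets \<nu>"
  by (auto simp: in_sets_\<nu> intro: le_less_trans)

lemma atLeast_in_sets: "0 < t \<Longrightarrow> {ennreal t..} \<in> sets \<nu>"
  by (auto simp: in_sets_\<nu> ennreal_le_imp_pos)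

text \<open>On [t, \<infinity>) the integrand min 1 z is at least min 1 t > 0, so a Markov bound
  applies; the point \<infinity> carries no mass.\<close>

lemma finite_atLeast:
  assumes t: "0 < t" shows "emeasure \<nu> {ennreal t..} < \<infinity>"
proof -
  let ?m = "min 1 (ennreal t)"
  have m: "?m \<noteq> 0" using t by (auto simp: min_def)
  have s: "{ennreal t..<\<infinity>} \<in> sets \<nu>" using t by (auto simp: in_sets_\<nu> ennreal_le_imp_pos)
  have "?m * emeasure \<nu> {ennreal t..<\<infinity>} = (\<integral>\<^sup>+z. ?m * indicator {ennreal t..<\<infinity>} z \<partial>\<nu>)"
    by (rule nn_integral_cmult_indicator[OF s, symmetric])
  also have "\<dots> \<le> (\<integral>\<^sup>+z\<in>{0<..<\<infinity>}. min 1 z \<partial>\<nu>)"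
  proof (rule nn_integral_mono)
    fix z
    show "?m * indicator {ennreal t..<\<infinity>} z \<le> min 1 z * indicator {0<..<\<infinity>} z"
    proof (cases "ennreal t \<le> z \<and> z < \<infinity>")
      case True
      then show ?thesis using ennreal_le_imp_pos[OF t, of z] by (simp add: min.coboundedI2)
    qed (auto simp: indicator_def)
  qed
  finally have "?m * emeasure \<nu> {ennreal t..<\<infinity>} < \<infinity>" using \<nu>_int by (rule le_less_trans)
  then have "emeasure \<nu> {ennreal t..<\<infinity>} < \<infinity>" using m by (auto simp: ennreal_mult_less_top)
  moreover have "emeasure \<nu> {ennreal t..} \<le> emeasure \<nu> {ennreal t..<\<infinity>} + emeasure \<nu> {\<infinity>}"
  proof -
    have "{ennreal t..} \<subseteq> {ennreal t..<\<infinity>} \<union> {\<infinity>}" by (auto simp: less_top[symmetric])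
    then have "emeasure \<nu> {ennreal t..} \<le> emeasure \<nu> ({ennreal t..<\<infinity>} \<union> {\<infinity>})"
      using s by (intro emeasure_mono sets.Un) (auto simp: in_sets_\<nu>)
    also have "\<dots> \<le> emeasure \<nu> {ennreal t..<\<infinity>} + emeasure \<nu> {\<infinity>}"
      using s by (intro emeasure_subadditive) (auto simp: in_sets_\<nu>)
    finally show ?thesis .
  qed
  ultimately show ?thesis by (simp add: \<nu>_top' le_less_trans)
qed

lemma finite_greaterThan:
  assumes "0 < t" shows "emeasure \<nu> {ennreal t<..} < \<infinity>"
  using finite_atLeast[OF assms]
  by (rule le_less_trans[rotated]) (intro emeasure_mono atLeast_in_sets[OF assms], auto)

sublocale sigma_finite_measure \<nu>
proof
  let ?A = "range (\<lambda>n :: nat. {ennreal (1 / real (Suc n))..})"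
  have "\<Union>?A = space \<nu>"
  proof
    show "space \<nu> \<subseteq> \<Union>?A"
    proof
      fix z :: ennreal assume "z \<in> space \<nu>"
      then have z: "0 < z" by (simp add: space_\<nu>)
      obtain r where r: "0 < r" "ennreal r \<le> z"
      proof (cases z)
        case (real y)
        then show ?thesis using z that[of y] by simp
      next
        case top
        then show ?thesis using that[of 1] by simp
      qed
      obtain n where "1 / real (Suc n) < r" using r(1) by (rule nat_approx_posE)
      then have "ennreal (1 / real (Suc n)) \<le> z"
        using r by (meson ennreal_leI less_imp_le order_trans)
      then show "z \<in> \<Union>?A" by auto
    qed
  next
    show "\<Union>?A \<subseteq> space \<nu>"
      by (auto simp: space_\<nu> simp del: of_nat_Suc intro!: ennreal_le_imp_pos[of "1 / real (Suc _)"])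
  qed
  moreover have "\<forall>a\<in>?A. emeasure \<nu> a \<noteq> \<infinity>" using finite_atLeast by (auto simp: less_top)
  moreover have "?A \<subseteq> sets \<nu>" using atLeast_in_sets by auto
  ultimately show "\<exists>A. countable A \<and> A \<subseteq> sets \<nu> \<and> \<Union>A = space \<nu> \<and> (\<forall>a\<in>A. emeasure \<nu> a \<noteq> \<infinity>)"
    by (intro exI[of _ ?A]) auto
qed

abbreviation tail :: "real \<Rightarrow> real"
  where "tail t \<equiv> measure \<nu> {ennreal t<..}"

lemma tail_mono: "0 < u \<Longrightarrow> u \<le> w \<Longrightarrow> tail w \<le> tail u"
  by (intro measure_mono_fmeasurable greaterThan_in_sets)
    (auto simp: fmeasurable_def greaterThan_in_sets finite_greaterThan[unfolded infinity_ennreal_def] intro: le_less_trans ennreal_leI)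

text \<open>The tails decrease to the mass of the point \<infinity>, so this is where
  \<open>\<nu>_top\<close> enters.\<close>

lemma tail_at_top: "(tail \<longlongrightarrow> 0) at_top"
proof -
  have "(\<lambda>n. tail (real (Suc n))) \<longlonglongrightarrow> measure \<nu> (\<Inter>n. {ennreal (real (Suc n))<..})"
    using finite_greaterThan
    by (intro Lim_measure_decseq) (auto simp: greaterThan_in_sets decseq_def less_top simp del: of_nat_Suc intro: le_less_trans ennreal_leI)
  moreover have "(\<Inter>n. {ennreal (real (Suc n))<..}) = {\<infinity>}"
  proof -
    have *: "\<exists>n. z \<le> ennreal (real (Suc n))" if z: "z \<noteq> \<infinity>" for z
    proof -
      obtain r where r: "z = ennreal r" using z by (cases z) auto
      obtain n where "r \<le> real n" using real_arch_simple by blast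
      then show ?thesis unfolding r by (intro exI[of _ n] ennreal_leI) simp
    qed
    show ?thesis
    proof (intro equalityI subsetI)
      fix z assume z: "z \<in> (\<Inter>n. {ennreal (real (Suc n))<..})"
      show "z \<in> {\<infinity>}"
      proof (rule ccontr)
        assume "z \<notin> {\<infinity>}"
        then obtain n where "z \<le> ennreal (real (Suc n))" using * by blast
        moreover have "ennreal (real (Suc n)) < z" using z by blast
        ultimately show False by simp
      qed
    qed simp
  qed
  ultimately have lim: "(\<lambda>n. tail (real (Suc n))) \<longlonglongrightarrow> 0" by (simp add: measure_def \<nu>_top')
  show ?thesis
  proof (rule tendstoI)
    fix e :: real assume "0 < e"
    then obtain n where n: "tail (real (Suc n)) < e"
      using order_tendstoD(2)[OF lim] by (auto simp: eventually_sequentially)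
    have "dist (tail t) 0 < e" if "real (Suc n) \<le> t" for t
      using tail_mono[OF _ that] n by simp
    then show "\<forall>\<^sub>F t in at_top. dist (tail t) 0 < e" unfolding eventually_at_top_linorder by blast
  qed
qed

text \<open>Restricted to [a, \<infinity>] the measure is finite and has countably many atoms, while
  (a, b) is uncountable.\<close>

lemma null_atom_exists:
  assumes "0 < a" "a < b" shows "\<exists>t. a < t \<and> t < b \<and> emeasure \<nu> {ennreal t} = 0"
proof -
  let ?R = "restrict_space \<nu> {ennreal a..}"
  have a: "{ennreal a..} \<inter> space \<nu> \<in> sets \<nu>" using atLeast_in_sets[OF assms(1)] by simp
  interpret R: finite_measure ?R
  proof (rule finite_measureI)
    have "emeasure ?R (space ?R) = emeasure \<nu> {ennreal a..}"
      using a assms(1) by (subst emeasure_restrict_space)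
        (auto simp: space_restrict_space space_\<nu> ennreal_le_imp_pos intro!: arg_cong[where f = "emeasure \<nu>"])
    then show "emeasure ?R (space ?R) \<noteq> \<infinity>" using finite_atLeast[OF assms(1)] by simp
  qed
  define S where "S = enn2real ` {z. measure ?R {z} \<noteq> 0}"
  have "countable S" unfolding S_def by (intro countable_image R.countable_support)
  then have "\<not> {a<..<b} \<subseteq> S"
    using uncountable_open_interval assms countable_subset by blast
  then obtain t where "t \<in> {a<..<b}" "t \<notin> S" by blast
  then have t: "a < t" "t < b" "t \<notin> S" by simp_all
  have "measure ?R {ennreal t} = 0"
    using t assms unfolding S_def by (force simp: image_iff)
  then have "measure \<nu> {ennreal t} = 0"
    using measure_restrict_space[OF a, of "{ennreal t}"] t by (simp add: ennreal_leI)
  moreover have "emeasure \<nu> {ennreal t} \<noteq> \<infinity>"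
    using emeasure_mono[OF _ atLeast_in_sets, of "{ennreal t}" a] finite_atLeast[OF assms(1)] assms t
    by (auto simp: ennreal_leI top_unique)
  ultimately show ?thesis using t by (auto simp: measure_eq_emeasure_eq_ennreal emeasure_eq_ennreal_measure)
qed

text \<open>Continuity from the right always holds. From the left the tails decrease to the mass of
  [t, \<infinity>], which equals \<open>tail t\<close> because t is not an atom. The strict gaps u <
  t < w leave room for continuous ramps on either side of t.\<close>

lemma tail_continuous:
  assumes t: "0 < t" "emeasure \<nu> {ennreal t} = 0" and e: "0 < e"
  shows "\<exists>u w. 0 < u \<and> u < t \<and> t < w \<and> tail u < tail t + e \<and> tail t - e < tail w"
proof -
  define w where "w n = t + 1 / real (Suc n)" for n
  have w: "t < w n" for n by (simp add: w_def)
  have w_mono: "ennreal (w m) \<le> ennreal (w n)" if "n \<le> m" for n m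
    unfolding w_def using that by (intro ennreal_leI add_left_mono divide_left_mono) auto
  have tw: "ennreal t < z" if "ennreal (w n) < z" for n z
    by (rule le_less_trans[OF ennreal_leI that]) (use w in \<open>simp add: less_imp_le\<close>)
  have "(\<lambda>n. tail (w n)) \<longlonglongrightarrow> measure \<nu> (\<Union>n. {ennreal (w n)<..})"
  proof (rule Lim_measure_incseq)
    have "(\<Union>n. {ennreal (w n)<..}) \<subseteq> {ennreal t<..}" using tw by auto
    then have "emeasure \<nu> (\<Union>n. {ennreal (w n)<..}) \<le> emeasure \<nu> {ennreal t<..}"
      by (intro emeasure_mono greaterThan_in_sets)
    then show "emeasure \<nu> (\<Union>n. {ennreal (w n)<..}) \<noteq> \<infinity>"
      using finite_greaterThan[OF t(1)] by (metis leD infinity_ennreal_def)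
    show "incseq (\<lambda>n. {ennreal (w n)<..})"
      unfolding incseq_def using w_mono by (meson greaterThan_iff le_less_trans subsetI)
    show "range (\<lambda>n. {ennreal (w n)<..}) \<subseteq> sets \<nu>" using greaterThan_in_sets by blast
  qed
  moreover have "(\<Union>n. {ennreal (w n)<..}) = {ennreal t<..}"
  proof (intro equalityI subsetI)
    fix z assume "z \<in> {ennreal t<..}"
    then have z: "ennreal t < z" by simp
    obtain r where r: "t < r" "ennreal r < z"
      using ennreal_dense_real[OF z] t by auto
    obtain n where "1 / real (Suc n) < r - t" using r(1) by (metis diff_gt_0_iff_gt nat_approx_posE)
    then have "ennreal (w n) \<le> ennreal r" unfolding w_def by (intro ennreal_leI) simp
    then show "z \<in> (\<Union>n. {ennreal (w n)<..})" using r le_less_trans by blast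
  qed (use tw in auto)
  ultimately have "(\<lambda>n. tail (w n)) \<longlonglongrightarrow> tail t" by simp
  then have "\<forall>\<^sub>F n in sequentially. tail t - e < tail (w n)"
    using e by (intro order_tendstoD) auto
  then obtain n where n: "tail t - e < tail (w n)" by (auto simp: eventually_sequentially)
  \<comment> \<open>Subtracting a fraction of t keeps all levels positive, where tails are
    finite.\<close>
  define u where "u n = t - t / real (n + 2)" for n
  have u: "0 < u n" "u n < t" for n using t by (auto simp: u_def field_simps intro!: add_pos_nonneg)
  have "(\<lambda>n. tail (u n)) \<longlonglongrightarrow> measure \<nu> (\<Inter>n. {ennreal (u n)<..})"
  proof (rule Lim_measure_decseq)
    have "ennreal (u n) \<le> ennreal (u m)" if "n \<le> m" for n m
      unfolding u_def using that t by (intro ennreal_leI diff_left_mono divide_left_mono) auto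
    then show "decseq (\<lambda>n. {ennreal (u n)<..})"
      unfolding decseq_def by (meson greaterThan_iff le_less_trans subsetI)
    show "range (\<lambda>n. {ennreal (u n)<..}) \<subseteq> sets \<nu>" using greaterThan_in_sets by blast
    show "emeasure \<nu> {ennreal (u n)<..} \<noteq> \<infinity>" for n
      using finite_greaterThan[OF u(1)] by (metis less_irrefl)
  qed
  moreover have "(\<Inter>n. {ennreal (u n)<..}) = {ennreal t..}"
  proof (intro equalityI subsetI)
    fix z assume z: "z \<in> (\<Inter>n. {ennreal (u n)<..})"
    have "(\<lambda>n. t - t / real (n + 2)) \<longlonglongrightarrow> t - 0" by real_asymp
    then have "(\<lambda>n. ennreal (u n)) \<longlonglongrightarrow> ennreal t" unfolding u_def by (intro tendsto_ennrealI) simp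
    moreover have "\<exists>N. \<forall>n\<ge>N. ennreal (u n) \<le> z" using z by (blast intro: less_imp_le)
    ultimately have "ennreal t \<le> z" by (rule LIMSEQ_le_const2)
    then show "z \<in> {ennreal t..}" by simp
  next
    fix z assume "z \<in> {ennreal t..}"
    moreover have "ennreal (u n) < ennreal t" for n
      using u(2)[of n] t(1) by (rule_tac ennreal_lessI)
    ultimately show "z \<in> (\<Inter>n. {ennreal (u n)<..})"
      by (blast intro: less_le_trans)
  qed
  moreover have "measure \<nu> {ennreal t..} = tail t"
  proof -
    have "{ennreal t..} = {ennreal t<..} \<union> {ennreal t}" by auto
    moreover have "emeasure \<nu> ({ennreal t<..} \<union> {ennreal t}) = emeasure \<nu> {ennreal t<..}"
      using t by (intro emeasure_Un_null_set greaterThan_in_sets) (auto simp: null_sets_def in_sets_\<nu>)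
    ultimately show ?thesis by (simp add: measure_def)
  qed
  ultimately have "(\<lambda>n. tail (u n)) \<longlonglongrightarrow> tail t" by simp
  then have "\<forall>\<^sub>F n in sequentially. tail (u n) < tail t + e"
    using e by (intro order_tendstoD) auto
  then obtain m where m: "tail (u m) < tail t + e" by (auto simp: eventually_sequentially)
  show ?thesis using n m u[of m] w[of n] by (intro exI[of _ "u m"] exI[of _ "w n"]) auto
qed

text \<open>Where z \<le> 1 the integrand z equals min 1 z, so the integral is the mass of (0, s]
  under the finite measure with density min 1 z, and these sets decrease to the empty set. The shift
  n + 2 in the levels gives s0 < 1.\<close>

lemma small_jumps_integral:
  assumes e: "0 < e"
  shows "\<exists>s0>0. s0 < 1 \<and> (\<forall>s\<le>s0. (\<integral>\<^sup>+z\<in>{0<..ennreal s}. z \<partial>\<nu>) \<le> ennreal e)"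
proof -
  let ?f = "\<lambda>z. min 1 z * indicator {0<..<\<infinity>} z :: ennreal"
  have f: "?f \<in> borel_measurable \<nu>" by (intro borel_measurable_\<nu>) measurable
  let ?D = "density \<nu> ?f"
  have D: "emeasure ?D A = (\<integral>\<^sup>+z. ?f z * indicator A z \<partial>\<nu>)" if "A \<in> sets \<nu>" for A
    using emeasure_density[OF f that] .
  let ?A = "\<lambda>n :: nat. {0<..ennreal (1 / real (n + 2))}"
  have A: "?A n \<in> sets \<nu>" for n by (auto simp: in_sets_\<nu>)
  have "(\<lambda>n. emeasure ?D (?A n)) \<longlonglongrightarrow> emeasure ?D (\<Inter>n. ?A n)"
  proof (rule Lim_emeasure_decseq)
    show "emeasure ?D (?A n) \<noteq> \<infinity>" for n
    proof -
      have "emeasure ?D (?A n) \<le> (\<integral>\<^sup>+z. ?f z \<partial>\<nu>)"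
        unfolding D[OF A] by (intro nn_integral_mono) (auto simp: indicator_def)
      then show ?thesis using \<nu>_int by auto
    qed
    have "ennreal (1 / real (m + 2)) \<le> ennreal (1 / real (n + 2))" if "n \<le> m" for n m
      using that by (intro ennreal_leI divide_left_mono) auto
    then show "decseq ?A"
      unfolding decseq_def by (meson greaterThanAtMost_iff order_trans subsetI)
  qed (use A in auto)
  moreover have "(\<Inter>n. ?A n) = {}"
  proof -
    have *: "\<exists>n. \<not> z \<le> ennreal (1 / real (n + 2))" if z: "0 < z" for z
    proof -
      have "(\<lambda>n. 1 / real (n + 2)) \<longlonglongrightarrow> 0" by real_asymp
      then have "(\<lambda>n. ennreal (1 / real (n + 2))) \<longlonglongrightarrow> ennreal 0" by (rule tendsto_ennrealI)
      then have "\<forall>\<^sub>F n in sequentially. ennreal (1 / real (n + 2)) < z" using z by (intro order_tendstoD) auto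
      then show ?thesis by (auto simp: eventually_sequentially not_le)
    qed
    show ?thesis
    proof (rule ccontr)
      assume "(\<Inter>n. ?A n) \<noteq> {}"
      then obtain z where z: "\<And>n. z \<in> ?A n" by blast
      then obtain n where "\<not> z \<le> ennreal (1 / real (n + 2))" using *[of z] by auto
      then show False using z[of n] by simp
    qed
  qed
  ultimately have "(\<lambda>n. emeasure ?D (?A n)) \<longlonglongrightarrow> 0" by simp
  then have "\<forall>\<^sub>F n in sequentially. emeasure ?D (?A n) < ennreal e" using e by (intro order_tendstoD) auto
  then obtain n where n: "emeasure ?D (?A n) < ennreal e" by (auto simp: eventually_sequentially)
  have "(\<integral>\<^sup>+z\<in>{0<..ennreal s}. z \<partial>\<nu>) \<le> ennreal e" if s: "s \<le> 1 / real (n + 2)" for s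
  proof -
    have "(\<integral>\<^sup>+z\<in>{0<..ennreal s}. z \<partial>\<nu>) \<le> (\<integral>\<^sup>+z. ?f z * indicator (?A n) z \<partial>\<nu>)"
    proof (rule nn_integral_mono)
      fix z
      have "z \<le> ennreal (1 / real (n + 2)) \<and> z \<le> 1 \<and> z < \<infinity>" if "z \<le> ennreal s"
      proof -
        have 1: "z \<le> ennreal (1 / real (n + 2))" using that s ennreal_leI order_trans by blast
        also have "\<dots> \<le> ennreal 1" by (intro ennreal_leI) simp
        finally show ?thesis using 1 by (auto simp: order_le_less_trans)
      qed
      then show "z * indicator {0<..ennreal s} z \<le> ?f z * indicator (?A n) z"
        by (auto simp: indicator_def min_def)
    qed
    also have "\<dots> = emeasure ?D (?A n)" by (rule D[OF A, symmetric])
    finally show ?thesis using n by simp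
  qed
  then show ?thesis by (intro exI[of _ "1 / real (n + 2)"]) auto
qed

end

section \<open>Continuous ramps: from vague convergence to tail probabilities\<close>

text \<open>Cutting at w before applying \<open>enn2real\<close> makes the ramp continuous at
  \<infinity>. It vanishes up to u, so it is supported in the compact set [u, \<infinity>] and is
  admissible in \<open>vague_conv\<close>, unlike the indicators of tails that it separates.\<close>

definition trapezoid :: "real \<Rightarrow> real \<Rightarrow> ennreal \<Rightarrow> real"
  where "trapezoid u w z = max 0 (min 1 ((enn2real (min z (ennreal w)) - u) / (w - u)))"

lemma trapezoid_bounds: "0 \<le> trapezoid u w z" "trapezoid u w z \<le> 1"
  by (auto simp: trapezoid_def)

lemma trapezoid_eq_0:
  assumes "0 < u" "u < w" "z \<le> ennreal u" shows "trapezoid u w z = 0"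
proof -
  have "enn2real (min z (ennreal w)) \<le> enn2real (ennreal u)"
    using assms by (intro enn2real_mono) (auto simp: min_le_iff_disj)
  then have "(enn2real (min z (ennreal w)) - u) / (w - u) \<le> 0"
    using assms by (intro divide_nonpos_nonneg) auto
  then show ?thesis by (simp add: trapezoid_def min_def)
qed

lemma trapezoid_eq_1:
  assumes "0 < u" "u < w" "ennreal w \<le> z" shows "trapezoid u w z = 1"
  using assms by (simp add: trapezoid_def min_absorb2)

lemma continuous_on_trapezoid:
  assumes "0 < u" "u < w" shows "continuous_on A (trapezoid u w)"
proof -
  have "((\<lambda>z. enn2real (min z (ennreal w))) \<longlongrightarrow> enn2real (min c (ennreal w))) (at c within A)" for c
  proof (rule tendsto_ennrealD)
    have *: "ennreal (enn2real (min z (ennreal w))) = min z (ennreal w)" for z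
      by (intro ennreal_enn2real) (auto simp: min_less_iff_disj)
    show "((\<lambda>z. ennreal (enn2real (min z (ennreal w)))) \<longlongrightarrow> ennreal (enn2real (min c (ennreal w)))) (at c within A)"
      unfolding * by (intro tendsto_min tendsto_const tendsto_ident_at)
  qed auto
  then have "continuous_on A (\<lambda>z. enn2real (min z (ennreal w)))" by (simp add: continuous_on_def)
  then show ?thesis
    unfolding trapezoid_def using assms by (intro continuous_intros) auto
qed

lemma borel_measurable_trapezoid:
  "0 < u \<Longrightarrow> u < w \<Longrightarrow> trapezoid u w \<in> borel_measurable borel"
  by (intro borel_measurable_continuous_onI continuous_on_trapezoid)

lemma (in prob_space) integral_trapezoid_scaled_distr:
  assumes R: "R \<in> borel_measurable M" and uw: "0 < u" "u < w"
  shows "(\<integral>z. trapezoid u w z \<partial>scale_measure (of_nat n)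
      (restrict_space (distr M borel (\<lambda>\<omega>. ennreal (R \<omega>))) {0<..})) = real n * expectation (\<lambda>\<omega>. trapezoid u w (ennreal (R \<omega>)))"
proof -
  let ?D = "distr M borel (\<lambda>\<omega>. ennreal (R \<omega>))"
  have tm: "trapezoid u w \<in> borel_measurable borel" using uw by (rule borel_measurable_trapezoid)
  have m: "(\<lambda>z. ennreal (trapezoid u w z)) \<in> borel_measurable borel" using tm by measurable
  have m': "(\<lambda>\<omega>. trapezoid u w (ennreal (R \<omega>))) \<in> borel_measurable M"
    using R tm by measurable
  have "(\<integral>\<^sup>+z. trapezoid u w z \<partial>scale_measure (of_nat n) (restrict_space ?D {0<..}))
      = of_nat n * (\<integral>\<^sup>+z. ennreal (trapezoid u w z) * indicator {0<..} z \<partial>?D)"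
    using m by (subst nn_integral_scale_measure) (auto intro!: measurable_restrict_space1 simp: nn_integral_restrict_space)
  \<comment> \<open>The restriction to (0, \<infinity>] drops only the point 0, where the ramp
    vanishes.\<close>
  also have "(\<integral>\<^sup>+z. ennreal (trapezoid u w z) * indicator {0<..} z \<partial>?D) = (\<integral>\<^sup>+z. ennreal (trapezoid u w z) \<partial>?D)"
    using trapezoid_eq_0[OF uw] by (intro nn_integral_cong) (auto simp: indicator_def not_less)
  also have "\<dots> = (\<integral>\<^sup>+\<omega>. ennreal (trapezoid u w (ennreal (R \<omega>))) \<partial>M)"
    using R m by (subst nn_integral_distr) auto
  finally have eq: "(\<integral>\<^sup>+z. trapezoid u w z \<partial>scale_measure (of_nat n) (restrict_space ?D {0<..})) =
    of_nat n * (\<integral>\<^sup>+\<omega>. ennreal (trapezoid u w (ennreal (R \<omega>))) \<partial>M)" .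
  have "(\<integral>z. trapezoid u w z \<partial>scale_measure (of_nat n) (restrict_space ?D {0<..})) =
      enn2real (of_nat n * (\<integral>\<^sup>+\<omega>. ennreal (trapezoid u w (ennreal (R \<omega>))) \<partial>M))"
    unfolding eq[symmetric]
  proof (rule integral_eq_nn_integral)
    have "trapezoid u w \<in> borel_measurable (restrict_space ?D {0<..})"
      using tm by (intro measurable_restrict_space1) simp
    then show "trapezoid u w \<in> borel_measurable (scale_measure (of_nat n) (restrict_space ?D {0<..}))"
      by (subst measurable_cong_sets[OF sets_scale_measure refl])
  qed (simp add: trapezoid_bounds)
  also have "\<dots> = real n * enn2real (\<integral>\<^sup>+\<omega>. ennreal (trapezoid u w (ennreal (R \<omega>))) \<partial>M)"
    by (simp add: enn2real_mult)
  also have "enn2real (\<integral>\<^sup>+\<omega>. ennreal (trapezoid u w (ennreal (R \<omega>))) \<partial>M) = expectation (\<lambda>\<omega>. trapezoid u w (ennreal (R \<omega>)))"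
    by (rule integral_eq_nn_integral[symmetric, OF m']) (simp add: trapezoid_bounds)
  finally show ?thesis .
qed

lemma (in prob_space) expectation_trapezoid_bounds:
  assumes [measurable]: "R \<in> borel_measurable M" and uw: "0 < u" "u < w"
  shows "prob {\<omega> \<in> space M. w \<le> R \<omega>} \<le> expectation (\<lambda>\<omega>. trapezoid u w (ennreal (R \<omega>)))" (is ?A)
    and "expectation (\<lambda>\<omega>. trapezoid u w (ennreal (R \<omega>))) \<le> prob {\<omega> \<in> space M. u < R \<omega>}" (is ?B)
proof -
  have tm: "trapezoid u w \<in> borel_measurable borel" using uw by (rule borel_measurable_trapezoid)
  have m': "(\<lambda>\<omega>. trapezoid u w (ennreal (R \<omega>))) \<in> borel_measurable M"
    using tm by measurable
  have int: "integrable M (\<lambda>\<omega>. trapezoid u w (ennreal (R \<omega>)))"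
    by (rule integrable_const_bound[where B = 1, OF _ m']) (auto simp: trapezoid_bounds)
  have "prob {\<omega> \<in> space M. w \<le> R \<omega>} = expectation (indicator {\<omega> \<in> space M. w \<le> R \<omega>})" by simp
  also have "\<dots> \<le> expectation (\<lambda>\<omega>. trapezoid u w (ennreal (R \<omega>)))"
  proof (rule integral_mono[OF _ int])
    show "indicator {\<omega> \<in> space M. w \<le> R \<omega>} \<omega> \<le> trapezoid u w (ennreal (R \<omega>))" for \<omega>
      using trapezoid_eq_1[OF uw, of "ennreal (R \<omega>)"] trapezoid_bounds
      by (auto simp: indicator_def ennreal_leI)
  qed (simp add: emeasure_eq_measure)
  finally show ?A .
  have "expectation (\<lambda>\<omega>. trapezoid u w (ennreal (R \<omega>))) \<le> expectation (indicator {\<omega> \<in> space M. u < R \<omega>})"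
  proof (rule integral_mono[OF int])
    show "trapezoid u w (ennreal (R \<omega>)) \<le> indicator {\<omega> \<in> space M. u < R \<omega>} \<omega>" if "\<omega> \<in> space M" for \<omega>
      using trapezoid_eq_0[OF uw, of "ennreal (R \<omega>)"] trapezoid_bounds that
      by (auto simp: indicator_def ennreal_leI)
  qed (simp add: emeasure_eq_measure)
  then show ?B by simp
qed

context subordinator_measure
begin

lemma integral_trapezoid_bounds:
  assumes uw: "0 < u" "u < w"
  shows "tail w \<le> (\<integral>z. trapezoid u w z \<partial>\<nu>)" (is ?A) and "(\<integral>z. trapezoid u w z \<partial>\<nu>) \<le> tail u" (is ?B)
proof -
  have i: "integrable \<nu> (indicator {ennreal t<..} :: _ \<Rightarrow> real)" if "0 < t" for t
    using finite_greaterThan[OF that] by (intro integrable_real_indicator greaterThan_in_sets)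
  have le: "trapezoid u w z \<le> indicator {ennreal u<..} z" for z
    using trapezoid_eq_0[OF uw, of z] trapezoid_bounds by (auto simp: indicator_def not_less)
  have int: "integrable \<nu> (trapezoid u w)"
    by (rule Bochner_Integration.integrable_bound[OF i[OF uw(1)]])
      (use le trapezoid_bounds in \<open>auto intro!: borel_measurable_\<nu> borel_measurable_trapezoid uw\<close>)
  have m: "(\<integral>z. indicator {ennreal t<..} z \<partial>\<nu>) = tail t" if "0 < t" for t
    using greaterThan_in_sets[of t] by (simp add: sets.Int_space_eq2)
  show ?B using integral_mono[OF int i[OF uw(1)] le] m[OF uw(1)] by simp
  have w: "0 < w" using uw by simp
  have "indicator {ennreal w<..} z \<le> trapezoid u w z" for z
    using trapezoid_eq_1[OF uw, of z] trapezoid_bounds by (auto simp: indicator_def)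
  from integral_mono[OF i[OF w] int this] m[OF w] show ?A by simp
qed

context
  fixes P :: "nat \<Rightarrow> 'p measure" and R :: "nat \<Rightarrow> 'p \<Rightarrow> real" and n :: "nat \<Rightarrow> nat"
  assumes P: "\<And>d. prob_space (P d)" and R: "\<And>d. R d \<in> borel_measurable (P d)"
    and vague: "vague_conv (\<lambda>d. scale_measure (of_nat (n d))
      (restrict_space (distr (P d) borel (\<lambda>\<omega>. ennreal (R d \<omega>))) {0<..})) \<nu>"
begin

lemma trapezoid_tendsto:
  assumes uw: "0 < u" "u < w"
  shows "(\<lambda>d. real (n d) * (\<integral>\<omega>. trapezoid u w (ennreal (R d \<omega>)) \<partial>P d)) \<longlonglongrightarrow> (\<integral>z. trapezoid u w z \<partial>\<nu>)"
proof -
  have "compact {ennreal u..}" by (simp add: compact_eq_closed)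
  then have "(\<lambda>d. \<integral>z. trapezoid u w z \<partial>scale_measure (of_nat (n d))
      (restrict_space (distr (P d) borel (\<lambda>\<omega>. ennreal (R d \<omega>))) {0<..})) \<longlonglongrightarrow> (\<integral>z. trapezoid u w z \<partial>\<nu>)"
    using vague uw unfolding vague_conv_def
    by (elim allE[of _ "trapezoid u w"] mp)
      (auto intro!: continuous_on_trapezoid exI[of _ "{ennreal u..}"] trapezoid_eq_0 simp: ennreal_le_imp_pos)
  then show ?thesis
    using prob_space.integral_trapezoid_scaled_distr[OF P R uw] by simp
qed

text \<open>The ramp from u to w lies above the indicator of [w, \<infinity>] and below that of (u,
  \<infinity>], so the bound holds at atoms as well. It also keeps the expected number of large
  steps bounded.\<close>

lemma eventually_scaled_prob_less:
  assumes uw: "0 < u" "u < w" and e: "0 < e"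
  shows "\<forall>\<^sub>F d in sequentially. real (n d) * measure (P d) {\<omega> \<in> space (P d). w \<le> R d \<omega>} < tail u + e"
proof -
  have "\<forall>\<^sub>F d in sequentially. real (n d) * (\<integral>\<omega>. trapezoid u w (ennreal (R d \<omega>)) \<partial>P d) < tail u + e"
    using integral_trapezoid_bounds[OF uw] e by (intro order_tendstoD(2)[OF trapezoid_tendsto[OF uw]]) simp
  then show ?thesis
  proof eventually_elim
    case (elim d)
    have "real (n d) * measure (P d) {\<omega> \<in> space (P d). w \<le> R d \<omega>} \<le> real (n d) * (\<integral>\<omega>. trapezoid u w (ennreal (R d \<omega>)) \<partial>P d)"
      by (intro mult_left_mono prob_space.expectation_trapezoid_bounds P R uw) simp
    with elim show ?case by simp
  qed
qed

lemma eventually_scaled_prob_greater: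
  assumes uw: "0 < u" "u < w" and e: "0 < e"
  shows "\<forall>\<^sub>F d in sequentially. tail w - e < real (n d) * measure (P d) {\<omega> \<in> space (P d). u < R d \<omega>}"
proof -
  have "\<forall>\<^sub>F d in sequentially. tail w - e < real (n d) * (\<integral>\<omega>. trapezoid u w (ennreal (R d \<omega>)) \<partial>P d)"
    using integral_trapezoid_bounds[OF uw] e by (intro order_tendstoD(1)[OF trapezoid_tendsto[OF uw]]) simp
  then show ?thesis
  proof eventually_elim
    case (elim d)
    have "real (n d) * (\<integral>\<omega>. trapezoid u w (ennreal (R d \<omega>)) \<partial>P d) \<le> real (n d) * measure (P d) {\<omega> \<in> space (P d). u < R d \<omega>}"
      by (intro mult_left_mono prob_space.expectation_trapezoid_bounds P R uw) simp
    with elim show ?case by simp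
  qed
qed

text \<open>Squeeze between a ramp to the left and a ramp to the right of t. Half of the gap to b is
  spent on the continuity of the tail at t, half on the limit.\<close>

lemma scaled_prob_tendsto_tail:
  assumes t: "0 < t" "emeasure \<nu> {ennreal t} = 0"
  shows "(\<lambda>d. real (n d) * measure (P d) {\<omega> \<in> space (P d). t < R d \<omega>}) \<longlonglongrightarrow> tail t"
proof (rule order_tendstoI)
  fix b assume "b < tail t"
  then have e: "0 < (tail t - b) / 2" by simp
  obtain w where w: "t < w" "tail t - (tail t - b) / 2 < tail w" using tail_continuous[OF t e] by blast
  show "\<forall>\<^sub>F d in sequentially. b < real (n d) * measure (P d) {\<omega> \<in> space (P d). t < R d \<omega>}"
    using eventually_scaled_prob_greater[OF t(1) w(1) e] by eventually_elim (use w in \<open>simp add: field_simps\<close>)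
next
  fix b assume "tail t < b"
  then have e: "0 < (b - tail t) / 2" by simp
  obtain u where u: "0 < u" "u < t" "tail u < tail t + (b - tail t) / 2" using tail_continuous[OF t e] by blast
  show "\<forall>\<^sub>F d in sequentially. real (n d) * measure (P d) {\<omega> \<in> space (P d). t < R d \<omega>} < b"
    using eventually_scaled_prob_less[OF u(1,2) e]
  proof eventually_elim
    case (elim d)
    interpret prob_space "P d" by (rule P)
    have "prob {\<omega> \<in> space (P d). t < R d \<omega>} \<le> prob {\<omega> \<in> space (P d). t \<le> R d \<omega>}"
      using R[of d] by (intro finite_measure_mono) auto
    then have "real (n d) * prob {\<omega> \<in> space (P d). t < R d \<omega>} \<le> real (n d) * prob {\<omega> \<in> space (P d). t \<le> R d \<omega>}"
      by (intro mult_left_mono) auto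
    with elim u show ?case by (simp add: field_simps)
  qed
qed

end

end

section \<open>Configurations of large steps\<close>

text \<open>Index \<open>0\<close> stands for a block without values above \<open>s\<close>, and \<open>j > 0\<close> for a block whose only
  value above \<open>s\<close> lies in the cell \<open>C j\<close>.\<close>

definition block_config :: "real \<Rightarrow> (nat \<Rightarrow> real set) \<Rightarrow> nat \<Rightarrow> nat set \<Rightarrow> (nat \<Rightarrow> real) \<Rightarrow> bool"
  where "block_config s C j B v \<longleftrightarrow>
    (if j = 0 then \<forall>k\<in>B. v k \<le> s else \<exists>k\<in>B. v k \<in> C j \<and> (\<forall>k'\<in>B - {k}. v k' \<le> s))"

lemma (in prob_space) indep_vars_prob_Ball:
  assumes ind: "indep_vars N v UNIV" and B: "finite B" and E: "\<And>k. k \<in> B \<Longrightarrow> E k \<in> sets (N k)"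
  shows "prob {\<omega> \<in> space M. \<forall>k\<in>B. v k \<omega> \<in> E k} = (\<Prod>k\<in>B. prob {\<omega> \<in> space M. v k \<omega> \<in> E k})"
proof (cases "B = {}")
  case False
  have eq: "{\<omega> \<in> space M. v k \<omega> \<in> E k} = v k -` E k \<inter> space M" for k by auto
  have "{\<omega> \<in> space M. \<forall>k\<in>B. v k \<omega> \<in> E k} = (\<Inter>k\<in>B. v k -` E k \<inter> space M)" using False by auto
  then show ?thesis unfolding eq
    using indep_varsD[OF ind False B _ E] by simp
qed (simp add: prob_space)

text \<open>For j > 0, split by the position k of the single large value. The resulting events are
  disjoint because the cell lies above s, and independence makes each a product of one factor p and
  card B - 1 factors p0.\<close>

lemma (in prob_space) prob_block_config:
  assumes ind: "indep_vars (\<lambda>_. borel) v UNIV" and B: "finite B"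
    and C: "C j \<in> sets borel" "C j \<subseteq> {s<..}"
    and p: "\<And>k. prob {\<omega> \<in> space M. v k \<omega> \<in> C j} = p" and p0: "\<And>k. prob {\<omega> \<in> space M. v k \<omega> \<le> s} = p0"
  shows "prob {\<omega> \<in> space M. block_config s C j B (\<lambda>k. v k \<omega>)} =
    (if j = 0 then p0 ^ card B else real (card B) * p * p0 ^ (card B - 1))"
proof (cases "j = 0")
  case True
  have "prob {\<omega> \<in> space M. \<forall>k\<in>B. v k \<omega> \<in> {..s}} = (\<Prod>k\<in>B. p0)"
    by (subst indep_vars_prob_Ball[OF ind B]) (auto simp: p0)
  then show ?thesis using True by (simp add: block_config_def)
next
  case False
  have [measurable]: "v k \<in> borel_measurable M" for k
    using ind by (auto simp: indep_vars_def2)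
  note [measurable] = C(1)
  let ?E = "\<lambda>k k'. if k' = k then C j else {..s}"
  let ?A = "\<lambda>k. {\<omega> \<in> space M. \<forall>k'\<in>B. v k' \<omega> \<in> ?E k k'}"
  have E: "?E k k' \<in> sets borel" for k k' using C by simp
  have A: "?A k \<in> events" for k
    using E B by measurable
  have "{\<omega> \<in> space M. block_config s C j B (\<lambda>k. v k \<omega>)} = (\<Union>k\<in>B. ?A k)"
    using False by (auto simp: block_config_def split: if_splits)
  also have "prob \<dots> = (\<Sum>k\<in>B. prob (?A k))"
  proof (rule finite_measure_finite_Union[OF B])
    show "disjoint_family_on ?A B"
      unfolding disjoint_family_on_def
    proof (intro ballI impI)
      fix k k' assume kk: "k \<in> B" "k' \<in> B" "k \<noteq> k'"
      have False if "\<omega> \<in> ?A k" "\<omega> \<in> ?A k'" for \<omega>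
      proof -
        have "v k \<omega> \<in> C j" "v k \<omega> \<le> s" using that kk by auto
        then show False using C(2) by auto
      qed
      then show "?A k \<inter> ?A k' = {}" by blast
    qed
  qed (use A in auto)
  also have "\<dots> = (\<Sum>k\<in>B. p * p0 ^ (card B - 1))"
  proof (intro sum.cong refl)
    fix k assume k: "k \<in> B"
    have "prob (?A k) = (\<Prod>k'\<in>B. prob {\<omega> \<in> space M. v k' \<omega> \<in> ?E k k'})"
      using E by (intro indep_vars_prob_Ball[OF ind B])
    also have "\<dots> = prob {\<omega> \<in> space M. v k \<omega> \<in> ?E k k} * (\<Prod>k'\<in>B - {k}. prob {\<omega> \<in> space M. v k' \<omega> \<in> ?E k k'})"
      by (rule prod.remove[OF B k])
    also have "(\<Prod>k'\<in>B - {k}. prob {\<omega> \<in> space M. v k' \<omega> \<in> ?E k k'}) = (\<Prod>k'\<in>B - {k}. p0)"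
      using p0 by (intro prod.cong) auto
    finally show "prob (?A k) = p * p0 ^ (card B - 1)" using k B by (simp add: p)
  qed
  finally show ?thesis using False by simp
qed

lemma measurable_block_config [measurable]:
  assumes v: "\<And>k. k \<in> B \<Longrightarrow> v k \<in> borel_measurable M" and B: "finite B" and C [measurable]: "C j \<in> sets borel"
  shows "Measurable.pred M (\<lambda>\<omega>. block_config s C j B (\<lambda>k. v k \<omega>))"
proof -
  have 1: "Measurable.pred M (\<lambda>\<omega>. v k \<omega> \<le> s)" if "k \<in> B" for k
    using v[OF that] by measurable
  have 2: "Measurable.pred M (\<lambda>\<omega>. v k \<omega> \<in> C j)" if "k \<in> B" for k
    using v[OF that] by measurable
  show ?thesis
  proof (cases "j = 0")
    case True
    then show ?thesis unfolding block_config_def by (simp add: pred_intros_finite B 1)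
  next
    case False
    have "Measurable.pred M (\<lambda>\<omega>. \<exists>k\<in>B. v k \<omega> \<in> C j \<and> (\<forall>k'\<in>B - {k}. v k' \<omega> \<le> s))"
      by (intro pred_intros_finite pred_intros_logic B finite_Diff 1 2) auto
    then show ?thesis using False by (simp add: block_config_def)
  qed
qed

text \<open>Disjoint index blocks carry independent vectors, so the event factors over blocks.
  \<open>block_config\<close> reads v only on its block and may therefore be evaluated at the
  restricted function.\<close>

lemma (in prob_space) prob_config:
  fixes q :: nat
  assumes ind: "indep_vars (\<lambda>_. borel) v UNIV"
    and blk: "\<And>i. finite (blk i)" "disjoint_family_on blk {..<q}"
    and C: "\<And>j. C j \<in> sets borel" "\<And>j. C j \<subseteq> {s<..}"
    and p: "\<And>k j. prob {\<omega> \<in> space M. v k \<omega> \<in> C j} = p j" and p0: "\<And>k. prob {\<omega> \<in> space M. v k \<omega> \<le> s} = p0"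
  shows "prob {\<omega> \<in> space M. \<forall>i<q. block_config s C (\<kappa> i) (blk i) (\<lambda>k. v k \<omega>)} =
    (\<Prod>i<q. if \<kappa> i = 0 then p0 ^ card (blk i) else real (card (blk i)) * p (\<kappa> i) * p0 ^ (card (blk i) - 1))"
proof -
  let ?N = "\<lambda>i. PiM (blk i) (\<lambda>_. borel :: real measure)"
  let ?V = "\<lambda>i \<omega>. restrict (\<lambda>k. v k \<omega>) (blk i)"
  let ?E = "\<lambda>i. {f \<in> space (?N i). block_config s C (\<kappa> i) (blk i) f}"
  have indV: "indep_vars ?N ?V {..<q}"
    using blk by (intro indep_vars_restrict[OF ind]) auto
  have E: "?E i \<in> sets (?N i)" for i
  proof -
    have "Measurable.pred (?N i) (\<lambda>f. block_config s C (\<kappa> i) (blk i) (\<lambda>k. f k))"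
      by (rule measurable_block_config) (use blk C in \<open>auto intro: measurable_component_singleton\<close>)
    then show ?thesis by (simp add: pred_def)
  qed
  have bc: "block_config s C j (blk i) (?V i \<omega>) = block_config s C j (blk i) (\<lambda>k. v k \<omega>)" for i j \<omega>
    by (simp add: block_config_def)
  have eq: "?V i -` ?E i \<inter> space M = {\<omega> \<in> space M. block_config s C (\<kappa> i) (blk i) (\<lambda>k. v k \<omega>)}" for i
    by (auto simp: bc space_PiM)
  show ?thesis
  proof (cases "q = 0")
    case False
    have "{\<omega> \<in> space M. \<forall>i<q. block_config s C (\<kappa> i) (blk i) (\<lambda>k. v k \<omega>)} = (\<Inter>i\<in>{..<q}. ?V i -` ?E i \<inter> space M)"
      unfolding eq using False by auto
    also have "prob \<dots> = (\<Prod>i\<in>{..<q}. prob (?V i -` ?E i \<inter> space M))"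
      using False E by (intro indep_varsD[OF indV]) auto
    finally show ?thesis
      unfolding eq by (simp add: prob_block_config[OF ind blk(1) C p p0])
  qed (simp add: prob_space)
qed

section \<open>Poisson limit of the word probabilities\<close>

text \<open>For p < 1/2, 1 - p lies between exp (- p - 2 p^2) and exp (- p). Raised to the power l,
  the quadratic correction becomes 2 (l p) p in the exponent, which tends to 0.\<close>

lemma tendsto_one_minus_power:
  fixes p :: "nat \<Rightarrow> real" and l :: "nat \<Rightarrow> nat"
  assumes p: "p \<longlonglongrightarrow> 0" "\<And>d. 0 \<le> p d" "\<And>d. p d \<le> 1" and lp: "(\<lambda>d. real (l d) * p d) \<longlonglongrightarrow> x"
  shows "(\<lambda>d. (1 - p d) ^ l d) \<longlonglongrightarrow> exp (- x)"
proof (rule tendsto_sandwich)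
  show "\<forall>\<^sub>F d in sequentially. (1 - p d) ^ l d \<le> exp (- (real (l d) * p d))"
  proof (intro always_eventually allI)
    fix d
    have "(1 - p d) ^ l d \<le> exp (- p d) ^ l d"
      using p exp_ge_add_one_self[of "- p d"] by (intro power_mono) auto
    then show "(1 - p d) ^ l d \<le> exp (- (real (l d) * p d))" by (simp add: exp_of_nat_mult[symmetric])
  qed
  have "\<forall>\<^sub>F d in sequentially. p d < 1 / 2" using p(1) by (rule order_tendstoD) simp
  then show "\<forall>\<^sub>F d in sequentially. exp (- (real (l d) * p d) - 2 * (real (l d) * p d) * p d) \<le> (1 - p d) ^ l d"
  proof eventually_elim
    case (elim d)
    have "exp (- p d - 2 * (p d)\<^sup>2) \<le> exp (ln (1 - p d))"
      unfolding exp_le_cancel_iff using p(2)[of d] elim by (intro ln_one_minus_pos_lower_bound) auto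
    also have "\<dots> = 1 - p d" using elim by simp
    finally have "exp (- p d - 2 * (p d)\<^sup>2) ^ l d \<le> (1 - p d) ^ l d"
      using elim by (intro power_mono) auto
    then show ?case by (simp add: exp_of_nat_mult[symmetric] algebra_simps power2_eq_square)
  qed
  show "(\<lambda>d. exp (- (real (l d) * p d))) \<longlonglongrightarrow> exp (- x)" by (intro tendsto_intros lp)
  have "(\<lambda>d. exp (- (real (l d) * p d) - 2 * (real (l d) * p d) * p d)) \<longlonglongrightarrow> exp (- x - 2 * x * 0)"
    by (intro tendsto_intros lp p)
  then show "(\<lambda>d. exp (- (real (l d) * p d) - 2 * (real (l d) * p d) * p d)) \<longlonglongrightarrow> exp (- x)" by simp
qed

text \<open>Steps are counted from \<open>0\<close>: step \<open>k\<close> of the walk takes place at time \<open>(k + 1) / n\<close>.\<close>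

definition walk_block :: "nat \<Rightarrow> real \<Rightarrow> nat \<Rightarrow> nat \<Rightarrow> nat set"
  where "walk_block n T q i = {k. real (Suc k) / real n \<in> time_block T q i}"

lemma walk_block_eq:
  assumes n: "0 < n" and T: "0 < T"
  shows "walk_block n T q i =
    {nat \<lfloor>real n * (T * real i / real q)\<rfloor>..<nat \<lfloor>real n * (T * real (Suc i) / real q)\<rfloor>}"
proof -
  have a: "a < real (Suc k) / real n \<longleftrightarrow> nat \<lfloor>real n * a\<rfloor> \<le> k" if "0 \<le> a" for a k
  proof -
    have "a < real (Suc k) / real n \<longleftrightarrow> real n * a < of_int (int (Suc k))" using n by (simp add: field_simps)
    also have "\<dots> \<longleftrightarrow> \<lfloor>real n * a\<rfloor> < int (Suc k)" by (rule floor_less_iff[symmetric])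
    finally show ?thesis by linarith
  qed
  have b: "real (Suc k) / real n \<le> b \<longleftrightarrow> k < nat \<lfloor>real n * b\<rfloor>" if "0 \<le> b" for b k
    using a[OF that, of k] by linarith
  show ?thesis
    unfolding walk_block_def time_block_def using a b T by auto
qed

lemma finite_walk_block: "0 < n \<Longrightarrow> 0 < T \<Longrightarrow> finite (walk_block n T q i)"
  by (simp add: walk_block_eq)

lemma card_walk_block_tendsto:
  assumes n: "\<And>d. 0 < n d" "filterlim n at_top sequentially" and T: "0 < T"
  shows "(\<lambda>d. real (card (walk_block (n d) T q i)) / real (n d)) \<longlonglongrightarrow> T / real q"
proof -
  let ?a = "T * real i / real q" and ?b = "T * real (Suc i) / real q"
  have n_top: "filterlim (\<lambda>d. real (n d)) at_top sequentially"
    using n(2) by (rule filterlim_compose[OF filterlim_real_sequentially])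
  have fl: "(\<lambda>d. real (nat \<lfloor>real (n d) * c\<rfloor>) / real (n d)) \<longlonglongrightarrow> c" if c: "0 \<le> c" for c
  proof (rule tendsto_sandwich)
    show "\<forall>\<^sub>F d in sequentially. c - 1 / real (n d) \<le> real (nat \<lfloor>real (n d) * c\<rfloor>) / real (n d)"
    proof (intro always_eventually allI)
      fix d
      have "(c - 1 / real (n d)) * real (n d) = real (n d) * c - 1" using n(1)[of d] by (simp add: field_simps)
      also have "\<dots> \<le> real (nat \<lfloor>real (n d) * c\<rfloor>)" by linarith
      finally show "c - 1 / real (n d) \<le> real (nat \<lfloor>real (n d) * c\<rfloor>) / real (n d)"
        using n(1)[of d] by (simp add: pos_le_divide_eq)
    qed
    show "\<forall>\<^sub>F d in sequentially. real (nat \<lfloor>real (n d) * c\<rfloor>) / real (n d) \<le> c"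
      using n(1) c by (intro always_eventually allI) (simp add: pos_divide_le_eq mult.commute)
    have "(\<lambda>d. c - 1 / real (n d)) \<longlonglongrightarrow> c - 0"
      by (intro tendsto_intros tendsto_divide_0[OF tendsto_const] filterlim_at_top_imp_at_infinity n_top)
    then show "(\<lambda>d. c - 1 / real (n d)) \<longlonglongrightarrow> c" by simp
  qed simp
  have ab: "?a \<le> ?b" using T by (intro divide_right_mono mult_left_mono) auto
  have "real (card (walk_block (n d) T q i)) / real (n d) =
      real (nat \<lfloor>real (n d) * ?b\<rfloor>) / real (n d) - real (nat \<lfloor>real (n d) * ?a\<rfloor>) / real (n d)" for d
  proof -
    have "nat \<lfloor>real (n d) * ?a\<rfloor> \<le> nat \<lfloor>real (n d) * ?b\<rfloor>"
      using ab by (intro nat_mono floor_mono mult_left_mono) auto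
    then show ?thesis
      by (simp add: walk_block_eq[OF n(1) T] of_nat_diff diff_divide_distrib del: of_nat_Suc)
  qed
  moreover have "(\<lambda>d. real (nat \<lfloor>real (n d) * ?b\<rfloor>) / real (n d) - real (nat \<lfloor>real (n d) * ?a\<rfloor>) / real (n d))
      \<longlonglongrightarrow> ?b - ?a"
    using T by (intro tendsto_diff fl) auto
  moreover have "?b - ?a = T / real q" by (simp add: diff_divide_distrib[symmetric] algebra_simps)
  ultimately show ?thesis by simp
qed

text \<open>A block of l steps, with l / n tending to T / q, has no large step with probability (1 -
  p0)^l, and exactly one, lying in cell j, with probability l p (1 - p0)^(l - 1). Both limits
  contain the same exponential, so it appears once for every letter.\<close>

lemma prob_config_tendsto:
  fixes v :: "nat \<Rightarrow> nat \<Rightarrow> 'q \<Rightarrow> real"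
  assumes Q: "\<And>d. prob_space (Q d)" and ind: "\<And>d. prob_space.indep_vars (Q d) (\<lambda>_. borel) (v d) UNIV"
    and n: "\<And>d. 0 < n d" "filterlim n at_top sequentially" and T: "0 < T"
    and C: "\<And>j. C j \<in> sets borel" "\<And>j. C j \<subseteq> {s<..}"
    and p: "\<And>d k j. measure (Q d) {\<omega> \<in> space (Q d). v d k \<omega> \<in> C j} = p d j"
    and p0: "\<And>d k. measure (Q d) {\<omega> \<in> space (Q d). s < v d k \<omega>} = p0 d"
    and np: "\<And>i. i < q \<Longrightarrow> \<kappa> i \<noteq> 0 \<Longrightarrow> (\<lambda>d. real (n d) * p d (\<kappa> i)) \<longlonglongrightarrow> \<alpha> (\<kappa> i)"
    and np0: "(\<lambda>d. real (n d) * p0 d) \<longlonglongrightarrow> \<Lambda>"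
  shows "(\<lambda>d. measure (Q d) {\<omega> \<in> space (Q d). \<forall>i<q. block_config s C (\<kappa> i) (walk_block (n d) T q i) (\<lambda>k. v d k \<omega>)})
    \<longlonglongrightarrow> (\<Prod>i<q. (if \<kappa> i = 0 then 1 else T / q * \<alpha> (\<kappa> i)) * exp (- (T / q * \<Lambda>)))"
proof -
  let ?l = "\<lambda>d i. card (walk_block (n d) T q i)"
  have v_le: "measure (Q d) {\<omega> \<in> space (Q d). v d k \<omega> \<le> s} = 1 - p0 d" for d k
  proof -
    interpret prob_space "Q d" by (rule Q)
    have [measurable]: "v d k \<in> borel_measurable (Q d)" using ind[of d] by (auto simp: indep_vars_def2)
    have "prob {\<omega> \<in> space (Q d). \<not> s < v d k \<omega>} = 1 - prob {\<omega> \<in> space (Q d). s < v d k \<omega>}"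
      by (rule prob_neg) measurable
    then show ?thesis by (simp add: p0 not_less)
  qed
  have eq: "measure (Q d) {\<omega> \<in> space (Q d). \<forall>i<q. block_config s C (\<kappa> i) (walk_block (n d) T q i) (\<lambda>k. v d k \<omega>)}
      = (\<Prod>i<q. if \<kappa> i = 0 then (1 - p0 d) ^ ?l d i else real (?l d i) * p d (\<kappa> i) * (1 - p0 d) ^ (?l d i - 1))" for d
  proof (rule prob_space.prob_config[OF Q ind _ _ C p v_le])
    show "disjoint_family_on (walk_block (n d) T q) {..<q}"
      unfolding disjoint_family_on_def walk_block_def
      using disjoint_time_block[OF T] by fastforce
  qed (simp add: finite_walk_block n T)
  have p0_01: "0 \<le> p0 d" "p0 d \<le> 1" for d
    unfolding p0[of d 0, symmetric] using prob_space.prob_le_1[OF Q] by auto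
  have n_inv: "(\<lambda>d. inverse (real (n d))) \<longlonglongrightarrow> 0"
    by (rule tendsto_inverse_0_at_top[OF filterlim_compose[OF filterlim_real_sequentially n(2)]])
  have p0_lim: "p0 \<longlonglongrightarrow> 0"
  proof -
    have "(\<lambda>d. real (n d) * p0 d * inverse (real (n d))) \<longlonglongrightarrow> \<Lambda> * 0" by (intro tendsto_mult np0 n_inv)
    moreover have "real (n d) * p0 d * inverse (real (n d)) = p0 d" for d using n(1)[of d] by simp
    ultimately show ?thesis by simp
  qed
  have l_lim: "(\<lambda>d. real (?l d i) * x d) \<longlonglongrightarrow> T / q * y" if "(\<lambda>d. real (n d) * x d) \<longlonglongrightarrow> y" for x y i
  proof -
    have "(\<lambda>d. real (?l d i) / real (n d) * (real (n d) * x d)) \<longlonglongrightarrow> T / q * y"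
      by (intro tendsto_mult that card_walk_block_tendsto n T)
    moreover have "real (?l d i) / real (n d) * (real (n d) * x d) = real (?l d i) * x d" for d
      using n(1)[of d] by simp
    ultimately show ?thesis by simp
  qed
  \<comment> \<open>Subtraction in the exponent is truncated; the bounds l p0 - p0 and l p0 hold for
    l = 0 too.\<close>
  have l1_lim: "(\<lambda>d. real (?l d i - 1) * p0 d) \<longlonglongrightarrow> T / q * \<Lambda>" for i
  proof (rule tendsto_sandwich)
    have "(\<lambda>d. real (?l d i) * p0 d - p0 d) \<longlonglongrightarrow> T / q * \<Lambda> - 0"
      by (intro tendsto_diff l_lim np0 p0_lim)
    then show "(\<lambda>d. real (?l d i) * p0 d - p0 d) \<longlonglongrightarrow> T / q * \<Lambda>" by simp
    show "(\<lambda>d. real (?l d i) * p0 d) \<longlonglongrightarrow> T / q * \<Lambda>" by (rule l_lim[OF np0])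
    show "\<forall>\<^sub>F d in sequentially. real (?l d i) * p0 d - p0 d \<le> real (?l d i - 1) * p0 d"
    proof (intro always_eventually allI)
      fix d
      have "(real (?l d i) - 1) * p0 d \<le> real (?l d i - 1) * p0 d"
        using p0_01 by (intro mult_right_mono) auto
      then show "real (?l d i) * p0 d - p0 d \<le> real (?l d i - 1) * p0 d" by (simp add: algebra_simps)
    qed
    show "\<forall>\<^sub>F d in sequentially. real (?l d i - 1) * p0 d \<le> real (?l d i) * p0 d"
      using p0_01 by (intro always_eventually allI mult_right_mono) auto
  qed
  show ?thesis
    unfolding eq
  proof (intro tendsto_prod)
    fix i assume "i \<in> {..<q}"
    then have i: "i < q" by simp
    show "(\<lambda>d. if \<kappa> i = 0 then (1 - p0 d) ^ ?l d i else real (?l d i) * p d (\<kappa> i) * (1 - p0 d) ^ (?l d i - 1))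
      \<longlonglongrightarrow> (if \<kappa> i = 0 then 1 else T / q * \<alpha> (\<kappa> i)) * exp (- (T / q * \<Lambda>))"
    proof (cases "\<kappa> i = 0")
      case True
      then show ?thesis
        using tendsto_one_minus_power[OF p0_lim p0_01 l_lim[OF np0]] by simp
    next
      case False
      then show ?thesis
        using tendsto_mult[OF l_lim[OF np[OF i False]] tendsto_one_minus_power[OF p0_lim p0_01 l1_lim]] by simp
    qed
  qed
qed

section \<open>Paths with orthogonal jumps\<close>

text \<open>The set depends continuously on the point sequence in the product topology, since only
  the coordinates up to m matter and moving each by at most r moves the set by at most r.
  Measurability of the sequence is then checked coordinatewise.\<close>

lemma measurable_gh_of_set_image:
  fixes s :: "nat \<Rightarrow> 'a \<Rightarrow> l2"
  assumes s: "\<And>j. s j \<in> borel_measurable M"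
  shows "(\<lambda>\<omega>. gh_of_set ((\<lambda>j. s j \<omega>) ` {0..m})) \<in> borel_measurable M"
proof -
  let ?\<Phi> = "\<lambda>s :: nat \<Rightarrow> l2. gh_of_set (s ` {0..m})"
  have "continuous_on UNIV ?\<Phi>"
    unfolding continuous_on_def
  proof (intro ballI tendstoI)
    fix s :: "nat \<Rightarrow> l2" and e :: real assume e: "0 < e"
    have "\<forall>\<^sub>F s' in at s. dist (s' j) (s j) < e / 2" for j
    proof -
      have "continuous_on UNIV (\<lambda>s' :: nat \<Rightarrow> l2. s' j)" by (rule continuous_on_product_coordinates)
      then have "((\<lambda>s'. s' j) \<longlongrightarrow> s j) (at s)" by (simp add: continuous_on_def)
      then show ?thesis by (rule tendstoD) (use e in simp)
    qed
    then have "\<forall>\<^sub>F s' in at s. \<forall>j\<in>{0..m}. dist (s' j) (s j) < e / 2"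
      by (intro eventually_ball_finite) auto
    then show "\<forall>\<^sub>F s' in at s. dist (?\<Phi> s') (?\<Phi> s) < e"
    proof eventually_elim
      case (elim s')
      have "dist (?\<Phi> s') (?\<Phi> s) \<le> e / 2"
      proof (rule dist_gh_of_set_le_hausdorff)
        fix a assume "a \<in> s' ` {0..m}"
        then show "\<exists>b\<in>s ` {0..m}. dist a b \<le> e / 2" using elim by (auto intro: less_imp_le)
      next
        fix b assume "b \<in> s ` {0..m}"
        then show "\<exists>a\<in>s' ` {0..m}. dist a b \<le> e / 2" using elim by (auto intro: less_imp_le)
      qed (auto intro: finite_imp_compact)
      then show ?case using e by simp
    qed
  qed
  then have "?\<Phi> \<in> borel_measurable borel" by (rule borel_measurable_continuous_onI)
  moreover have "(\<lambda>\<omega> j. s j \<omega>) \<in> borel_measurable M"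
    by (rule measurable_coordinatewise_then_product) (rule s)
  ultimately show ?thesis by (rule measurable_compose[rotated])
qed

text \<open>Off a null set N the limit is measurable in the ordinary sense; on N it is arbitrary,
  and subsets of N are measurable for the completion.\<close>

lemma borel_measurable_completion_AE_lim:
  fixes f :: "nat \<Rightarrow> 'a \<Rightarrow> 'b :: metric_space"
  assumes f: "\<And>m. f m \<in> borel_measurable M" and lim: "AE \<omega> in M. (\<lambda>m. f m \<omega>) \<longlonglongrightarrow> g \<omega>"
  shows "g \<in> borel_measurable (completion M)"
proof -
  obtain N where N: "N \<in> null_sets M" "\<And>\<omega>. \<omega> \<in> space M - N \<Longrightarrow> (\<lambda>m. f m \<omega>) \<longlonglongrightarrow> g \<omega>"
    using lim by (auto elim!: AE_E3)
  define g' where "g' \<omega> = (if \<omega> \<in> N then undefined else g \<omega>)" for \<omega>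
  have g': "g' \<in> borel_measurable M"
  proof (rule borel_measurable_LIMSEQ_metric)
    show "(\<lambda>\<omega>. if \<omega> \<in> N then undefined else f m \<omega>) \<in> borel_measurable M" for m
      using N(1) f by (intro measurable_If_set) auto
    show "(\<lambda>m. if \<omega> \<in> N then undefined else f m \<omega>) \<longlonglongrightarrow> g' \<omega>" if "\<omega> \<in> space M" for \<omega>
      using N(2)[of \<omega>] that by (simp add: g'_def)
  qed
  show ?thesis
  proof (rule measurableI)
    fix A :: "'b set" assume A: "A \<in> sets borel"
    have eq: "g -` A \<inter> space (completion M) = ((g' -` A \<inter> space M) - N) \<union> (g -` A \<inter> space M \<inter> N)"
      by (auto simp: g'_def)
    have "(g' -` A \<inter> space M) - N \<in> sets (completion M)"
      using measurable_sets[OF g' A] N(1) by (intro sets_completionI_sets) auto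
    moreover have "g -` A \<inter> space M \<inter> N \<in> sets (completion M)"
      using N(1) by (intro null_sets_completion[of N]) auto
    ultimately show "g -` A \<inter> space (completion M) \<in> sets (completion M)"
      unfolding eq by (rule sets.Un)
  qed simp
qed

section \<open>Jump paths along the standard basis: truncation and compactness\<close>

text \<open>The sum of sqrt (c k) times the k-th basis vector over k in J, given by its coordinates;
  c k is a squared jump length. It is meaningful when c is summable over J.\<close>

definition l2_atoms :: "(nat \<Rightarrow> real) \<Rightarrow> nat set \<Rightarrow> l2"
  where "l2_atoms c J = Abs_l2 (\<lambda>k. if k \<in> J then sqrt (c k) else 0)"

definition atom_path :: "(nat \<Rightarrow> real) \<Rightarrow> nat set \<Rightarrow> (nat \<Rightarrow> real) \<Rightarrow> real \<Rightarrow> l2"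
  where "atom_path c I \<tau> t = l2_atoms c {k\<in>I. \<tau> k \<le> t}"

definition trunc_path :: "(nat \<Rightarrow> real) \<Rightarrow> nat set \<Rightarrow> (nat \<Rightarrow> real) \<Rightarrow> nat \<Rightarrow> real \<Rightarrow> l2"
  where "trunc_path c I \<tau> m t = l2_atoms c ({k\<in>I. \<tau> k \<le> t} \<inter> {..<m})"

text \<open>The squared norm of all that the first m atoms leave out up to time T.\<close>

definition atom_rest :: "(nat \<Rightarrow> real) \<Rightarrow> nat set \<Rightarrow> (nat \<Rightarrow> real) \<Rightarrow> real \<Rightarrow> nat \<Rightarrow> real"
  where "atom_rest c I \<tau> T m = (\<Sum>k. if k \<in> {k\<in>I. \<tau> k \<le> T} - {..<m} then c k else 0)"

context
  fixes c :: "nat \<Rightarrow> real"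
  assumes c: "\<And>k. 0 \<le> c k"
begin

lemma summable_subset_if:
  "J' \<subseteq> J \<Longrightarrow> summable (\<lambda>k. if k \<in> J then c k else 0) \<Longrightarrow> summable (\<lambda>k. if k \<in> J' then c k else 0)"
  by (rule summable_comparison_test'[of "\<lambda>k. if k \<in> J then c k else 0"]) (use c in auto)

lemma suminf_subset_le:
  assumes "J' \<subseteq> J" "summable (\<lambda>k. if k \<in> J then c k else 0)"
  shows "(\<Sum>k. if k \<in> J' then c k else 0) \<le> (\<Sum>k. if k \<in> J then c k else 0)"
  using assms c by (intro suminf_le summable_subset_if[OF assms] assms) auto

lemma l2_nth_atoms:
  assumes "summable (\<lambda>k. if k \<in> J then c k else 0)"
  shows "l2_nth (l2_atoms c J) k = (if k \<in> J then sqrt (c k) else 0)"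
proof -
  have "(\<lambda>k. (if k \<in> J then sqrt (c k) else 0)\<^sup>2) = (\<lambda>k. if k \<in> J then c k else 0)"
    using c by auto
  then show ?thesis using assms by (simp add: l2_atoms_def Abs_l2_inverse)
qed

lemma norm_l2_atoms_diff:
  assumes J: "summable (\<lambda>k. if k \<in> J then c k else 0)" and "J' \<subseteq> J"
  shows "(norm (l2_atoms c J - l2_atoms c J'))\<^sup>2 = (\<Sum>k. if k \<in> J - J' then c k else 0)"
proof -
  note J' = summable_subset_if[OF \<open>J' \<subseteq> J\<close> J]
  have "(\<lambda>k. (l2_nth (l2_atoms c J - l2_atoms c J') k)\<^sup>2) = (\<lambda>k. if k \<in> J - J' then c k else 0)"
    using c \<open>J' \<subseteq> J\<close> by (intro ext) (auto simp: l2_nth_atoms[OF J] l2_nth_atoms[OF J'])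
  then show ?thesis using norm_l2_sums[of "l2_atoms c J - l2_atoms c J'"] by (simp add: sums_iff)
qed

lemma l2_atoms_finite:
  assumes "finite J" shows "l2_atoms c J = (\<Sum>k\<in>J. sqrt (c k) *\<^sub>R l2_basis k)"
proof (rule l2_eqI)
  fix k
  have "summable (\<lambda>k. if k \<in> J then c k else 0)" using assms by (intro summable_If_finite_set)
  then show "l2_nth (l2_atoms c J) k = l2_nth (\<Sum>k\<in>J. sqrt (c k) *\<^sub>R l2_basis k) k"
    using assms by (simp add: l2_nth_atoms if_distrib cong: if_cong)
qed

lemma suminf_tail_eq:
  assumes J: "summable (\<lambda>k. if k \<in> J then c k else 0)"
  shows "(\<Sum>k. if k \<in> J - {..<m} then c k else 0) =
    (\<Sum>k. if k \<in> J then c k else 0) - (\<Sum>k<m. if k \<in> J then c k else 0)"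
proof -
  let ?f = "\<lambda>k. if k \<in> J then c k else 0"
  have "(\<lambda>k. ?f k - (if k \<in> {..<m} then ?f k else 0)) sums (suminf ?f - (\<Sum>k<m. ?f k))"
    by (intro sums_diff summable_sums[OF J] sums_If_finite_set) simp
  moreover have "(\<lambda>k. ?f k - (if k \<in> {..<m} then ?f k else 0)) = (\<lambda>k. if k \<in> J - {..<m} then c k else 0)"
    by auto
  ultimately show ?thesis by (simp add: sums_iff)
qed

lemma suminf_tail_tendsto_0:
  assumes J: "summable (\<lambda>k. if k \<in> J then c k else 0)"
  shows "(\<lambda>m. \<Sum>k. if k \<in> J - {..<m} then c k else 0) \<longlonglongrightarrow> 0"
  unfolding suminf_tail_eq[OF J] using tendsto_diff[OF tendsto_const[of "\<Sum>k. if k \<in> J then c k else 0"] summable_LIMSEQ[OF J]] by simp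

text \<open>Links the coordinatewise vector with the unordered sum in
  \<open>crinkled_subordinator\<close>: a finite F that contains the indices of J below N misses at
  most a tail of the series of c.\<close>

lemma has_sum_l2_atoms:
  assumes J: "summable (\<lambda>k. if k \<in> J then c k else 0)"
  shows "((\<lambda>k. sqrt (c k) *\<^sub>R l2_basis k) has_sum l2_atoms c J) J"
  unfolding has_sum_def
proof (rule tendstoI)
  fix e :: real assume e: "0 < e"
  let ?f = "\<lambda>k. if k \<in> J then c k else 0"
  obtain N where N: "dist (\<Sum>k<N. ?f k) (suminf ?f) < e\<^sup>2"
    using tendstoD[OF summable_LIMSEQ[OF J], of "e\<^sup>2"] e by (auto simp: eventually_sequentially)
  show "\<forall>\<^sub>F F in finite_subsets_at_top J. dist (\<Sum>k\<in>F. sqrt (c k) *\<^sub>R l2_basis k) (l2_atoms c J) < e"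
    unfolding eventually_finite_subsets_at_top
  proof (intro exI conjI allI impI)
    show "finite ({..<N} \<inter> J)" "{..<N} \<inter> J \<subseteq> J" by auto
    fix F assume F: "finite F \<and> {..<N} \<inter> J \<subseteq> F \<and> F \<subseteq> J"
    have "(norm (l2_atoms c J - l2_atoms c F))\<^sup>2 = (\<Sum>k. if k \<in> J - F then c k else 0)"
      using F by (intro norm_l2_atoms_diff J) auto
    also have "\<dots> \<le> (\<Sum>k. if k \<in> J - {..<N} then c k else 0)"
    proof (rule suminf_subset_le)
      show "summable (\<lambda>k. if k \<in> J - {..<N} then c k else 0)" by (rule summable_subset_if[OF _ J]) auto
    qed (use F in auto)
    also have "\<dots> = suminf ?f - (\<Sum>k<N. ?f k)" by (rule suminf_tail_eq[OF J])
    also have "\<dots> < e\<^sup>2" using N by (simp add: dist_real_def)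
    finally have "norm (l2_atoms c J - l2_atoms c F) < e" using e by (simp add: power2_less_imp_less)
    then show "dist (\<Sum>k\<in>F. sqrt (c k) *\<^sub>R l2_basis k) (l2_atoms c J) < e"
      using F by (simp add: l2_atoms_finite dist_norm norm_minus_commute)
  qed
qed

context
  fixes I :: "nat set" and \<tau> :: "nat \<Rightarrow> real" and T :: real
  assumes sum: "summable (\<lambda>k. if k \<in> {k\<in>I. \<tau> k \<le> T} then c k else 0)"
begin

text \<open>By orthogonality the neglected squared mass can only grow with t, so its value at T
  controls all earlier times. A is the set of retained indices: the first m atoms for truncation,
  the large atoms for comparison with staircases.\<close>

lemma norm_atom_path_diff:
  assumes "t \<le> T"
  shows "(norm (atom_path c I \<tau> t - l2_atoms c ({k\<in>I. \<tau> k \<le> t} \<inter> A)))\<^sup>2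
    \<le> (\<Sum>k. if k \<in> {k\<in>I. \<tau> k \<le> T} - A then c k else 0)"
proof -
  have sub: "{k\<in>I. \<tau> k \<le> t} \<subseteq> {k\<in>I. \<tau> k \<le> T}" using assms by auto
  have "(norm (atom_path c I \<tau> t - l2_atoms c ({k\<in>I. \<tau> k \<le> t} \<inter> A)))\<^sup>2
      = (\<Sum>k. if k \<in> {k\<in>I. \<tau> k \<le> t} - {k\<in>I. \<tau> k \<le> t} \<inter> A then c k else 0)"
    unfolding atom_path_def using summable_subset_if[OF sub sum] by (intro norm_l2_atoms_diff) auto
  also have "\<dots> \<le> (\<Sum>k. if k \<in> {k\<in>I. \<tau> k \<le> T} - A then c k else 0)"
    using sub by (intro suminf_subset_le summable_subset_if[OF _ sum]) auto
  finally show ?thesis .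
qed

lemma dist_trunc_path: "t \<le> T \<Longrightarrow> dist (atom_path c I \<tau> t) (trunc_path c I \<tau> m t) \<le> sqrt (atom_rest c I \<tau> T m)"
  unfolding dist_norm trunc_path_def atom_rest_def by (intro real_le_rsqrt norm_atom_path_diff)

lemma atom_rest_tendsto_0: "(\<lambda>m. sqrt (atom_rest c I \<tau> T m)) \<longlonglongrightarrow> 0"
  unfolding atom_rest_def using tendsto_real_sqrt[OF suminf_tail_tendsto_0[OF sum]] by simp

lemma finite_trunc_path: "finite (trunc_path c I \<tau> m ` A)"
proof (rule finite_subset)
  show "trunc_path c I \<tau> m ` A \<subseteq> l2_atoms c ` Pow {..<m}" by (auto simp: trunc_path_def)
qed simp

text \<open>Total boundedness: the path truncated to m atoms takes finitely many values, one at most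
  per subset of {..<m}, and is uniformly close to the full path.\<close>

lemma compact_atom_path: "compact (closure (atom_path c I \<tau> ` {0..T}))"
  unfolding compact_eq_totally_bounded complete_eq_closed
proof (intro conjI allI impI)
  show "closed (closure (atom_path c I \<tau> ` {0..T}))" by simp
  fix e :: real assume e: "0 < e"
  then obtain m where m: "sqrt (atom_rest c I \<tau> T m) < e / 2"
    using order_tendstoD(2)[OF atom_rest_tendsto_0, of "e / 2"] by (auto simp: eventually_sequentially)
  have "closure (atom_path c I \<tau> ` {0..T}) \<subseteq> (\<Union>z\<in>trunc_path c I \<tau> m ` {0..T}. ball z e)"
  proof
    fix z assume "z \<in> closure (atom_path c I \<tau> ` {0..T})"
    then obtain t where t: "t \<in> {0..T}" "dist (atom_path c I \<tau> t) z < e / 2"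
      using e unfolding closure_approachable by (metis half_gt_zero imageE)
    have "dist (trunc_path c I \<tau> m t) z < e"
      using t dist_trunc_path[of t m] m dist_triangle[of "trunc_path c I \<tau> m t" z "atom_path c I \<tau> t"]
      by (simp add: dist_commute)
    then show "z \<in> (\<Union>z\<in>trunc_path c I \<tau> m ` {0..T}. ball z e)" using t by auto
  qed
  then show "\<exists>k. finite k \<and> closure (atom_path c I \<tau> ` {0..T}) \<subseteq> (\<Union>x\<in>k. ball x e)"
    using finite_trunc_path by blast
qed

lemma gh_trunc_path_tendsto:
  assumes T: "0 \<le> T"
  shows "(\<lambda>m. gh_of_set (trunc_path c I \<tau> m ` {0..T})) \<longlonglongrightarrow> gh_of_set (closure (atom_path c I \<tau> ` {0..T}))"
proof (rule metric_tendsto_imp_tendsto[OF atom_rest_tendsto_0], intro always_eventually allI)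
  fix m
  have "dist (gh_of_set (trunc_path c I \<tau> m ` {0..T})) (gh_of_set (closure (atom_path c I \<tau> ` {0..T}))) \<le> sqrt (atom_rest c I \<tau> T m)"
  proof (rule field_le_epsilon)
    fix e :: real assume e: "0 < e"
    show "dist (gh_of_set (trunc_path c I \<tau> m ` {0..T})) (gh_of_set (closure (atom_path c I \<tau> ` {0..T}))) \<le> sqrt (atom_rest c I \<tau> T m) + e"
    proof (rule dist_gh_of_set_le_hausdorff)
      fix a assume "a \<in> trunc_path c I \<tau> m ` {0..T}"
      then obtain t where t: "t \<in> {0..T}" "a = trunc_path c I \<tau> m t" by auto
      show "\<exists>b\<in>closure (atom_path c I \<tau> ` {0..T}). dist a b \<le> sqrt (atom_rest c I \<tau> T m) + e"
        using t dist_trunc_path[of t m] e closure_subset[of "atom_path c I \<tau> ` {0..T}"]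
        by (intro bexI[of _ "atom_path c I \<tau> t"]) (auto simp: dist_commute)
    next
      fix b assume "b \<in> closure (atom_path c I \<tau> ` {0..T})"
      then obtain t where t: "t \<in> {0..T}" "dist (atom_path c I \<tau> t) b < e"
        using e unfolding closure_approachable by (metis imageE)
      then show "\<exists>a\<in>trunc_path c I \<tau> m ` {0..T}. dist a b \<le> sqrt (atom_rest c I \<tau> T m) + e"
        using dist_trunc_path[of t m] dist_triangle[of "trunc_path c I \<tau> m t" b "atom_path c I \<tau> t"]
        by (intro bexI[of _ "trunc_path c I \<tau> m t"]) (auto simp: dist_commute)
    qed (use T finite_trunc_path compact_atom_path in \<open>auto intro: finite_imp_compact\<close>)
  qed
  then show "dist (gh_of_set (trunc_path c I \<tau> m ` {0..T})) (gh_of_set (closure (atom_path c I \<tau> ` {0..T}))) \<le> dist (sqrt (atom_rest c I \<tau> T m)) 0"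
    using abs_ge_self[of "sqrt (atom_rest c I \<tau> T m)"] by simp
qed

end

text \<open>A step function attains all its values at time 0 and at its jump times. The range thus
  becomes a family indexed by {0..m} with measurable times, which is the form that measurability
  needs.\<close>

lemma trunc_path_image:
  assumes T: "0 \<le> T" and \<tau>: "\<And>k. k \<in> I \<Longrightarrow> 0 \<le> \<tau> k"
  shows "trunc_path c I \<tau> m ` {0..T} =
    (\<lambda>j. trunc_path c I \<tau> m (if j < m \<and> j \<in> I \<and> \<tau> j \<le> T then \<tau> j else 0)) ` {0..m}"
proof (intro equalityI subsetI)
  fix z assume "z \<in> trunc_path c I \<tau> m ` {0..T}"
  then obtain t where t: "0 \<le> t" "t \<le> T" "z = trunc_path c I \<tau> m t" by auto
  let ?S = "{k\<in>I. \<tau> k \<le> t} \<inter> {..<m}"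
  show "z \<in> (\<lambda>j. trunc_path c I \<tau> m (if j < m \<and> j \<in> I \<and> \<tau> j \<le> T then \<tau> j else 0)) ` {0..m}"
  proof (cases "?S = {}")
    case True
    then have "{k\<in>I. \<tau> k \<le> 0} \<inter> {..<m} = {}" using t by force
    then have "z = trunc_path c I \<tau> m 0" by (simp only: trunc_path_def t True)
    \<comment> \<open>The index m fails \<open>j < m\<close> and hence contributes time 0.\<close>
    then show ?thesis by (intro image_eqI[of _ _ m]) auto
  next
    case False
    have fin: "finite (\<tau> ` ?S)" by simp
    then have "Max (\<tau> ` ?S) \<in> \<tau> ` ?S" using False by (intro Max_in) auto
    then obtain j where j: "j \<in> ?S" "\<tau> j = Max (\<tau> ` ?S)" by auto
    have le: "\<tau> k \<le> \<tau> j" if "k \<in> ?S" for k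
      unfolding j(2) using that fin by (intro Max_ge) auto
    have "{k\<in>I. \<tau> k \<le> \<tau> j} \<inter> {..<m} = ?S" using j(1) le by force
    then have "z = trunc_path c I \<tau> m (\<tau> j)" using t by (simp add: trunc_path_def)
    then show ?thesis using j(1) t by (intro image_eqI[of _ _ j]) auto
  qed
next
  fix z assume "z \<in> (\<lambda>j. trunc_path c I \<tau> m (if j < m \<and> j \<in> I \<and> \<tau> j \<le> T then \<tau> j else 0)) ` {0..m}"
  then show "z \<in> trunc_path c I \<tau> m ` {0..T}" using T \<tau> by (auto split: if_splits)
qed

end

section \<open>Atoms of the Poisson random measure\<close>

lemma prod_lessThan_add:
  fixes f :: "nat \<Rightarrow> 'a :: comm_monoid_mult"
  shows "(\<Prod>e<m + n. f e) = (\<Prod>e<m. f e) * (\<Prod>e<n. f (m + e))"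
  by (induction n) (simp_all add: mult.assoc)

locale poisson_atoms_setup = subordinator_measure \<nu> + W: prob_space W
  for \<nu> :: "ennreal measure" and W :: "'w measure" +
  fixes I :: "'w \<Rightarrow> nat set" and x :: "nat \<Rightarrow> 'w \<Rightarrow> real" and y :: "nat \<Rightarrow> 'w \<Rightarrow> ennreal"
  assumes atoms: "poisson_atoms W \<nu> I x y"
begin

definition \<mu> :: "(real \<times> ennreal) measure"
  where "\<mu> = restrict_space lborel {0..} \<Otimes>\<^sub>M \<nu>"

definition \<N> :: "'w \<Rightarrow> (real \<times> ennreal) measure"
  where "\<N> \<omega> = distr (count_space (I \<omega>)) \<mu> (\<lambda>k. (x k \<omega>, y k \<omega>))"

lemma sets_I: "{\<omega> \<in> space W. k \<in> I \<omega>} \<in> sets W"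
  and x_meas [measurable]: "x k \<in> borel_measurable W" and y_meas [measurable]: "y k \<in> borel_measurable W"
  and xy_pos: "\<omega> \<in> space W \<Longrightarrow> k \<in> I \<omega> \<Longrightarrow> 0 \<le> x k \<omega> \<and> 0 < y k \<omega>"
  and prm: "poisson_random_measure W \<mu> \<N>"
  using atoms by (auto simp: poisson_atoms_def \<mu>_def \<N>_def[abs_def])

lemma pred_I [measurable]: "Measurable.pred W (\<lambda>\<omega>. k \<in> I \<omega>)"
  using sets_I by (simp add: pred_def)

lemma space_\<mu>: "space \<mu> = {0..} \<times> {0<..}"
  by (simp add: \<mu>_def space_pair_measure space_restrict_space space_\<nu>)

lemma Times_in_sets_\<mu>:
  assumes "A \<in> sets borel" "A \<subseteq> {0..}" "B \<in> sets \<nu>" shows "A \<times> B \<in> sets \<mu>"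
  using assms unfolding \<mu>_def by (intro pair_measureI) (auto simp: sets_restrict_space_iff)

lemma emeasure_\<mu>_Times:
  assumes "A \<in> sets borel" "A \<subseteq> {0..}" "B \<in> sets \<nu>"
  shows "emeasure \<mu> (A \<times> B) = emeasure lborel A * emeasure \<nu> B"
  unfolding \<mu>_def using assms
  by (subst emeasure_pair_measure_Times) (auto simp: sets_restrict_space_iff emeasure_restrict_space)

lemma atoms_measurable: "\<omega> \<in> space W \<Longrightarrow> (\<lambda>k. (x k \<omega>, y k \<omega>)) \<in> measurable (count_space (I \<omega>)) \<mu>"
  using xy_pos by (auto simp: space_\<mu>)

lemma emeasure_\<N>:
  assumes "\<omega> \<in> space W" "S \<in> sets \<mu>"
  shows "emeasure (\<N> \<omega>) S = (if finite {k \<in> I \<omega>. (x k \<omega>, y k \<omega>) \<in> S}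
    then of_nat (card {k \<in> I \<omega>. (x k \<omega>, y k \<omega>) \<in> S}) else \<infinity>)"
proof -
  have "emeasure (\<N> \<omega>) S = emeasure (count_space (I \<omega>)) ((\<lambda>k. (x k \<omega>, y k \<omega>)) -` S \<inter> I \<omega>)"
    unfolding \<N>_def using assms by (subst emeasure_distr[OF atoms_measurable]) auto
  also have "(\<lambda>k. (x k \<omega>, y k \<omega>)) -` S \<inter> I \<omega> = {k \<in> I \<omega>. (x k \<omega>, y k \<omega>) \<in> S}" by auto
  finally show ?thesis by (simp add: emeasure_count_space)
qed

lemma emeasure_\<N>_measurable: "S \<in> sets \<mu> \<Longrightarrow> (\<lambda>\<omega>. emeasure (\<N> \<omega>) S) \<in> borel_measurable W"
  using prm unfolding poisson_random_measure_def by auto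

lemma prob_\<N>_eq:
  assumes "S \<in> sets \<mu>" "emeasure \<mu> S < \<infinity>"
  shows "W.prob {\<omega> \<in> space W. emeasure (\<N> \<omega>) S = of_nat j} = measure \<mu> S ^ j / fact j * exp (- measure \<mu> S)"
  using prm assms unfolding poisson_random_measure_def by blast

text \<open>The Poisson weights of the finite counts already add up to exp m * exp (- m) =
  1.\<close>

lemma AE_\<N>_finite:
  assumes S: "S \<in> sets \<mu>" "emeasure \<mu> S < \<infinity>"
  shows "AE \<omega> in W. emeasure (\<N> \<omega>) S < \<infinity>"
proof -
  note [measurable] = emeasure_\<N>_measurable[OF S(1)]
  let ?m = "measure \<mu> S"
  let ?A = "\<lambda>j :: nat. {\<omega> \<in> space W. emeasure (\<N> \<omega>) S = of_nat j}"
  have "(\<lambda>j. W.prob (?A j)) sums W.prob (\<Union>j. ?A j)"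
    by (rule W.finite_measure_UNION) (auto simp: disjoint_family_on_def)
  moreover have "(\<lambda>j. W.prob (?A j)) sums (exp ?m * exp (- ?m))"
    unfolding prob_\<N>_eq[OF S] using exp_converges[of ?m]
    by (intro sums_mult2) (simp add: divide_inverse mult.commute)
  ultimately have "W.prob (\<Union>j. ?A j) = 1"
    using sums_unique2 by (simp add: exp_minus_inverse) blast
  then have "AE \<omega> in W. \<omega> \<in> (\<Union>j. ?A j)" by (intro W.AE_prob_1)
  then show ?thesis by eventually_elim (auto simp: of_nat_less_top)
qed

text \<open>A Poisson count of mean 0 vanishes with probability 1; this rules out atoms in
  exceptional regions.\<close>

lemma AE_\<N>_null:
  assumes S: "S \<in> sets \<mu>" "emeasure \<mu> S = 0"
  shows "AE \<omega> in W. \<forall>k\<in>I \<omega>. (x k \<omega>, y k \<omega>) \<notin> S"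
proof -
  have "W.prob {\<omega> \<in> space W. emeasure (\<N> \<omega>) S = of_nat 0} = 1"
    using S by (subst prob_\<N>_eq) (auto simp: measure_def)
  then have "AE \<omega> in W. \<omega> \<in> {\<omega> \<in> space W. emeasure (\<N> \<omega>) S = of_nat 0}" by (rule W.AE_prob_1)
  then show ?thesis
    by eventually_elim (use S(1) in \<open>auto simp: emeasure_\<N> split: if_splits\<close>)
qed

lemma nn_integral_emeasure_\<N>:
  assumes S: "S \<in> sets \<mu>"
  shows "(\<integral>\<^sup>+\<omega>. emeasure (\<N> \<omega>) S \<partial>W) = emeasure \<mu> S"
proof (cases "emeasure \<mu> S = \<infinity>")
  case True
  then have "AE \<omega> in W. emeasure (\<N> \<omega>) S = \<infinity>"
    using prm S unfolding poisson_random_measure_def by blast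
  then have "(\<integral>\<^sup>+\<omega>. emeasure (\<N> \<omega>) S \<partial>W) = (\<integral>\<^sup>+\<omega>. \<infinity> \<partial>W)" by (rule nn_integral_cong_AE)
  then show ?thesis using True by (simp add: W.emeasure_space_1)
next
  case False
  then have fin: "emeasure \<mu> S < \<infinity>" by (simp add: less_top)
  note [measurable] = emeasure_\<N>_measurable[OF S]
  let ?m = "measure \<mu> S"
  let ?A = "\<lambda>j :: nat. {\<omega> \<in> space W. emeasure (\<N> \<omega>) S = of_nat j}"
  have "(\<integral>\<^sup>+\<omega>. emeasure (\<N> \<omega>) S \<partial>W) = (\<integral>\<^sup>+\<omega>. (\<Sum>j. of_nat j * indicator (?A j) \<omega>) \<partial>W)"
  proof (rule nn_integral_cong_AE)
    show "AE \<omega> in W. emeasure (\<N> \<omega>) S = (\<Sum>j. of_nat j * indicator (?A j) \<omega>)"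
      using AE_\<N>_finite[OF S fin] AE_space
    proof eventually_elim
      case (elim \<omega>)
      then obtain i :: nat where i: "emeasure (\<N> \<omega>) S = of_nat i"
        using S by (auto simp: emeasure_\<N> split: if_splits)
      have "(\<Sum>j. of_nat j * indicator (?A j) \<omega> :: ennreal) = (\<Sum>j. if j = i then of_nat j else 0)"
        using i elim by (intro suminf_cong) auto
      also have "\<dots> = (\<Sum>j\<in>{i}. if j = i then of_nat j else 0)" by (rule suminf_finite) auto
      finally show ?case using i by simp
    qed
  qed
  also have "\<dots> = (\<Sum>j. \<integral>\<^sup>+\<omega>. of_nat j * indicator (?A j) \<omega> \<partial>W)"
    by (rule nn_integral_suminf) measurable
  also have "\<dots> = (\<Sum>j. ennreal (real j * W.prob (?A j)))"
  proof (intro suminf_cong)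
    fix j
    have "(\<integral>\<^sup>+\<omega>. of_nat j * indicator (?A j) \<omega> \<partial>W) = of_nat j * emeasure W (?A j)"
      by (rule nn_integral_cmult_indicator) measurable
    then show "(\<integral>\<^sup>+\<omega>. of_nat j * indicator (?A j) \<omega> \<partial>W) = ennreal (real j * W.prob (?A j))"
      by (simp add: W.emeasure_eq_measure ennreal_mult ennreal_of_nat_eq_real_of_nat)
  qed
  also have "\<dots> = ennreal ?m"
  proof (rule suminf_ennreal_eq)
    have "(\<lambda>j. ?m ^ j / fact j * (?m * exp (- ?m))) sums (exp ?m * (?m * exp (- ?m)))"
      using exp_converges[of ?m] by (intro sums_mult2) (simp add: divide_inverse mult.commute)
    \<comment> \<open>Mean of the Poisson law: the factor Suc j cancels against the factorial,
      leaving m times the exponential series; the term j = 0 contributes nothing.\<close>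
    then have "(\<lambda>j. real (Suc j) * W.prob (?A (Suc j))) sums (exp ?m * (?m * exp (- ?m)))"
      unfolding prob_\<N>_eq[OF S fin] fact_Suc of_nat_mult power_Suc
      by (rule sums_cong[THEN iffD1, rotated]) (simp add: divide_simps del: of_nat_Suc)
    then have "(\<lambda>j. real j * W.prob (?A j)) sums (exp ?m * (?m * exp (- ?m)))"
      by (subst (asm) sums_Suc_iff) simp
    moreover have "exp ?m * (?m * exp (- ?m)) = ?m" by (simp add: exp_minus)
    ultimately show "(\<lambda>j. real j * W.prob (?A j)) sums ?m" by (simp only:)
  qed simp
  also have "\<dots> = emeasure \<mu> S" using False by (simp add: emeasure_eq_ennreal_measure)
  finally show ?thesis .
qed

text \<open>Campbell's formula, by induction over Borel functions from the mean of a single count.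
  Measurability of the inner integral is carried along because the steps for sums and suprema use
  it.\<close>

lemma
  assumes g: "g \<in> borel_measurable \<mu>"
  shows nn_integral_\<N>_measurable: "(\<lambda>\<omega>. \<integral>\<^sup>+z. g z \<partial>\<N> \<omega>) \<in> borel_measurable W" (is "?M g")
    and campbell_\<N>: "(\<integral>\<^sup>+\<omega>. (\<integral>\<^sup>+z. g z \<partial>\<N> \<omega>) \<partial>W) = (\<integral>\<^sup>+z. g z \<partial>\<mu>)" (is "?E g")
proof -
  have sets: "sets (\<N> \<omega>) = sets \<mu>" "space (\<N> \<omega>) = space \<mu>" for \<omega> by (simp_all add: \<N>_def)
  have "?M g \<and> ?E g"
    using g
  proof (induction g rule: borel_measurable_induct)
    case (cong f g)
    have "(\<integral>\<^sup>+z. f z \<partial>\<N> \<omega>) = (\<integral>\<^sup>+z. g z \<partial>\<N> \<omega>)" for \<omega>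
      using cong by (intro nn_integral_cong) (simp add: sets)
    moreover have "(\<integral>\<^sup>+z. f z \<partial>\<mu>) = (\<integral>\<^sup>+z. g z \<partial>\<mu>)" using cong by (intro nn_integral_cong) simp
    ultimately show ?case using cong by simp
  next
    case (set A)
    then have "(\<integral>\<^sup>+z. indicator A z \<partial>\<N> \<omega>) = emeasure (\<N> \<omega>) A" for \<omega> by (simp add: sets)
    then show ?case using set by (simp add: emeasure_\<N>_measurable nn_integral_emeasure_\<N>)
  next
    case (mult u c)
    have "u \<in> borel_measurable (\<N> \<omega>)" for \<omega>
      using mult by (simp add: measurable_cong_sets[OF sets(1) refl])
    then show ?case using mult by (auto simp: nn_integral_cmult intro!: borel_measurable_times_ennreal)
  next
    case (add u v)
    have "u \<in> borel_measurable (\<N> \<omega>)" "v \<in> borel_measurable (\<N> \<omega>)" for \<omega>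
      using add by (simp_all add: measurable_cong_sets[OF sets(1) refl])
    then show ?case using add by (auto simp: nn_integral_add intro!: borel_measurable_add)
  next
    case (seq U)
    have m: "U i \<in> borel_measurable (\<N> \<omega>)" for \<omega> i
      using seq by (simp add: measurable_cong_sets[OF sets(1) refl])
    have SUP: "(\<integral>\<^sup>+z. (SUP i. U i) z \<partial>\<N> \<omega>) = (SUP i. \<integral>\<^sup>+z. U i z \<partial>\<N> \<omega>)" for \<omega>
      using seq m by (simp add: nn_integral_monotone_convergence_SUP image_comp)
    have SUP': "(\<integral>\<^sup>+z. (SUP i. U i) z \<partial>\<mu>) = (SUP i. \<integral>\<^sup>+z. U i z \<partial>\<mu>)"
      using seq by (simp add: nn_integral_monotone_convergence_SUP image_comp)
    have inc: "incseq (\<lambda>i \<omega>. \<integral>\<^sup>+z. U i z \<partial>\<N> \<omega>)"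
      using seq by (auto simp: incseq_def le_fun_def intro!: nn_integral_mono)
    have mm: "(\<lambda>\<omega>. \<integral>\<^sup>+z. U i z \<partial>\<N> \<omega>) \<in> borel_measurable W" for i using seq by blast
    have "(\<integral>\<^sup>+\<omega>. (SUP i. \<integral>\<^sup>+z. U i z \<partial>\<N> \<omega>) \<partial>W) = (SUP i. \<integral>\<^sup>+\<omega>. (\<integral>\<^sup>+z. U i z \<partial>\<N> \<omega>) \<partial>W)"
      using nn_integral_monotone_convergence_SUP[OF inc mm] by simp
    then show ?case unfolding SUP SUP' using seq mm by (auto intro: borel_measurable_SUP)
  qed
  then show "?M g" "?E g" by auto
qed

lemma nn_integral_\<N>:
  assumes "\<omega> \<in> space W" "g \<in> borel_measurable \<mu>"
  shows "(\<integral>\<^sup>+z. g z \<partial>\<N> \<omega>) = (\<integral>\<^sup>+k. g (x k \<omega>, y k \<omega>) \<partial>count_space (I \<omega>))"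
  unfolding \<N>_def using assms by (subst nn_integral_distr[OF atoms_measurable]) auto

lemma campbell:
  assumes h: "h \<in> borel_measurable borel" and T: "0 \<le> T"
  shows "(\<lambda>\<omega>. \<integral>\<^sup>+k. indicator {0..T} (x k \<omega>) * h (y k \<omega>) \<partial>count_space (I \<omega>)) \<in> borel_measurable W" (is ?M)
    and "(\<integral>\<^sup>+\<omega>. (\<integral>\<^sup>+k. indicator {0..T} (x k \<omega>) * h (y k \<omega>) \<partial>count_space (I \<omega>)) \<partial>W) = ennreal T * (\<integral>\<^sup>+z. h z \<partial>\<nu>)" (is ?E)
proof -
  let ?g = "\<lambda>(t, z). indicator {0..T} t * h z :: ennreal"
  have h\<nu>: "h \<in> borel_measurable \<nu>" by (rule borel_measurable_\<nu>[OF h])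
  have ind: "indicator {0..T} \<in> borel_measurable (restrict_space lborel {0..})"
    by (rule measurable_restrict_space1) simp
  have g: "?g \<in> borel_measurable \<mu>"
    unfolding \<mu>_def case_prod_beta using h\<nu> ind
    by (intro borel_measurable_times_ennreal measurable_compose[OF measurable_fst ind] measurable_compose[OF measurable_snd h\<nu>])
  have eq: "(\<integral>\<^sup>+z. ?g z \<partial>\<N> \<omega>) = (\<integral>\<^sup>+k. indicator {0..T} (x k \<omega>) * h (y k \<omega>) \<partial>count_space (I \<omega>))"
    if "\<omega> \<in> space W" for \<omega>
    using nn_integral_\<N>[OF that g] by simp
  show ?M by (rule iffD1[OF measurable_cong nn_integral_\<N>_measurable[OF g]]) (rule eq)
  have "(\<integral>\<^sup>+\<omega>. (\<integral>\<^sup>+k. indicator {0..T} (x k \<omega>) * h (y k \<omega>) \<partial>count_space (I \<omega>)) \<partial>W) = (\<integral>\<^sup>+\<omega>. (\<integral>\<^sup>+z. ?g z \<partial>\<N> \<omega>) \<partial>W)"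
    by (rule nn_integral_cong) (rule eq[symmetric])
  also have "\<dots> = (\<integral>\<^sup>+z. ?g z \<partial>\<mu>)" by (rule campbell_\<N>[OF g])
  also have "\<dots> = (\<integral>\<^sup>+t. \<integral>\<^sup>+z. indicator {0..T} t * h z \<partial>\<nu> \<partial>restrict_space lborel {0..})"
    using nn_integral_fst[OF g[unfolded \<mu>_def]] by (simp add: \<mu>_def)
  also have "\<dots> = (\<integral>\<^sup>+t. indicator {0..T} t * (\<integral>\<^sup>+z. h z \<partial>\<nu>) \<partial>restrict_space lborel {0..})"
    using h\<nu> by (intro nn_integral_cong) (simp add: nn_integral_cmult)
  also have "\<dots> = (\<integral>\<^sup>+t. indicator {0..T} t \<partial>restrict_space lborel {0..}) * (\<integral>\<^sup>+z. h z \<partial>\<nu>)"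
    using ind by (rule nn_integral_multc)
  also have "(\<integral>\<^sup>+t. indicator {0..T} t \<partial>restrict_space lborel {0..}) = (\<integral>\<^sup>+t. indicator {0..T} t \<partial>lborel)"
    by (subst nn_integral_restrict_space) (simp, intro nn_integral_cong, simp split: split_indicator)
  also have "\<dots> = ennreal T" using T by simp
  finally show ?E .
qed

end

section \<open>Regular outcomes and measurability of the crinkled range\<close>

context poisson_atoms_setup
begin

abbreviation c :: "'w \<Rightarrow> nat \<Rightarrow> real"
  where "c \<omega> k \<equiv> enn2real (y k \<omega>)"

abbreviation xs :: "'w \<Rightarrow> nat \<Rightarrow> real"
  where "xs \<omega> k \<equiv> x k \<omega>"

text \<open>The almost sure properties that make the crinkled path an actual path in l2. Times are
  positive because time blocks exclude 0; sizes are finite up to T because \<open>enn2real\<close>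
  would turn an infinite size into 0.\<close>

definition regular :: "real \<Rightarrow> 'w \<Rightarrow> bool"
  where "regular T \<omega> \<longleftrightarrow> (\<forall>k\<in>I \<omega>. 0 < x k \<omega>) \<and> (\<forall>k\<in>I \<omega>. x k \<omega> \<le> T \<longrightarrow> y k \<omega> \<noteq> \<infinity>) \<and>
    summable (\<lambda>k. if k \<in> {k\<in>I \<omega>. x k \<omega> \<le> T} then c \<omega> k else 0)"

lemma nn_integral_atoms_suminf:
  assumes \<omega>: "\<omega> \<in> space W" and h: "\<And>k. k \<in> I \<omega> \<Longrightarrow> x k \<omega> \<le> T \<Longrightarrow> h (y k \<omega>) = ennreal (f k)"
  shows "(\<integral>\<^sup>+k. indicator {0..T} (x k \<omega>) * h (y k \<omega>) \<partial>count_space (I \<omega>)) =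
    (\<Sum>k. ennreal (if k \<in> {k\<in>I \<omega>. x k \<omega> \<le> T} then f k else 0))"
proof -
  have "(\<integral>\<^sup>+k. indicator {0..T} (x k \<omega>) * h (y k \<omega>) \<partial>count_space (I \<omega>)) =
      (\<integral>\<^sup>+k. indicator {0..T} (x k \<omega>) * h (y k \<omega>) * indicator (I \<omega>) k \<partial>count_space UNIV)"
    using nn_integral_restrict_space[of "I \<omega>" "count_space UNIV" "\<lambda>k. indicator {0..T} (x k \<omega>) * h (y k \<omega>)"]
    by (simp add: restrict_count_space)
  also have "\<dots> = (\<Sum>k. indicator {0..T} (x k \<omega>) * h (y k \<omega>) * indicator (I \<omega>) k)"
    by (rule nn_integral_count_space_nat)
  also have "\<dots> = (\<Sum>k. ennreal (if k \<in> {k\<in>I \<omega>. x k \<omega> \<le> T} then f k else 0))"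
    using h xy_pos[OF \<omega>] by (intro suminf_cong) (auto simp: indicator_def)
  finally show ?thesis .
qed

text \<open>Atoms at time 0 or of infinite size lie in null sets of the intensity. Campbell's
  formula for min 1 z makes the truncated sizes up to time T summable almost surely.\<close>

lemma AE_regular:
  assumes T: "0 \<le> T" shows "AE \<omega> in W. regular T \<omega>"
proof -
  have s: "{0<..} \<in> sets \<nu>" "{\<infinity>} \<in> sets \<nu>" by (auto simp: in_sets_\<nu>)
  have 1: "AE \<omega> in W. \<forall>k\<in>I \<omega>. (x k \<omega>, y k \<omega>) \<notin> {0} \<times> {0<..}"
    using s by (intro AE_\<N>_null Times_in_sets_\<mu>) (auto simp: emeasure_\<mu>_Times)
  have 2: "AE \<omega> in W. \<forall>k\<in>I \<omega>. (x k \<omega>, y k \<omega>) \<notin> {0..T} \<times> {\<infinity>}"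
    using s by (intro AE_\<N>_null Times_in_sets_\<mu>) (auto simp: emeasure_\<mu>_Times \<nu>_top \<nu>_top')
  have "AE z in \<nu>. z \<noteq> \<infinity>"
    using s \<nu>_top by (intro AE_I[of _ _ "{\<infinity>}"]) auto
  then have "(\<integral>\<^sup>+z. min 1 z \<partial>\<nu>) = (\<integral>\<^sup>+z\<in>{0<..<\<infinity>}. min 1 z \<partial>\<nu>)"
  proof (intro nn_integral_cong_AE)
    assume "AE z in \<nu>. z \<noteq> \<infinity>"
    then show "AE z in \<nu>. min 1 z = min 1 z * indicator {0<..<\<infinity>} z"
      using AE_space by eventually_elim (simp add: space_\<nu> less_top)
  qed
  then have fin: "(\<integral>\<^sup>+z. min 1 z \<partial>\<nu>) < \<infinity>" using \<nu>_int by simp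
  let ?h = "\<lambda>z :: ennreal. min 1 z"
  have h: "?h \<in> borel_measurable borel" by measurable
  have 3: "AE \<omega> in W. (\<integral>\<^sup>+k. indicator {0..T} (x k \<omega>) * ?h (y k \<omega>) \<partial>count_space (I \<omega>)) \<noteq> \<infinity>"
    using fin by (intro nn_integral_PInf_AE campbell(1)[OF h T])
      (auto simp: campbell(2)[OF h T] ennreal_mult_eq_top_iff)
  show ?thesis
    using 1 2 3 AE_space
  proof eventually_elim
    case (elim \<omega>)
    have pos: "0 < x k \<omega>" if "k \<in> I \<omega>" for k
      using elim(1,4) that xy_pos[of \<omega> k] by (cases "x k \<omega> = 0") auto
    have fin: "y k \<omega> \<noteq> \<infinity>" if "k \<in> I \<omega>" "x k \<omega> \<le> T" for k
      using elim(2) that pos[OF that(1)] by (auto dest: less_imp_le)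
    let ?f = "\<lambda>k. if k \<in> {k\<in>I \<omega>. x k \<omega> \<le> T} then min 1 (c \<omega> k) else 0"
    have "?h (y k \<omega>) = ennreal (min 1 (c \<omega> k))" if "k \<in> I \<omega>" "x k \<omega> \<le> T" for k
      using fin[OF that] by (cases "y k \<omega>") (auto simp: min_def ennreal_1[symmetric] simp del: ennreal_1)
    then have "(\<integral>\<^sup>+k. indicator {0..T} (x k \<omega>) * ?h (y k \<omega>) \<partial>count_space (I \<omega>)) = (\<Sum>k. ennreal (?f k))"
      by (intro nn_integral_atoms_suminf elim)
    then have sum: "summable ?f" using elim(3) by (intro summable_suminf_not_top) auto
    \<comment> \<open>Summable terms tend to 0, so the truncation at 1 is eventually inactive and
      may be removed.\<close>
    have "\<forall>\<^sub>F k in sequentially. ?f k < 1"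
      by (rule order_tendstoD(2)[OF summable_LIMSEQ_zero[OF sum]]) simp
    then have "\<forall>\<^sub>F k in sequentially. ?f k = (if k \<in> {k\<in>I \<omega>. x k \<omega> \<le> T} then c \<omega> k else 0)"
      by eventually_elim (auto simp: min_def split: if_splits)
    then have "summable (\<lambda>k. if k \<in> {k\<in>I \<omega>. x k \<omega> \<le> T} then c \<omega> k else 0)"
      using sum by (simp only: summable_cong)
    then show ?case unfolding regular_def using pos fin by auto
  qed
qed

lemma crinkled_subordinator_eq:
  assumes r: "regular T \<omega>" and t: "t \<le> T"
  shows "crinkled_subordinator I x y t \<omega> = atom_path (c \<omega>) (I \<omega>) (xs \<omega>) t"
  unfolding crinkled_subordinator_def atom_path_def
proof (rule infsumI, rule has_sum_l2_atoms)
  show "summable (\<lambda>k. if k \<in> {k \<in> I \<omega>. x k \<omega> \<le> t} then c \<omega> k else 0)"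
    by (rule summable_subset_if[of "c \<omega>" _ "{k \<in> I \<omega>. x k \<omega> \<le> T}"]) (use r t in \<open>auto simp: regular_def\<close>)
qed simp

lemma crinkled_range_eq:
  assumes r: "regular T \<omega>"
  shows "crinkled_range I x y T \<omega> = closure (atom_path (c \<omega>) (I \<omega>) (xs \<omega>) ` {0..T})"
  unfolding crinkled_range_def using crinkled_subordinator_eq[OF r]
  by (intro arg_cong[where f = closure] image_cong) auto

text \<open>On regular outcomes the range is the Gromov-Hausdorff limit of ranges of truncated
  paths, each of which consists of finitely many measurable points.\<close>

lemma measurable_gh_crinkled_range:
  assumes T: "0 \<le> T"
  shows "(\<lambda>\<omega>. gh_of_set (crinkled_range I x y T \<omega>)) \<in> borel_measurable (completion W)"
proof (rule borel_measurable_completion_AE_lim)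
  let ?t = "\<lambda>m j \<omega>. if j < m \<and> j \<in> I \<omega> \<and> x j \<omega> \<le> T then x j \<omega> else 0"
  let ?s = "\<lambda>m j \<omega>. trunc_path (c \<omega>) (I \<omega>) (xs \<omega>) m (?t m j \<omega>)"
  show "AE \<omega> in W. (\<lambda>m. gh_of_set ((\<lambda>j. ?s m j \<omega>) ` {0..m})) \<longlonglongrightarrow> gh_of_set (crinkled_range I x y T \<omega>)"
    using AE_regular[OF T] AE_space
  proof eventually_elim
    case (elim \<omega>)
    have "trunc_path (c \<omega>) (I \<omega>) (xs \<omega>) m ` {0..T} = (\<lambda>j. ?s m j \<omega>) ` {0..m}" for m
      by (rule trunc_path_image) (use T xy_pos elim in auto)
    then show ?case
      using gh_trunc_path_tendsto[of "c \<omega>" "I \<omega>" "xs \<omega>" T] elim T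
      by (simp add: crinkled_range_eq regular_def)
  qed
  show "(\<lambda>\<omega>. gh_of_set ((\<lambda>j. ?s m j \<omega>) ` {0..m})) \<in> borel_measurable W" for m
  proof (rule measurable_gh_of_set_image)
    fix j
    define u where "u = ?t m j"
    have u [measurable]: "u \<in> borel_measurable W" unfolding u_def by measurable
    let ?f = "\<lambda>\<omega>. \<Sum>k<m. if k \<in> I \<omega> \<and> x k \<omega> \<le> u \<omega> then sqrt (c \<omega> k) *\<^sub>R l2_basis k else 0"
    have eq: "?s m j \<omega> = ?f \<omega>" for \<omega>
    proof -
      have "?s m j \<omega> = (\<Sum>k\<in>{k\<in>I \<omega>. x k \<omega> \<le> u \<omega>} \<inter> {..<m}. sqrt (c \<omega> k) *\<^sub>R l2_basis k)"
        unfolding trunc_path_def u_def by (rule l2_atoms_finite) auto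
      also have "\<dots> = (\<Sum>k\<in>{..<m}. if k \<in> {k\<in>I \<omega>. x k \<omega> \<le> u \<omega>} then sqrt (c \<omega> k) *\<^sub>R l2_basis k else 0)"
        by (subst Int_commute, rule sum.inter_restrict) simp
      finally show ?thesis by simp
    qed
    have "?f \<in> borel_measurable W"
    proof (intro borel_measurable_sum measurable_If)
      show "(\<lambda>\<omega>. sqrt (c \<omega> k) *\<^sub>R l2_basis k) \<in> borel_measurable W" for k
        by (intro borel_measurable_scaleR) measurable
      show "{\<omega> \<in> space W. k \<in> I \<omega> \<and> x k \<omega> \<le> u \<omega>} \<in> sets W" for k by measurable
    qed simp
    then show "?s m j \<in> borel_measurable W" unfolding eq .
  qed
qed

text \<open>The sum of the sizes of the small atoms is the squared norm of their joint contribution,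
  hence the bound \<eta>^2. It is stated as an integral over atoms so that Campbell's formula
  applies to it.\<close>

definition small_jumps :: "real \<Rightarrow> real \<Rightarrow> real \<Rightarrow> 'w set"
  where "small_jumps T s \<eta> = {\<omega> \<in> space W.
    (\<integral>\<^sup>+k. indicator {0..T} (x k \<omega>) * (y k \<omega> * indicator {0<..ennreal s} (y k \<omega>)) \<partial>count_space (I \<omega>)) \<le> ennreal (\<eta>\<^sup>2)}"

text \<open>Markov's inequality for that sum; its mean is T times the integral of z over (0,
  s].\<close>

lemma
  assumes T: "0 \<le> T" and \<eta>: "0 < \<eta>"
  shows small_jumps_in_sets: "small_jumps T s \<eta> \<in> sets W"
    and prob_small_jumps: "ennreal (1 - W.prob (small_jumps T s \<eta>)) \<le>
      ennreal (T / \<eta>\<^sup>2) * (\<integral>\<^sup>+z\<in>{0<..ennreal s}. z \<partial>\<nu>)"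
proof -
  let ?h = "\<lambda>z. z * indicator {0<..ennreal s} z :: ennreal"
  let ?F = "\<lambda>\<omega>. \<integral>\<^sup>+k. indicator {0..T} (x k \<omega>) * ?h (y k \<omega>) \<partial>count_space (I \<omega>)"
  have h: "?h \<in> borel_measurable borel" by measurable
  note [measurable] = campbell(1)[OF h T]
  show sets: "small_jumps T s \<eta> \<in> sets W" unfolding small_jumps_def by measurable
  have "ennreal (1 - W.prob (small_jumps T s \<eta>)) = emeasure W (space W - small_jumps T s \<eta>)"
    using sets by (simp add: W.emeasure_eq_measure W.prob_compl)
  also have "\<dots> \<le> emeasure W {\<omega> \<in> space W. 1 \<le> ennreal (1 / \<eta>\<^sup>2) * ?F \<omega>}"
  proof (rule emeasure_mono)
    show "space W - small_jumps T s \<eta> \<subseteq> {\<omega> \<in> space W. 1 \<le> ennreal (1 / \<eta>\<^sup>2) * ?F \<omega>}"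
    proof
      fix \<omega> assume \<omega>: "\<omega> \<in> space W - small_jumps T s \<eta>"
      then have "ennreal (\<eta>\<^sup>2) \<le> ?F \<omega>" by (auto simp: small_jumps_def not_le less_imp_le)
      then have "ennreal (1 / \<eta>\<^sup>2) * ennreal (\<eta>\<^sup>2) \<le> ennreal (1 / \<eta>\<^sup>2) * ?F \<omega>" by (intro mult_left_mono) auto
      moreover have "ennreal (1 / \<eta>\<^sup>2) * ennreal (\<eta>\<^sup>2) = 1"
        using \<eta> by (simp add: ennreal_mult[symmetric])
      ultimately show "\<omega> \<in> {\<omega> \<in> space W. 1 \<le> ennreal (1 / \<eta>\<^sup>2) * ?F \<omega>}" using \<omega> by simp
    qed
  qed measurable
  also have "\<dots> \<le> ennreal (1 / \<eta>\<^sup>2) * (\<integral>\<^sup>+\<omega>. ?F \<omega> * indicator (space W) \<omega> \<partial>W)"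
    by (rule nn_integral_Markov_inequality) measurable
  also have "(\<integral>\<^sup>+\<omega>. ?F \<omega> * indicator (space W) \<omega> \<partial>W) = (\<integral>\<^sup>+\<omega>. ?F \<omega> \<partial>W)" by (intro nn_integral_cong) simp
  also have "\<dots> = ennreal T * (\<integral>\<^sup>+z\<in>{0<..ennreal s}. z \<partial>\<nu>)" by (rule campbell(2)[OF h T])
  also have "ennreal (1 / \<eta>\<^sup>2) * (ennreal T * (\<integral>\<^sup>+z\<in>{0<..ennreal s}. z \<partial>\<nu>)) = ennreal (T / \<eta>\<^sup>2) * (\<integral>\<^sup>+z\<in>{0<..ennreal s}. z \<partial>\<nu>)"
    using T \<eta> by (simp add: mult.assoc[symmetric] ennreal_mult[symmetric])
  finally show "ennreal (1 - W.prob (small_jumps T s \<eta>)) \<le> ennreal (T / \<eta>\<^sup>2) * (\<integral>\<^sup>+z\<in>{0<..ennreal s}. z \<partial>\<nu>)" .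
qed

lemma small_jumps_suminf:
  assumes \<omega>: "\<omega> \<in> small_jumps T s \<eta>" and r: "regular T \<omega>" and s: "0 < s"
  shows "(\<Sum>k. if k \<in> {k\<in>I \<omega>. x k \<omega> \<le> T} - {k. s < c \<omega> k} then c \<omega> k else 0) \<le> \<eta>\<^sup>2"
proof -
  have sp: "\<omega> \<in> space W" using \<omega> by (simp add: small_jumps_def)
  let ?f = "\<lambda>k. if c \<omega> k \<le> s then c \<omega> k else 0"
  have h: "y k \<omega> * indicator {0<..ennreal s} (y k \<omega>) = ennreal (?f k)" if k: "k \<in> I \<omega>" "x k \<omega> \<le> T" for k
  proof (cases "y k \<omega>")
    case (real u)
    then show ?thesis using xy_pos[OF sp k(1)] s by (auto simp: indicator_def)
  next
    case top
    then show ?thesis using r k by (auto simp: regular_def)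
  qed
  have "(\<integral>\<^sup>+k. indicator {0..T} (x k \<omega>) * (y k \<omega> * indicator {0<..ennreal s} (y k \<omega>)) \<partial>count_space (I \<omega>))
      = (\<Sum>k. ennreal (if k \<in> {k\<in>I \<omega>. x k \<omega> \<le> T} then ?f k else 0))"
    by (rule nn_integral_atoms_suminf[where h = "\<lambda>z. z * indicator {0<..ennreal s} z" and f = ?f, OF sp h])
  also have "(\<lambda>k. if k \<in> {k\<in>I \<omega>. x k \<omega> \<le> T} then ?f k else 0) =
      (\<lambda>k. if k \<in> {k\<in>I \<omega>. x k \<omega> \<le> T} - {k. s < c \<omega> k} then c \<omega> k else 0)" by auto
  also have "(\<Sum>k. ennreal (if k \<in> {k\<in>I \<omega>. x k \<omega> \<le> T} - {k. s < c \<omega> k} then c \<omega> k else 0))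
      = ennreal (\<Sum>k. if k \<in> {k\<in>I \<omega>. x k \<omega> \<le> T} - {k. s < c \<omega> k} then c \<omega> k else 0)"
  proof (rule suminf_ennreal2)
    show "summable (\<lambda>k. if k \<in> {k\<in>I \<omega>. x k \<omega> \<le> T} - {k. s < c \<omega> k} then c \<omega> k else 0)"
      by (rule summable_subset_if[of "c \<omega>" _ "{k \<in> I \<omega>. x k \<omega> \<le> T}"]) (use r in \<open>auto simp: regular_def\<close>)
  qed auto
  finally have "ennreal (\<Sum>k. if k \<in> {k\<in>I \<omega>. x k \<omega> \<le> T} - {k. s < c \<omega> k} then c \<omega> k else 0) \<le> ennreal (\<eta>\<^sup>2)"
    using \<omega> by (simp add: small_jumps_def)
  then show ?thesis by (subst (asm) ennreal_le_iff) auto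
qed

section \<open>Words read off the Poisson atoms\<close>

context
  fixes T s :: real and q :: nat and t :: "nat \<Rightarrow> real"
  assumes T: "0 < T" and q: "0 < q" and s: "0 < s" and t0: "t 0 = s" and t_mono: "strict_mono t"
begin

abbreviation cell :: "nat \<Rightarrow> ennreal set"
  where "cell j \<equiv> (if j = 0 then {} else {ennreal (t (j - 1))<..ennreal (t j)})"

text \<open>The counterpart of \<open>block_config\<close> for atoms, phrased through counts on
  rectangles so that the law and independence in \<open>poisson_random_measure\<close> apply
  directly. Cell 0 is empty, so letter 0 leaves the whole region above s to the second
  condition.\<close>

definition atom_config :: "(nat \<Rightarrow> nat) \<Rightarrow> 'w set"
  where "atom_config \<kappa> = {\<omega> \<in> space W. \<forall>i<q.
    emeasure (\<N> \<omega>) (time_block T q i \<times> cell (\<kappa> i)) = of_nat (if \<kappa> i = 0 then 0 else 1) \<and>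
    emeasure (\<N> \<omega>) (time_block T q i \<times> ({ennreal s<..} - cell (\<kappa> i))) = of_nat 0}"

lemma t_pos: "0 < t j"
  using s t0 strict_mono_less_eq[OF t_mono, of 0 j] by simp

lemma cell_subset: "cell j \<subseteq> {ennreal s<..}"
proof -
  have "ennreal s \<le> ennreal (t (j - 1))"
    using strict_mono_less_eq[OF t_mono, of 0 "j - 1"] by (intro ennreal_leI) (simp add: t0)
  then show ?thesis by (auto intro: le_less_trans)
qed

lemma cell_disjoint:
  assumes "i \<noteq> j" shows "cell i \<inter> cell j = {}"
proof -
  have *: "cell i \<inter> cell j = {}" if "i < j" for i j
  proof -
    have "ennreal (t i) \<le> ennreal (t (j - 1))"
      using that strict_mono_less_eq[OF t_mono, of i "j - 1"] by (intro ennreal_leI) simp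
    then show ?thesis by (auto dest: le_less_trans)
  qed
  show ?thesis using *[of i j] *[of j i] assms by (cases "i < j") auto
qed

lemma cell_in_sets: "cell j \<in> sets \<nu>" "{ennreal s<..} - cell j \<in> sets \<nu>"
  by (auto simp: in_sets_\<nu> intro: le_less_trans)

lemma time_block_in_sets: "time_block T q i \<in> sets borel" "time_block T q i \<subseteq> {0..}"
proof -
  have "0 \<le> T * real i / real q" using T by simp
  then show "time_block T q i \<subseteq> {0..}" by (auto simp: time_block_def)
qed (simp add: time_block_def)

lemma emeasure_time_block: "emeasure lborel (time_block T q i) = ennreal (T / real q)"
proof -
  have "T * real i / real q \<le> T * real (Suc i) / real q"
    using T by (intro divide_right_mono mult_left_mono) auto
  moreover have "T * real (Suc i) / real q - T * real i / real q = T / real q"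
    by (simp add: diff_divide_distrib[symmetric] algebra_simps)
  ultimately show ?thesis unfolding time_block_def by simp
qed

lemma block_Times_in_sets: "B \<in> sets \<nu> \<Longrightarrow> time_block T q i \<times> B \<in> sets \<mu>"
  by (intro Times_in_sets_\<mu> time_block_in_sets)

lemma atom_config_in_sets: "atom_config \<kappa> \<in> sets W"
proof -
  have [measurable]: "(\<lambda>\<omega>. emeasure (\<N> \<omega>) (time_block T q i \<times> cell (\<kappa> i))) \<in> borel_measurable W"
    "(\<lambda>\<omega>. emeasure (\<N> \<omega>) (time_block T q i \<times> ({ennreal s<..} - cell (\<kappa> i)))) \<in> borel_measurable W" for i
    by (intro emeasure_\<N>_measurable block_Times_in_sets cell_in_sets)+
  show ?thesis unfolding atom_config_def by measurable
qed

lemma finite_subset_tail: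
  assumes B: "B \<in> sets \<nu>" "B \<subseteq> {ennreal s<..}"
  shows "emeasure \<mu> (time_block T q i \<times> B) < \<infinity>" "measure \<mu> (time_block T q i \<times> B) = T / q * measure \<nu> B"
    "emeasure \<nu> B < \<infinity>"
proof -
  show fin: "emeasure \<nu> B < \<infinity>"
    using emeasure_mono[OF B(2) greaterThan_in_sets] finite_greaterThan[OF s] by (rule le_less_trans)
  have eq: "emeasure \<mu> (time_block T q i \<times> B) = ennreal (T / real q) * emeasure \<nu> B"
    using B by (simp add: emeasure_\<mu>_Times time_block_in_sets emeasure_time_block)
  then show "emeasure \<mu> (time_block T q i \<times> B) < \<infinity>"
    using fin by (simp add: ennreal_mult_less_top)
  show "measure \<mu> (time_block T q i \<times> B) = T / q * measure \<nu> B"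
    using T by (simp add: measure_def eq enn2real_mult)
qed

lemma measure_cell:
  assumes "j \<noteq> 0" shows "measure \<nu> (cell j) = tail (t (j - 1)) - tail (t j)"
proof -
  have lt: "t (j - 1) < t j" using assms strict_mono_less[OF t_mono, of "j - 1" j] by simp
  have "cell j = {ennreal (t (j - 1))<..} - {ennreal (t j)<..}" using assms by (auto simp: not_less)
  moreover have "measure \<nu> ({ennreal (t (j - 1))<..} - {ennreal (t j)<..}) = tail (t (j - 1)) - tail (t j)"
  proof (rule measure_Diff)
    show "{ennreal (t j)<..} \<subseteq> {ennreal (t (j - 1))<..}"
      using lt by (simp add: greaterThan_subset_iff ennreal_leI)
  qed (use finite_greaterThan[OF t_pos] in \<open>auto simp: greaterThan_in_sets less_top\<close>)
  ultimately show ?thesis by simp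
qed

text \<open>In each block the count in the cell and the count in the rest of the region above s are
  independent Poisson variables. Their two exponentials multiply to exp (- (T / q) tail s), whatever
  the letter.\<close>

lemma prob_atom_config:
  "W.prob (atom_config \<kappa>) =
    (\<Prod>i<q. (if \<kappa> i = 0 then 1 else T / q * (tail (t (\<kappa> i - 1)) - tail (t (\<kappa> i)))) * exp (- (T / q * tail s)))"
proof -
  \<comment> \<open>Index e < q is the cell of block e, and index q + i the rest of the region above
    s in block i. This puts all 2 q rectangles into one disjoint family.\<close>
  define S where "S e = (if e < q then time_block T q e \<times> cell (\<kappa> e)
    else time_block T q (e - q) \<times> ({ennreal s<..} - cell (\<kappa> (e - q))))" for e
  define a :: "nat \<Rightarrow> nat" where "a e = (if e < q \<and> \<kappa> e \<noteq> 0 then 1 else 0)" for e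
  have S: "S e \<in> sets \<mu>" for e
    unfolding S_def by (simp only: block_Times_in_sets cell_in_sets split: if_split) simp
  have disj: "disjoint_family_on S {..<q + q}"
    unfolding disjoint_family_on_def
  proof (intro ballI impI)
    fix e e' :: nat assume e: "e \<in> {..<q + q}" "e' \<in> {..<q + q}" "e \<noteq> e'"
    have b: "time_block T q i \<inter> time_block T q j = {}" if "i \<noteq> j" for i j
      by (rule disjoint_time_block[OF T that])
    consider "e < q" "e' < q" | "e < q" "\<not> e' < q" | "\<not> e < q" "e' < q" | "\<not> e < q" "\<not> e' < q" by blast
    then show "S e \<inter> S e' = {}"
    proof cases
      case 1
      then show ?thesis using b[OF e(3)] unfolding S_def by (simp only: if_True Times_Int_Times) simp
    next
      case 2
      then show ?thesis using b[of e "e' - q"] unfolding S_def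
        by (cases "e = e' - q") (simp_all only: if_True if_False Times_Int_Times, auto)
    next
      case 3
      then show ?thesis using b[of "e - q" e'] unfolding S_def
        by (cases "e - q = e'") (simp_all only: if_True if_False Times_Int_Times, auto)
    next
      case 4
      then have "e - q \<noteq> e' - q" using e by auto
      with 4 show ?thesis using b[of "e - q" "e' - q"] unfolding S_def by (simp only: if_False Times_Int_Times) simp
    qed
  qed
  have ind: "W.indep_vars (\<lambda>_. borel) (\<lambda>e \<omega>. emeasure (\<N> \<omega>) (S e)) {..<q + q}"
    using prm S disj unfolding poisson_random_measure_def by blast
  have fin: "emeasure \<mu> (S e) < \<infinity>" for e
    unfolding S_def using finite_subset_tail(1)[OF cell_in_sets(1) cell_subset] finite_subset_tail(1)[OF cell_in_sets(2) Diff_subset]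
    by (simp only: split: if_split) blast
  have pS: "W.prob ((\<lambda>\<omega>. emeasure (\<N> \<omega>) (S e)) -` {of_nat (a e)} \<inter> space W) =
      measure \<mu> (S e) ^ a e / fact (a e) * exp (- measure \<mu> (S e))" for e
  proof -
    have "(\<lambda>\<omega>. emeasure (\<N> \<omega>) (S e)) -` {of_nat (a e)} \<inter> space W = {\<omega> \<in> space W. emeasure (\<N> \<omega>) (S e) = of_nat (a e)}"
      by auto
    then show ?thesis using prob_\<N>_eq[OF S fin] by simp
  qed
  have "atom_config \<kappa> = (\<Inter>e\<in>{..<q + q}. (\<lambda>\<omega>. emeasure (\<N> \<omega>) (S e)) -` {of_nat (a e)} \<inter> space W)"
  proof (intro equalityI subsetI)
    let ?R = "\<Inter>e\<in>{..<q + q}. (\<lambda>\<omega>. emeasure (\<N> \<omega>) (S e)) -` {of_nat (a e)} \<inter> space W"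
    fix \<omega> assume \<omega>: "\<omega> \<in> atom_config \<kappa>"
    have "emeasure (\<N> \<omega>) (S e) = of_nat (a e)" if "e < q + q" for e
    proof (cases "e < q")
      case True
      then show ?thesis using \<omega> by (simp add: atom_config_def S_def a_def del: of_nat_0 of_nat_1)
    next
      case False
      then have "e - q < q" using that by simp
      then have "emeasure (\<N> \<omega>) (time_block T q (e - q) \<times> ({ennreal s<..} - cell (\<kappa> (e - q)))) = of_nat 0"
        using \<omega> unfolding atom_config_def by blast
      then show ?thesis using False by (simp only: S_def a_def if_False simp_thms)
    qed
    moreover have "\<omega> \<in> space W" using \<omega> by (simp add: atom_config_def)
    ultimately show "\<omega> \<in> ?R" by blast
  next
    fix \<omega> assume \<omega>: "\<omega> \<in> (\<Inter>e\<in>{..<q + q}. (\<lambda>\<omega>. emeasure (\<N> \<omega>) (S e)) -` {of_nat (a e)} \<inter> space W)"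
    have "0 \<in> {..<q + q}" using q by simp
    with \<omega> have sp: "\<omega> \<in> space W" by blast
    have e: "emeasure (\<N> \<omega>) (S e) = of_nat (a e)" if "e < q + q" for e using \<omega> that by blast
    show "\<omega> \<in> atom_config \<kappa>"
      unfolding atom_config_def
    proof (intro CollectI conjI sp allI impI)
      fix i assume i: "i < q"
      show "emeasure (\<N> \<omega>) (time_block T q i \<times> cell (\<kappa> i)) = of_nat (if \<kappa> i = 0 then 0 else 1)"
        using e[of i] i by (cases "\<kappa> i = 0") (simp_all add: S_def a_def)
      show "emeasure (\<N> \<omega>) (time_block T q i \<times> ({ennreal s<..} - cell (\<kappa> i))) = of_nat 0"
        using e[of "q + i"] i unfolding S_def a_def by (simp only: not_add_less1 if_False simp_thms add_diff_cancel_left')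
    qed
  qed
  also have "W.prob \<dots> = (\<Prod>e\<in>{..<q + q}. W.prob ((\<lambda>\<omega>. emeasure (\<N> \<omega>) (S e)) -` {of_nat (a e)} \<inter> space W))"
    using q by (intro W.indep_varsD[OF ind]) auto
  also have "\<dots> = (\<Prod>i<q. measure \<mu> (S i) ^ a i / fact (a i) * exp (- measure \<mu> (S i)) *
      (measure \<mu> (S (q + i)) ^ a (q + i) / fact (a (q + i)) * exp (- measure \<mu> (S (q + i)))))"
    unfolding pS prod_lessThan_add by (rule prod.distrib[symmetric])
  also have "\<dots> = (\<Prod>i<q. (if \<kappa> i = 0 then 1 else T / q * (tail (t (\<kappa> i - 1)) - tail (t (\<kappa> i)))) * exp (- (T / q * tail s)))"
  proof (intro prod.cong refl)
    fix i assume "i \<in> {..<q}"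
    then have i: "i < q" by simp
    have 1: "measure \<mu> (S i) = T / q * measure \<nu> (cell (\<kappa> i))"
      using i finite_subset_tail(2)[OF cell_in_sets(1) cell_subset, of i "\<kappa> i"] by (simp only: S_def if_True)
    have 2: "measure \<mu> (S (q + i)) = T / q * measure \<nu> ({ennreal s<..} - cell (\<kappa> i))"
      using finite_subset_tail(2)[OF cell_in_sets(2) Diff_subset, of i "\<kappa> i"]
      by (simp only: S_def not_add_less1 if_False add_diff_cancel_left')
    have 3: "measure \<nu> ({ennreal s<..} - cell (\<kappa> i)) = tail s - measure \<nu> (cell (\<kappa> i))"
      using finite_greaterThan[OF s] finite_subset_tail(3)[OF cell_in_sets(1) cell_subset] cell_in_sets(1) cell_subset
      by (intro measure_Diff greaterThan_in_sets) (blast | simp only: less_top[symmetric] infinity_ennreal_def)+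
    have 4: "exp (- (T / q * u)) * exp (- (T / q * (tail s - u))) = exp (- (T / q * tail s))" for u
      by (simp add: exp_add[symmetric] algebra_simps)
    show "measure \<mu> (S i) ^ a i / fact (a i) * exp (- measure \<mu> (S i)) *
      (measure \<mu> (S (q + i)) ^ a (q + i) / fact (a (q + i)) * exp (- measure \<mu> (S (q + i)))) =
      (if \<kappa> i = 0 then 1 else T / q * (tail (t (\<kappa> i - 1)) - tail (t (\<kappa> i)))) * exp (- (T / q * tail s))"
    proof (cases "\<kappa> i = 0")
      case True
      then have m: "measure \<nu> (cell (\<kappa> i)) = 0" by simp
      show ?thesis unfolding 1 2 3 m using True by (simp add: a_def)
    next
      case False
      have a: "a i = 1" "a (q + i) = 0" using False i by (simp_all add: a_def)
      show ?thesis unfolding 1 2 3 a measure_cell[OF False] using False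
        4[of "tail (t (\<kappa> i - 1)) - tail (t (\<kappa> i))"] by (simp add: mult.assoc)
    qed
  qed
  finally show ?thesis .
qed

lemma emeasure_\<N>_eq_0:
  assumes "\<omega> \<in> space W" "S \<in> sets \<mu>" "emeasure (\<N> \<omega>) S = of_nat 0"
  shows "{k \<in> I \<omega>. (x k \<omega>, y k \<omega>) \<in> S} = {}"
  using assms by (auto simp: emeasure_\<N> split: if_splits)

lemma emeasure_\<N>_eq_1:
  assumes "\<omega> \<in> space W" "S \<in> sets \<mu>" "emeasure (\<N> \<omega>) S = of_nat 1"
  shows "\<exists>k. {k \<in> I \<omega>. (x k \<omega>, y k \<omega>) \<in> S} = {k}"
  using assms by (auto simp: emeasure_\<N> card_1_singleton_iff split: if_splits)

lemma atom_config_block: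
  assumes \<omega>: "\<omega> \<in> atom_config \<kappa>" and i: "i < q"
  shows "\<kappa> i = 0 \<and> {k \<in> I \<omega>. x k \<omega> \<in> time_block T q i \<and> y k \<omega> \<in> {ennreal s<..}} = {} \<or>
    \<kappa> i \<noteq> 0 \<and> (\<exists>k. {k \<in> I \<omega>. x k \<omega> \<in> time_block T q i \<and> y k \<omega> \<in> {ennreal s<..}} = {k} \<and> y k \<omega> \<in> cell (\<kappa> i))"
proof -
  have sp: "\<omega> \<in> space W" using \<omega> by (simp add: atom_config_def)
  have 0: "{k \<in> I \<omega>. (x k \<omega>, y k \<omega>) \<in> time_block T q i \<times> ({ennreal s<..} - cell (\<kappa> i))} = {}"
    using \<omega> i by (intro emeasure_\<N>_eq_0[OF sp] block_Times_in_sets cell_in_sets) (simp add: atom_config_def)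
  show ?thesis
  proof (cases "\<kappa> i = 0")
    case True
    then show ?thesis using 0 by simp
  next
    case False
    have "emeasure (\<N> \<omega>) (time_block T q i \<times> cell (\<kappa> i)) = of_nat (if \<kappa> i = 0 then 0 else 1)"
      using \<omega> i unfolding atom_config_def by blast
    then have "emeasure (\<N> \<omega>) (time_block T q i \<times> cell (\<kappa> i)) = of_nat 1" using False by (simp only: if_False)
    then have "\<exists>k. {k \<in> I \<omega>. (x k \<omega>, y k \<omega>) \<in> time_block T q i \<times> cell (\<kappa> i)} = {k}"
      by (intro emeasure_\<N>_eq_1[OF sp] block_Times_in_sets cell_in_sets)
    then obtain k where k: "{k \<in> I \<omega>. (x k \<omega>, y k \<omega>) \<in> time_block T q i \<times> cell (\<kappa> i)} = {k}" by blast
    have "{k \<in> I \<omega>. x k \<omega> \<in> time_block T q i \<and> y k \<omega> \<in> {ennreal s<..}} =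
        {k \<in> I \<omega>. (x k \<omega>, y k \<omega>) \<in> time_block T q i \<times> cell (\<kappa> i)}"
      using 0 cell_subset[of "\<kappa> i"] by blast
    moreover have "y k \<omega> \<in> cell (\<kappa> i)" using k by blast
    ultimately show ?thesis using k False by auto
  qed
qed

text \<open>The outcome determines the word: a letter is 0 if the block has no atom above s, and
  otherwise names the cell of its only such atom.\<close>

lemma disjoint_atom_config: "disjoint_family_on atom_config (PiE {..<q} (\<lambda>_. R))"
  unfolding disjoint_family_on_def
proof (intro ballI impI)
  fix \<kappa> \<kappa>' assume \<kappa>: "\<kappa> \<in> PiE {..<q} (\<lambda>_. R)" "\<kappa>' \<in> PiE {..<q} (\<lambda>_. R)" "\<kappa> \<noteq> \<kappa>'"
  then obtain i where i: "i < q" "\<kappa> i \<noteq> \<kappa>' i" by (metis PiE_ext lessThan_iff)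
  have False if \<omega>: "\<omega> \<in> atom_config \<kappa>" "\<omega> \<in> atom_config \<kappa>'" for \<omega>
    using atom_config_block[OF \<omega>(1) i(1)] atom_config_block[OF \<omega>(2) i(1)] cell_disjoint[OF i(2)] i(2)
    by (elim disjE conjE exE) (simp_all only: insert_not_empty simp_thms singleton_insert_inj_eq', blast+)
  then show "atom_config \<kappa> \<inter> atom_config \<kappa>' = {}" by blast
qed

text \<open>The general path comparison, with jumps that are exactly orthogonal. The tolerance
  \<delta>2 is kept free so that the bound has the same shape as the one for the walk.\<close>

lemma dist_crinkled_range_staircase:
  assumes \<omega>: "\<omega> \<in> atom_config \<kappa>" "\<omega> \<in> small_jumps T s \<eta>" and r: "regular T \<omega>" and \<eta>: "0 < \<eta>"
    and mesh: "\<And>j. t (Suc j) - t j \<le> \<delta>1" and \<delta>2: "0 \<le> \<delta>2"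
  shows "dist (gh_of_set (crinkled_range I x y T \<omega>)) (gh_of_set (staircase q (\<lambda>i. if \<kappa> i = 0 then 0 else t (\<kappa> i))))
    \<le> \<eta> + sqrt (real q * \<delta>1 + (real q)\<^sup>2 * \<delta>2)"
proof -
  have sp: "\<omega> \<in> space W" using \<omega> by (simp add: atom_config_def)
  have sum: "summable (\<lambda>k. if k \<in> {k\<in>I \<omega>. x k \<omega> \<le> T} then c \<omega> k else 0)" using r by (simp add: regular_def)
  have c0: "0 \<le> c \<omega> k" for k by simp
  let ?D = "{k\<in>I \<omega>. x k \<omega> \<le> T} \<inter> {k. s < c \<omega> k}"
  have y_c: "ennreal s < y k \<omega> \<longleftrightarrow> s < c \<omega> k" if "k \<in> I \<omega>" "x k \<omega> \<le> T" for k
  proof (cases "y k \<omega>")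
    case (real u)
    then show ?thesis using s by (simp add: ennreal_less_iff)
  next
    case top
    then show ?thesis using r that by (auto simp: regular_def)
  qed
  \<comment> \<open>The sizes are summable up to time T, so only finitely many exceed s.\<close>
  have D: "finite ?D"
  proof -
    have "\<forall>\<^sub>F k in sequentially. (if k \<in> {k\<in>I \<omega>. x k \<omega> \<le> T} then c \<omega> k else 0) < s"
      by (rule order_tendstoD(2)[OF summable_LIMSEQ_zero[OF sum] s])
    then obtain K where K: "\<And>k. K \<le> k \<Longrightarrow> (if k \<in> {k\<in>I \<omega>. x k \<omega> \<le> T} then c \<omega> k else 0) < s"
      by (auto simp: eventually_sequentially)
    have "?D \<subseteq> {..<K}"
    proof
      fix k assume k: "k \<in> ?D"
      show "k \<in> {..<K}"
      proof (rule ccontr)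
        assume "k \<notin> {..<K}"
        then have "(if k \<in> {k\<in>I \<omega>. x k \<omega> \<le> T} then c \<omega> k else 0) < s" by (intro K) simp
        then show False using k by simp
      qed
    qed
    then show ?thesis by (rule finite_subset) simp
  qed
  have Di: "{k\<in>?D. x k \<omega> \<in> time_block T q i} = {k \<in> I \<omega>. x k \<omega> \<in> time_block T q i \<and> y k \<omega> \<in> {ennreal s<..}}"
    if "i < q" for i
    using y_c time_block_le[OF _ that T] by (auto simp del: greaterThan_iff simp: greaterThan_iff[of _ "ennreal s"])
  show ?thesis
    unfolding crinkled_range_eq[OF r]
  proof (rule dist_gh_path_staircase[where D = ?D and \<tau> = "xs \<omega>" and V = "\<lambda>k. sqrt (c \<omega> k) *\<^sub>R l2_basis k"])
    show "compact (closure (atom_path (c \<omega>) (I \<omega>) (xs \<omega>) ` {0..T}))"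
      by (rule compact_atom_path[OF c0 sum])
    show "atom_path (c \<omega>) (I \<omega>) (xs \<omega>) ` {0..T} \<subseteq> closure (atom_path (c \<omega>) (I \<omega>) (xs \<omega>) ` {0..T})"
      by (rule closure_subset)
    show "0 < x k \<omega>" if "k \<in> ?D" for k using r that by (simp add: regular_def)
    show "norm (atom_path (c \<omega>) (I \<omega>) (xs \<omega>) u - (\<Sum>k\<in>{k\<in>?D. x k \<omega> \<le> u}. sqrt (c \<omega> k) *\<^sub>R l2_basis k)) \<le> \<eta>"
      if u: "0 \<le> u" "u \<le> T" for u
    proof -
      have eq: "{k\<in>?D. x k \<omega> \<le> u} = {k\<in>I \<omega>. x k \<omega> \<le> u} \<inter> {k. s < c \<omega> k}" using u by auto
      have fin: "finite ({k\<in>I \<omega>. x k \<omega> \<le> u} \<inter> {k. s < c \<omega> k})" by (rule finite_subset[OF _ D]) (use u in auto)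
      have "(norm (atom_path (c \<omega>) (I \<omega>) (xs \<omega>) u - l2_atoms (c \<omega>) ({k\<in>I \<omega>. x k \<omega> \<le> u} \<inter> {k. s < c \<omega> k})))\<^sup>2
          \<le> (\<Sum>k. if k \<in> {k\<in>I \<omega>. x k \<omega> \<le> T} - {k. s < c \<omega> k} then c \<omega> k else 0)"
        by (rule norm_atom_path_diff[OF c0 sum u(2)])
      also have "\<dots> \<le> \<eta>\<^sup>2" by (rule small_jumps_suminf[OF \<omega>(2) r s])
      finally show ?thesis unfolding eq l2_atoms_finite[OF c0 fin] by (rule power2_le_imp_le) (use \<eta> in simp)
    qed
    show "{k\<in>?D. x k \<omega> \<in> time_block T q i} = {} \<and> (if \<kappa> i = 0 then 0 else t (\<kappa> i)) = 0 \<or>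
        (\<exists>k. {k\<in>?D. x k \<omega> \<in> time_block T q i} = {k} \<and>
          \<bar>(norm (sqrt (c \<omega> k) *\<^sub>R l2_basis k))\<^sup>2 - (if \<kappa> i = 0 then 0 else t (\<kappa> i))\<bar> \<le> \<delta>1)" if i: "i < q" for i
      using atom_config_block[OF \<omega>(1) i]
    proof (elim disjE conjE exE)
      assume "\<kappa> i = 0" "{k \<in> I \<omega>. x k \<omega> \<in> time_block T q i \<and> y k \<omega> \<in> {ennreal s<..}} = {}"
      then show ?thesis unfolding Di[OF i] by simp
    next
      fix k assume \<kappa>: "\<kappa> i \<noteq> 0" and k: "{k \<in> I \<omega>. x k \<omega> \<in> time_block T q i \<and> y k \<omega> \<in> {ennreal s<..}} = {k}"
        and yk: "y k \<omega> \<in> cell (\<kappa> i)"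
      have "ennreal (t (\<kappa> i - 1)) < y k \<omega>" "y k \<omega> \<le> ennreal (t (\<kappa> i))" using yk \<kappa> by simp_all
      then have "t (\<kappa> i - 1) \<le> c \<omega> k" "c \<omega> k \<le> t (\<kappa> i)"
        using t_pos[of "\<kappa> i"] t_pos[of "\<kappa> i - 1"]
        by (cases "y k \<omega>"; simp add: ennreal_less_iff top_unique less_imp_le)+
      moreover have "t (\<kappa> i) - t (\<kappa> i - 1) \<le> \<delta>1" using mesh[of "\<kappa> i - 1"] \<kappa> by simp
      ultimately have "\<bar>c \<omega> k - t (\<kappa> i)\<bar> \<le> \<delta>1" by linarith
      then show ?thesis unfolding Di[OF i] k using \<kappa> by (intro disjI2 exI[of _ k]) simp
    qed
    show "0 \<le> (if \<kappa> i = 0 then 0 else t (\<kappa> i))" for i using t_pos[of "\<kappa> i"] by simp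
    show "\<bar>inner (sqrt (c \<omega> k) *\<^sub>R l2_basis k) (sqrt (c \<omega> k') *\<^sub>R l2_basis k')\<bar> \<le> \<delta>2" if "k \<noteq> k'" for k k'
      using \<delta>2 that by (simp add: inner_l2_basis)
    show "0 \<le> \<delta>1" using mesh[of 0] strict_mono_less[OF t_mono, of 0 "Suc 0"] by linarith
  qed (use D T q \<delta>2 in auto)
qed

end

end

section \<open>The scaled random walk\<close>

locale scaled_walk = prob_space Q for Q :: "'q measure" +
  fixes \<xi> :: "nat \<Rightarrow> 'q \<Rightarrow> l2" and P :: "'p measure" and X :: "'p \<Rightarrow> l2" and n :: nat and a :: real
  assumes indep: "indep_vars (\<lambda>_. borel) \<xi> UNIV"
    and copies: "\<And>i. distr Q borel (\<xi> i) = distr P borel X"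
    and P: "prob_space P" and X: "X \<in> borel_measurable P"
    and n: "0 < n" and a: "0 < a"
begin

lemma \<xi>_meas [measurable]: "\<xi> i \<in> borel_measurable Q"
  using indep by (auto simp: indep_vars_def2)

lemma integral_copies:
  fixes f :: "l2 \<Rightarrow> 'c :: {banach, second_countable_topology}"
  assumes "f \<in> borel_measurable borel"
  shows "(\<integral>\<omega>. f (\<xi> i \<omega>) \<partial>Q) = (\<integral>\<omega>. f (X \<omega>) \<partial>P)"
  using integral_distr[OF \<xi>_meas assms, of i] integral_distr[OF X assms] copies[of i] by simp

lemma prob_copies:
  assumes "S \<in> sets borel"
  shows "prob {\<omega> \<in> space Q. \<xi> i \<omega> \<in> S} = measure P {\<omega> \<in> space P. X \<omega> \<in> S}"
  using measure_distr[OF \<xi>_meas assms, of i] measure_distr[OF X assms] copies[of i]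
  by (simp add: vimage_def Int_def conj_commute)

definition v :: "nat \<Rightarrow> 'q \<Rightarrow> real"
  where "v k \<omega> = (norm (\<xi> k \<omega>))\<^sup>2 / a"

lemma v_meas [measurable]: "v k \<in> borel_measurable Q"
  unfolding v_def[abs_def] by measurable

lemma prob_v:
  assumes "S \<in> sets borel"
  shows "prob {\<omega> \<in> space Q. v k \<omega> \<in> S} = measure P {\<omega> \<in> space P. (norm (X \<omega>))\<^sup>2 / a \<in> S}"
proof -
  have "(\<lambda>u :: l2. (norm u)\<^sup>2 / a) -` S \<in> sets borel"
    using measurable_sets[of "\<lambda>u :: l2. (norm u)\<^sup>2 / a" borel borel S] assms by simp
  from prob_copies[OF this, of k] show ?thesis by (simp add: v_def)
qed

lemma indep_v: "indep_vars (\<lambda>_. borel) v UNIV"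
  unfolding v_def[abs_def] by (rule indep_vars_compose2[OF indep]) measurable

definition small :: "real \<Rightarrow> l2 \<Rightarrow> l2"
  where "small s u = indicator {v. (norm v)\<^sup>2 \<le> s * a} u *\<^sub>R u"

lemma small_meas [measurable]: "small s \<in> borel_measurable borel"
  unfolding small_def[abs_def] by measurable

lemma norm_small_le: "0 \<le> s \<Longrightarrow> norm (small s u) \<le> sqrt (s * a)"
  using a by (auto simp: small_def indicator_def intro: real_le_rsqrt)

text \<open>Centre the truncated steps. The removed drift is at most \<eta> / 2 over the whole time
  span by \<open>mean\<close>, so the centred walk must reach \<eta> / 2, whence the factor 4. The
  variance is bounded by the raw second moment.\<close>

lemma prob_small_walk:
  assumes s: "0 < s" and \<eta>: "0 < \<eta>" and T: "0 \<le> T"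
    and mean: "T * (real n / sqrt a * norm (\<integral>\<omega>. small s (X \<omega>) \<partial>P)) \<le> \<eta> / 2"
  shows "prob {\<omega> \<in> space Q. \<exists>k\<le>nat \<lfloor>real n * T\<rfloor>. \<eta> < norm (\<Sum>i<k. small s (\<xi> i \<omega>)) / sqrt a}
    \<le> 4 * T / \<eta>\<^sup>2 * (real n / a * (\<integral>\<omega>. (norm (small s (X \<omega>)))\<^sup>2 \<partial>P))"
proof -
  define m where "m = (\<integral>\<omega>. small s (X \<omega>) \<partial>P)"
  define \<sigma> where "\<sigma> = (\<integral>\<omega>. (norm (small s (X \<omega>)))\<^sup>2 \<partial>P)"
  define Y where "Y i \<omega> = small s (\<xi> i \<omega>) - m" for i \<omega>
  let ?N = "nat \<lfloor>real n * T\<rfloor>"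
  let ?C = "sqrt (s * a)"
  have b: "norm (small s u) \<le> ?C" for u using s by (intro norm_small_le) simp
  have int: "integrable Q (\<lambda>\<omega>. small s (\<xi> i \<omega>))" for i
    by (rule integrable_const_bound[where B = ?C]) (use b in auto)
  have int2: "integrable Q (\<lambda>\<omega>. (norm (small s (\<xi> i \<omega>)))\<^sup>2)" for i
    by (rule integrable_const_bound[where B = "?C\<^sup>2"]) (use power_mono[OF b norm_ge_zero, of _ 2] in auto)
  have m_eq: "expectation (\<lambda>\<omega>. small s (\<xi> i \<omega>)) = m" for i
    unfolding m_def by (rule integral_copies) measurable
  have indY: "indep_vars (\<lambda>_. borel) Y UNIV"
    unfolding Y_def[abs_def] by (rule indep_vars_compose2[OF indep]) measurable
  have Yb: "norm (Y i \<omega>) \<le> ?C + norm m" for i \<omega>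
    unfolding Y_def using norm_triangle_ineq4[of "small s (\<xi> i \<omega>)" m] b[of "\<xi> i \<omega>"] by linarith
  have meanY: "expectation (Y i) = 0" for i
    unfolding Y_def[abs_def] using int m_eq by (simp add: prob_space)
  have varY: "expectation (\<lambda>\<omega>. (norm (Y i \<omega>))\<^sup>2) \<le> \<sigma>" for i
  proof -
    have "(norm (Y i \<omega>))\<^sup>2 = (norm (small s (\<xi> i \<omega>)))\<^sup>2 - 2 * inner (small s (\<xi> i \<omega>)) m + (norm m)\<^sup>2" for \<omega>
      unfolding Y_def power2_norm_eq_inner by (simp add: inner_diff inner_commute)
    then have "expectation (\<lambda>\<omega>. (norm (Y i \<omega>))\<^sup>2) =
        expectation (\<lambda>\<omega>. (norm (small s (\<xi> i \<omega>)))\<^sup>2) - 2 * inner m m + (norm m)\<^sup>2"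
      using int[of i] int2[of i] m_eq[of i] by (simp add: prob_space)
    moreover have "expectation (\<lambda>\<omega>. (norm (small s (\<xi> i \<omega>)))\<^sup>2) = \<sigma>"
      unfolding \<sigma>_def by (rule integral_copies) measurable
    ultimately show ?thesis by (simp add: power2_norm_eq_inner)
  qed
  have N: "real ?N \<le> real n * T" using T by (simp add: mult_nonneg_nonneg)
  have sub: "{\<omega> \<in> space Q. \<exists>k\<le>?N. \<eta> < norm (\<Sum>i<k. small s (\<xi> i \<omega>)) / sqrt a} \<subseteq>
      {\<omega> \<in> space Q. \<exists>k\<le>?N. \<eta> / 2 * sqrt a \<le> norm (\<Sum>i<k. Y i \<omega>)}"
  proof safe
    fix \<omega> k assume \<omega>: "\<omega> \<in> space Q" and k: "k \<le> ?N" and large: "\<eta> < norm (\<Sum>i<k. small s (\<xi> i \<omega>)) / sqrt a"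
    have "(\<Sum>i<k. small s (\<xi> i \<omega>)) = (\<Sum>i<k. Y i \<omega>) + real k *\<^sub>R m"
      by (simp add: Y_def sum_subtractf sum_constant_scaleR)
    then have "norm (\<Sum>i<k. small s (\<xi> i \<omega>)) \<le> norm (\<Sum>i<k. Y i \<omega>) + real k * norm m"
      using norm_triangle_ineq[of "\<Sum>i<k. Y i \<omega>" "real k *\<^sub>R m"] by simp
    also have "real k * norm m \<le> (real n * T) * norm m"
      using k N by (intro mult_right_mono) auto
    also have "\<dots> \<le> \<eta> / 2 * sqrt a"
      using mean a unfolding m_def[symmetric] by (simp add: field_simps)
    finally have "norm (\<Sum>i<k. small s (\<xi> i \<omega>)) \<le> norm (\<Sum>i<k. Y i \<omega>) + \<eta> / 2 * sqrt a" by simp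
    moreover have "\<eta> * sqrt a < norm (\<Sum>i<k. small s (\<xi> i \<omega>))" using large a by (simp add: pos_less_divide_eq)
    ultimately have "\<eta> / 2 * sqrt a \<le> norm (\<Sum>i<k. Y i \<omega>)" by (simp add: algebra_simps)
    then show "\<exists>k\<le>?N. \<eta> / 2 * sqrt a \<le> norm (\<Sum>i<k. Y i \<omega>)" using k by blast
  qed
  have [measurable]: "Y i \<in> borel_measurable Q" for i using indY by (auto simp: indep_vars_def2)
  have "prob {\<omega> \<in> space Q. \<exists>k\<le>?N. \<eta> < norm (\<Sum>i<k. small s (\<xi> i \<omega>)) / sqrt a} \<le>
      prob {\<omega> \<in> space Q. \<exists>k\<le>?N. \<eta> / 2 * sqrt a \<le> norm (\<Sum>i<k. Y i \<omega>)}"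
    by (rule finite_measure_mono[OF sub]) measurable
  also have "\<dots> \<le> real ?N * \<sigma> / (\<eta> / 2 * sqrt a)\<^sup>2"
    using \<eta> a by (intro maximal_inequality[OF indY Yb meanY varY]) simp
  also have "\<dots> \<le> (real n * T) * \<sigma> / (\<eta> / 2 * sqrt a)\<^sup>2"
    using N by (intro divide_right_mono mult_right_mono) (auto simp: \<sigma>_def)
  also have "\<dots> = 4 * T / \<eta>\<^sup>2 * (real n / a * \<sigma>)"
    using a \<eta> by (simp add: power_mult_distrib power_divide field_simps)
  finally show ?thesis by (simp only: \<sigma>_def)
qed

text \<open>The bad event for two large steps, with \<open>sgn\<close> as the direction \<Theta>.
  The strict level agrees with s < v k in the words and implies the non-strict level under which
  condition (b) is stated.\<close>

definition aligned :: "real \<Rightarrow> real \<Rightarrow> l2 \<Rightarrow> l2 \<Rightarrow> bool"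
  where "aligned s \<epsilon> u w \<longleftrightarrow> s * a < (norm u)\<^sup>2 \<and> s * a < (norm w)\<^sup>2 \<and> \<epsilon> < \<bar>inner (sgn u) (sgn w)\<bar>"

lemma aligned_meas [measurable]: "Measurable.pred (borel \<Otimes>\<^sub>M borel) (case_prod (aligned s \<epsilon>))"
  unfolding aligned_def[abs_def] sgn_div_norm by measurable

text \<open>There are at most (n T)^2 pairs, and by independence a given pair is large with
  probability p^2. The number of pairs is thus absorbed into (n p)^2, which stays bounded, and the
  conditional probability remains as the vanishing factor.\<close>

lemma prob_aligned:
  assumes T: "0 \<le> T"
  shows "prob {\<omega> \<in> space Q. \<exists>i<nat \<lfloor>real n * T\<rfloor>. \<exists>j<nat \<lfloor>real n * T\<rfloor>. i \<noteq> j \<and> aligned s \<epsilon> (\<xi> i \<omega>) (\<xi> j \<omega>)}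
    \<le> T\<^sup>2 * (real n * measure P {\<omega> \<in> space P. s \<le> (norm (X \<omega>))\<^sup>2 / a})\<^sup>2 *
      cond_prob Q (\<lambda>\<omega>. \<bar>inner (sgn (\<xi> 0 \<omega>)) (sgn (\<xi> 1 \<omega>))\<bar> > \<epsilon>)
        (\<lambda>\<omega>. (norm (\<xi> 0 \<omega>))\<^sup>2 \<ge> s * a \<and> (norm (\<xi> 1 \<omega>))\<^sup>2 \<ge> s * a)"
    (is "_ \<le> T\<^sup>2 * (real n * ?p)\<^sup>2 * ?cp")
proof -
  let ?N = "nat \<lfloor>real n * T\<rfloor>"
  let ?L = "{\<omega> \<in> space Q. (norm (\<xi> 0 \<omega>))\<^sup>2 \<ge> s * a \<and> (norm (\<xi> 1 \<omega>))\<^sup>2 \<ge> s * a}"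
  let ?AL = "{\<omega> \<in> space Q. \<bar>inner (sgn (\<xi> 0 \<omega>)) (sgn (\<xi> 1 \<omega>))\<bar> > \<epsilon> \<and> (norm (\<xi> 0 \<omega>))\<^sup>2 \<ge> s * a \<and> (norm (\<xi> 1 \<omega>))\<^sup>2 \<ge> s * a}"
  have [measurable]: "?AL \<in> sets Q" "?L \<in> sets Q" unfolding sgn_div_norm by measurable
  have N: "real ?N \<le> real n * T" using T by (simp add: mult_nonneg_nonneg)
  have pv: "prob {\<omega> \<in> space Q. v k \<omega> \<in> {s..}} = ?p" for k
    by (subst prob_v) auto
  have "prob ?L = prob {\<omega> \<in> space Q. \<forall>k\<in>{0, 1 :: nat}. v k \<omega> \<in> {s..}}"
    using a by (intro arg_cong[where f = prob]) (auto simp: v_def pos_le_divide_eq)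
  also have "\<dots> = (\<Prod>k\<in>{0, 1 :: nat}. prob {\<omega> \<in> space Q. v k \<omega> \<in> {s..}})"
    by (rule indep_vars_prob_Ball[OF indep_v]) auto
  also have "\<dots> = ?p\<^sup>2" unfolding pv by (simp add: power2_eq_square)
  finally have L: "prob ?L = ?p\<^sup>2" .
  have "prob {\<omega> \<in> space Q. aligned s \<epsilon> (\<xi> 0 \<omega>) (\<xi> 1 \<omega>)} \<le> prob ?AL"
    by (intro finite_measure_mono) (auto simp: aligned_def)
  also have "prob ?AL = ?cp * ?p\<^sup>2"
  \<comment> \<open>Conditioning on a null event gives the value 0; the joint event is then null
    too, so the product formula survives.\<close>
  proof (cases "prob ?L = 0")
    case True
    have "prob ?AL \<le> prob ?L" by (intro finite_measure_mono) auto
    then have "prob ?AL = 0" using True measure_nonneg[of Q ?AL] by (intro antisym) simp_all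
    then show ?thesis using True L by simp
  next
    case False
    then show ?thesis unfolding cond_prob_def L by simp
  qed
  finally have 1: "prob {\<omega> \<in> space Q. aligned s \<epsilon> (\<xi> 0 \<omega>) (\<xi> 1 \<omega>)} \<le> ?cp * ?p\<^sup>2" .
  have "prob {\<omega> \<in> space Q. \<exists>i<?N. \<exists>j<?N. i \<noteq> j \<and> aligned s \<epsilon> (\<xi> i \<omega>) (\<xi> j \<omega>)}
      \<le> (real ?N)\<^sup>2 * prob {\<omega> \<in> space Q. aligned s \<epsilon> (\<xi> 0 \<omega>) (\<xi> 1 \<omega>)}"
    by (rule prob_pairs_le[OF indep copies aligned_meas])
  also have "\<dots> \<le> (real n * T)\<^sup>2 * (?cp * ?p\<^sup>2)"
    using N 1 by (intro mult_mono power_mono) auto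
  finally show ?thesis by (simp add: power_mult_distrib mult_ac)
qed

text \<open>The general path comparison, applied to the walk in continuous time u with position
  \<open>partial_sum\<close> at floor (n u). Letters at most R bound the squared lengths of the
  large steps by t R, which turns the bound \<epsilon> on directions into t R * \<epsilon> for inner
  products.\<close>

lemma dist_walk_staircase:
  fixes t :: "nat \<Rightarrow> real" and q R :: nat
  defines "N \<equiv> \<lambda>T. nat \<lfloor>real n * T\<rfloor>"
    and "C \<equiv> \<lambda>j. if j = 0 then {} else {t (j - 1)<..t j}"
  assumes T: "0 < T" and q: "0 < q" and s: "0 < s" and t0: "t 0 = s" and t_mono: "strict_mono t"
    and mesh: "\<And>j. t (Suc j) - t j \<le> \<delta>1" and \<epsilon>: "0 \<le> \<epsilon>" and \<kappa>: "\<And>i. i < q \<Longrightarrow> \<kappa> i \<le> R"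
    and config: "\<And>i. i < q \<Longrightarrow> block_config s C (\<kappa> i) (walk_block n T q i) (\<lambda>k. v k \<omega>)"
    and sm: "\<And>k. k \<le> N T \<Longrightarrow> norm (\<Sum>i<k. small s (\<xi> i \<omega>)) / sqrt a \<le> \<eta>"
    and orth: "\<And>i j. i < N T \<Longrightarrow> j < N T \<Longrightarrow> i \<noteq> j \<Longrightarrow> \<not> aligned s \<epsilon> (\<xi> i \<omega>) (\<xi> j \<omega>)"
  shows "dist (gh_of_set ((\<lambda>k. partial_sum \<xi> k \<omega> /\<^sub>R sqrt a) ` {0..N T}))
      (gh_of_set (staircase q (\<lambda>i. if \<kappa> i = 0 then 0 else t (\<kappa> i))))
    \<le> \<eta> + sqrt (real q * \<delta>1 + (real q)\<^sup>2 * (t R * \<epsilon>))"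
proof -
  let ?\<tau> = "\<lambda>k. real (Suc k) / real n"
  let ?V = "\<lambda>k. \<xi> k \<omega> /\<^sub>R sqrt a"
  let ?D = "{k. k < N T \<and> s < v k \<omega>}"
  let ?path = "\<lambda>u. partial_sum \<xi> (N u) \<omega> /\<^sub>R sqrt a"
  have tpos: "0 < t j" for j using s t0 strict_mono_less_eq[OF t_mono, of 0 j] by simp
  have \<tau>_le: "?\<tau> k \<le> u \<longleftrightarrow> k < N u" if "0 \<le> u" for k u
  proof -
    have "?\<tau> k \<le> u \<longleftrightarrow> of_int (int (Suc k)) \<le> real n * u" using n by (simp add: field_simps)
    also have "\<dots> \<longleftrightarrow> int (Suc k) \<le> \<lfloor>real n * u\<rfloor>" by (rule le_floor_iff[symmetric])
    finally show ?thesis unfolding N_def by linarith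
  qed
  have N_mono: "N u \<le> N T" if "u \<le> T" for u
    unfolding N_def using that by (intro nat_mono floor_mono mult_left_mono) auto
  have image: "?path ` {0..T} = (\<lambda>k. partial_sum \<xi> k \<omega> /\<^sub>R sqrt a) ` {0..N T}"
  proof -
    have "N ` {0..T} = {0..N T}"
    proof (intro equalityI subsetI)
      fix k assume "k \<in> {0..N T}"
      then have "real k \<le> real n * T" using T unfolding N_def by (simp add: le_nat_iff le_floor_iff)
      then have "real k / real n \<in> {0..T}" using n by (simp add: pos_divide_le_eq mult.commute)
      moreover have "N (real k / real n) = k" unfolding N_def using n by simp
      ultimately show "k \<in> N ` {0..T}" by (metis imageI)
    qed (use N_mono in auto)
    then have "(\<lambda>k. partial_sum \<xi> k \<omega> /\<^sub>R sqrt a) ` N ` {0..T} = (\<lambda>k. partial_sum \<xi> k \<omega> /\<^sub>R sqrt a) ` {0..N T}"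
      by simp
    then show ?thesis by (simp only: image_image)
  qed
  have normV: "(norm (?V k))\<^sup>2 = v k \<omega>" for k
    using a by (simp add: v_def power_mult_distrib power_inverse divide_inverse)
  have Di: "{k\<in>?D. ?\<tau> k \<in> time_block T q i} = {k \<in> walk_block n T q i. s < v k \<omega>}" if "i < q" for i
    using time_block_le[OF _ that T] \<tau>_le[of T] T by (auto simp: walk_block_def)
  have C_s: "C j \<subseteq> {s<..}" for j
  proof -
    have "s \<le> t (j - 1)" using strict_mono_less_eq[OF t_mono, of 0 "j - 1"] by (simp add: t0)
    then show ?thesis by (auto simp: C_def)
  qed
  have blocks: "{k \<in> walk_block n T q i. s < v k \<omega>} = {} \<and> \<kappa> i = 0 \<or>
      (\<exists>k. {k \<in> walk_block n T q i. s < v k \<omega>} = {k} \<and> \<kappa> i \<noteq> 0 \<and> v k \<omega> \<in> C (\<kappa> i))" if i: "i < q" for i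
  proof (cases "\<kappa> i = 0")
    case True
    then show ?thesis using config[OF i] by (auto simp: block_config_def not_less)
  next
    case False
    then obtain k where k: "k \<in> walk_block n T q i" "v k \<omega> \<in> C (\<kappa> i)"
      "\<And>k'. k' \<in> walk_block n T q i \<Longrightarrow> k' \<noteq> k \<Longrightarrow> v k' \<omega> \<le> s"
      using config[OF i] by (auto simp: block_config_def)
    have "{k \<in> walk_block n T q i. s < v k \<omega>} = {k}"
      using k(1,2) k(3) C_s[of "\<kappa> i"] by (force simp: not_less[symmetric])
    then show ?thesis using k False by blast
  qed
  \<comment> \<open>Each large step up to time T lies in some block and is the one named by the
    letter of that block.\<close>
  have D_le: "v k \<omega> \<le> t R" if k: "k \<in> ?D" for k
  proof -
    have "0 < ?\<tau> k" using n by simp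
    moreover have "?\<tau> k \<le> T" using \<tau>_le[of T k] T k by simp
    ultimately obtain i where i: "i < q" "?\<tau> k \<in> time_block T q i"
      using time_block_exists[OF T q] by blast
    then have "k \<in> {k \<in> walk_block n T q i. s < v k \<omega>}" using k by (simp add: walk_block_def)
    then have "\<kappa> i \<noteq> 0 \<and> v k \<omega> \<in> C (\<kappa> i)" using blocks[OF i(1)] by (metis empty_iff singletonD)
    then have "v k \<omega> \<le> t (\<kappa> i)" by (auto simp: C_def)
    also have "\<dots> \<le> t R" using \<kappa>[OF i(1)] strict_mono_less_eq[OF t_mono] by simp
    finally show ?thesis .
  qed
  show ?thesis
  proof (rule dist_gh_path_staircase[where D = ?D and \<tau> = ?\<tau> and V = ?V and path = ?path])
    show "?path ` {0..T} \<subseteq> (\<lambda>k. partial_sum \<xi> k \<omega> /\<^sub>R sqrt a) ` {0..N T}" using image by simp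
    show "(\<lambda>k. partial_sum \<xi> k \<omega> /\<^sub>R sqrt a) ` {0..N T} \<subseteq> closure (?path ` {0..T})"
      unfolding image by (rule closure_subset)
    show "norm (?path u - (\<Sum>k\<in>{k\<in>?D. ?\<tau> k \<le> u}. ?V k)) \<le> \<eta>" if u: "0 \<le> u" "u \<le> T" for u
    proof -
      have D: "{k\<in>?D. ?\<tau> k \<le> u} = {..<N u} \<inter> {k. s < v k \<omega>}"
        unfolding \<tau>_le[OF u(1)] using N_mono[OF u(2)] by (blast intro: less_le_trans)
      have large: "(\<Sum>k\<in>{k\<in>?D. ?\<tau> k \<le> u}. ?V k) = (\<Sum>k<N u. if k \<in> {k. s < v k \<omega>} then ?V k else 0)"
        unfolding D by (rule sum.inter_restrict) simp
      have "?path u - (\<Sum>k\<in>{k\<in>?D. ?\<tau> k \<le> u}. ?V k) =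
          (\<Sum>k<N u. ?V k) - (\<Sum>k<N u. if k \<in> {k. s < v k \<omega>} then ?V k else 0)"
        by (simp only: large partial_sum_def scaleR_sum_right)
      also have "\<dots> = (\<Sum>k<N u. ?V k - (if k \<in> {k. s < v k \<omega>} then ?V k else 0))"
        by (rule sum_subtractf[symmetric])
      \<comment> \<open>Removing the large steps from the walk leaves precisely the truncated ones:
        s < v k is the negation of the condition in \<open>small\<close>.\<close>
      also have "\<dots> = (\<Sum>k<N u. small s (\<xi> k \<omega>) /\<^sub>R sqrt a)"
        using a by (intro sum.cong refl) (auto simp: small_def v_def pos_less_divide_eq indicator_def)
      finally have "?path u - (\<Sum>k\<in>{k\<in>?D. ?\<tau> k \<le> u}. ?V k) = (\<Sum>k<N u. small s (\<xi> k \<omega>) /\<^sub>R sqrt a)" .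
      then have "norm (?path u - (\<Sum>k\<in>{k\<in>?D. ?\<tau> k \<le> u}. ?V k)) = norm (\<Sum>k<N u. small s (\<xi> k \<omega>)) / sqrt a"
        using a by (simp add: scaleR_sum_right[symmetric] divide_inverse mult.commute)
      also have "\<dots> \<le> \<eta>" by (rule sm[OF N_mono[OF u(2)]])
      finally show ?thesis .
    qed
    show "{k\<in>?D. ?\<tau> k \<in> time_block T q i} = {} \<and> (if \<kappa> i = 0 then 0 else t (\<kappa> i)) = 0 \<or>
        (\<exists>k. {k\<in>?D. ?\<tau> k \<in> time_block T q i} = {k} \<and> \<bar>(norm (?V k))\<^sup>2 - (if \<kappa> i = 0 then 0 else t (\<kappa> i))\<bar> \<le> \<delta>1)"
      if i: "i < q" for i
      unfolding Di[OF i] normV using blocks[OF i]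
    proof (elim disjE conjE exE)
      assume "{k \<in> walk_block n T q i. s < v k \<omega>} = {}" "\<kappa> i = 0"
      then show "{k \<in> walk_block n T q i. s < v k \<omega>} = {} \<and> (if \<kappa> i = 0 then 0 else t (\<kappa> i)) = 0 \<or>
        (\<exists>k. {k \<in> walk_block n T q i. s < v k \<omega>} = {k} \<and> \<bar>v k \<omega> - (if \<kappa> i = 0 then 0 else t (\<kappa> i))\<bar> \<le> \<delta>1)"
        by simp
    next
      fix k assume k: "{k \<in> walk_block n T q i. s < v k \<omega>} = {k}" "\<kappa> i \<noteq> 0" "v k \<omega> \<in> C (\<kappa> i)"
      then have "t (\<kappa> i - 1) < v k \<omega>" "v k \<omega> \<le> t (\<kappa> i)" by (simp_all add: C_def)
      moreover have "t (\<kappa> i) - t (\<kappa> i - 1) \<le> \<delta>1" using mesh[of "\<kappa> i - 1"] k by simp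
      ultimately have "\<bar>v k \<omega> - t (\<kappa> i)\<bar> \<le> \<delta>1" by linarith
      then show "{k \<in> walk_block n T q i. s < v k \<omega>} = {} \<and> (if \<kappa> i = 0 then 0 else t (\<kappa> i)) = 0 \<or>
        (\<exists>k. {k \<in> walk_block n T q i. s < v k \<omega>} = {k} \<and> \<bar>v k \<omega> - (if \<kappa> i = 0 then 0 else t (\<kappa> i))\<bar> \<le> \<delta>1)"
        using k by (intro disjI2 exI[of _ k]) simp
    qed
    show "\<bar>inner (?V k) (?V k')\<bar> \<le> t R * \<epsilon>" if k: "k \<in> ?D" "k' \<in> ?D" "k \<noteq> k'" for k k'
    proof -
      have na: "\<not> aligned s \<epsilon> (\<xi> k \<omega>) (\<xi> k' \<omega>)" using k by (intro orth) auto
      have "\<bar>inner (sgn (\<xi> k \<omega>)) (sgn (\<xi> k' \<omega>))\<bar> \<le> \<epsilon>"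
        using na k a by (simp add: aligned_def v_def pos_less_divide_eq)
      moreover have "inner (?V k) (?V k') = norm (?V k) * norm (?V k') * inner (sgn (\<xi> k \<omega>)) (sgn (\<xi> k' \<omega>))"
      proof -
        have "inner u w = norm u * norm w * inner (sgn u) (sgn w)" for u w :: l2
          by (cases "u = 0 \<or> w = 0") (auto simp: sgn_div_norm field_simps)
        moreover have "sgn (?V j) = sgn (\<xi> j \<omega>)" for j using a by (simp add: sgn_scaleR)
        ultimately show ?thesis by metis
      qed
      moreover have nV: "norm (?V j) \<le> sqrt (t R)" if "j \<in> ?D" for j
        using D_le[OF that] normV[of j] by (intro real_le_rsqrt) simp
      ultimately have "\<bar>inner (?V k) (?V k')\<bar> \<le> sqrt (t R) * sqrt (t R) * \<epsilon>"
        using tpos[of R] nV[OF k(1)] nV[OF k(2)]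
        by (simp only: abs_mult abs_norm_cancel) (intro mult_mono, simp_all)
      then show ?thesis using tpos[of R] by simp
    qed
    show "0 \<le> \<delta>1" using mesh[of 0] strict_mono_less[OF t_mono, of 0 "Suc 0"] by linarith
    show "0 \<le> t R * \<epsilon>" using tpos[of R] \<epsilon> by simp
    show "0 \<le> (if \<kappa> i = 0 then 0 else t (\<kappa> i))" for i using tpos[of "\<kappa> i"] by simp
    show "0 < ?\<tau> k" for k using n by simp
  qed (use T q in \<open>auto intro: finite_imp_compact\<close>)
qed

end

section \<open>Assembly: grid of cells, order of the choices, error budget\<close>

text \<open>The step that realises a nonzero letter exceeds s, so any other description of the block
  must name the same step, and the cells are disjoint.\<close>

lemma block_config_unique:
  assumes "block_config s C j B v" "block_config s C j' B v"
    and C: "\<And>j. C j \<subseteq> {s<..}" and disj: "\<And>i j. i \<noteq> j \<Longrightarrow> C i \<inter> C j = {}"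
  shows "j = j'"
proof (rule ccontr)
  assume jj: "j \<noteq> j'"
  have gt: "s < u" if "u \<in> C i" for u i using C[of i] that by auto
  show False
  proof (cases "j = 0 \<or> j' = 0")
    case True
    then show False using assms(1,2) jj gt by (fastforce simp: block_config_def not_less[symmetric])
  next
    case False
    then obtain k k' where k: "k \<in> B" "v k \<in> C j" "\<forall>i\<in>B - {k}. v i \<le> s"
      and k': "k' \<in> B" "v k' \<in> C j'" using assms(1,2) by (auto simp: block_config_def)
    have "s < v k'" using gt[OF k'(2)] .
    then have "k' = k" using k(3) k'(1) by (metis DiffI not_less singletonD)
    then show False using k(2) k'(2) disj[OF jj] by blast
  qed
qed

lemma (in subordinator_measure) null_grid_exists:
  assumes s: "0 < s" "emeasure \<nu> {ennreal s} = 0" and \<delta>: "0 < \<delta>"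
  shows "\<exists>t :: nat \<Rightarrow> real. t 0 = s \<and> strict_mono t \<and> (\<forall>j. emeasure \<nu> {ennreal (t j)} = 0) \<and>
    (\<forall>j. t (Suc j) - t j \<le> \<delta>) \<and> (\<forall>M. \<exists>R. M \<le> t R)"
proof -
  \<comment> \<open>Point j is picked among the non-atoms in the upper half of the j-th interval of
    length h = \<delta> / 2. Neighbours then differ by more than h / 2 and less than 3 h /
    2.\<close>
  define h where "h = \<delta> / 2"
  have h: "0 < h" using \<delta> by (simp add: h_def)
  have "\<exists>u. s + (real j + 1 / 2) * h < u \<and> u < s + (real j + 1) * h \<and> emeasure \<nu> {ennreal u} = 0" for j :: nat
    using s h by (intro null_atom_exists) (auto intro!: add_pos_nonneg)
  then obtain u where u: "\<And>j. s + (real j + 1 / 2) * h < u j" "\<And>j. u j < s + (real j + 1) * h"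
    "\<And>j. emeasure \<nu> {ennreal (u j)} = 0" by metis
  define t where "t j = (case j of 0 \<Rightarrow> s | Suc i \<Rightarrow> u i)" for j
  have step: "t j < t (Suc j) \<and> t (Suc j) - t j \<le> \<delta>" for j
  proof (cases j)
    case 0
    then show ?thesis using u(1)[of 0] u(2)[of 0] h by (simp add: t_def h_def)
  next
    case (Suc i)
    have "u i < s + real i * h + h" "s + real i * h + h / 2 < u i"
      "u (Suc i) < s + real i * h + 2 * h" "s + real i * h + 3 / 2 * h < u (Suc i)"
      using u(1,2)[of i] u(1,2)[of "Suc i"] by (simp_all add: algebra_simps)
    then have "u i < u (Suc i)" "u (Suc i) - u i \<le> 2 * h" using h by linarith+
    then show ?thesis using Suc by (simp add: t_def h_def)
  qed
  have "\<exists>R. M \<le> t R" for M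
  proof -
    obtain j :: nat where j: "(M - s) / h \<le> real j" using real_arch_simple by blast
    then have "M \<le> s + real j * h" using h by (simp add: field_simps)
    also have "\<dots> \<le> s + (real j + 1 / 2) * h" using h by simp
    also have "\<dots> \<le> t (Suc j)" using u(1)[of j] by (simp add: t_def)
    finally show ?thesis by blast
  qed
  moreover have "emeasure \<nu> {ennreal (t j)} = 0" for j using s u by (cases j) (simp_all add: t_def)
  moreover have "strict_mono t" using step by (simp add: strict_mono_Suc_iff)
  moreover have "t 0 = s" by (simp add: t_def)
  ultimately show ?thesis using step by blast
qed

theorem theorem2p3:
  fixes P :: "nat \<Rightarrow> 'p measure" and X :: "nat \<Rightarrow> 'p \<Rightarrow> l2"
    and Q :: "nat \<Rightarrow> 'q measure" and \<xi> :: "nat \<Rightarrow> nat \<Rightarrow> 'q \<Rightarrow> l2"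
    and n :: "nat \<Rightarrow> nat" and a :: "nat \<Rightarrow> real" and \<nu> :: "ennreal measure"
    and W :: "'w measure" and I :: "'w \<Rightarrow> nat set"
    and x :: "nat \<Rightarrow> 'w \<Rightarrow> real" and y :: "nat \<Rightarrow> 'w \<Rightarrow> ennreal"
    and T :: real
  assumes P: "\<And>d. prob_space (P d)"
    and X: "\<And>d. X d \<in> borel_measurable (P d)"
    and X_coord: "\<And>d \<omega>. \<omega> \<in> space (P d) \<Longrightarrow> X d \<omega> \<in> l2_coord_space d"
    and Q: "\<And>d. prob_space (Q d)"
    and \<xi>_indep: "\<And>d. prob_space.indep_vars (Q d) (\<lambda>_. borel) (\<xi> d) UNIV"
    and \<xi>_copies: "\<And>d i. distr (Q d) borel (\<xi> d i) = distr (P d) borel (X d)"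
    and n_pos: "\<And>d. 0 < n d" and n_lim: "filterlim n at_top sequentially"
    and a_pos: "\<And>k. 0 < k \<Longrightarrow> 0 < a k"
    and sets_\<nu>: "sets \<nu> = sets (restrict_space borel {0<..})"
    and \<nu>_int: "(\<integral>\<^sup>+z\<in>{0<..<\<infinity>}. min 1 z \<partial>\<nu>) < \<infinity>"
    and \<nu>_top: "emeasure \<nu> {\<infinity>} = 0"
    and a1: "vague_conv
        (\<lambda>d. scale_measure (of_nat (n d))
           (restrict_space (distr (P d) borel (\<lambda>\<omega>. ennreal ((norm (X d \<omega>))\<^sup>2 / a (n d)))) {0<..})) \<nu>"
    and a2: "((\<lambda>s. limsup (\<lambda>d. ereal (real (n d) / a (n d) *
        (\<integral>\<omega>. (norm (X d \<omega>))\<^sup>2 * indicator {v. (norm v)\<^sup>2 \<le> s * a (n d)} (X d \<omega>) \<partial>P d)))) \<longlongrightarrow> 0)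
        (at_right 0)"
    and b: "\<And>s \<epsilon> :: real. 0 < s \<Longrightarrow> 0 < \<epsilon> \<Longrightarrow>
        (\<lambda>d. \<P>(\<omega> in Q d. \<bar>inner (sgn (\<xi> d 0 \<omega>)) (sgn (\<xi> d 1 \<omega>))\<bar> > \<epsilon> \<bar>
           (norm (\<xi> d 0 \<omega>))\<^sup>2 \<ge> s * a (n d) \<and> (norm (\<xi> d 1 \<omega>))\<^sup>2 \<ge> s * a (n d))) \<longlonglongrightarrow> 0"
    and c: "((\<lambda>s. limsup (\<lambda>d. ereal (real (n d) / sqrt (a (n d)) *
        norm (\<integral>\<omega>. indicator {v. (norm v)\<^sup>2 \<le> s * a (n d)} (X d \<omega>) *\<^sub>R X d \<omega> \<partial>P d)))) \<longlongrightarrow> 0)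
        (at_right 0)"
    and T: "0 < T"
    and W: "prob_space W" and atoms: "poisson_atoms W \<nu> I x y"
  shows "conv_in_distribution Q
      (\<lambda>d \<omega>. gh_of_set ((\<lambda>k. partial_sum (\<xi> d) k \<omega> /\<^sub>R sqrt (a (n d))) ` {0..nat \<lfloor>real (n d) * T\<rfloor>}))
      (completion W) (\<lambda>\<omega>. gh_of_set (crinkled_range I x y T \<omega>))"
proof -
  interpret pa: poisson_atoms_setup \<nu> W I x y
    by (intro poisson_atoms_setup.intro subordinator_measure.intro poisson_atoms_setup_axioms.intro
        sets_\<nu> \<nu>_int \<nu>_top W atoms)
  have wk: "scaled_walk (Q d) (\<xi> d) (P d) (X d) (n d) (a (n d))" for d
    by (intro scaled_walk.intro scaled_walk_axioms.intro Q \<xi>_indep \<xi>_copies P X n_pos a_pos)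
  have \<xi>_meas: "\<xi> d k \<in> borel_measurable (Q d)" for d k
    by (rule scaled_walk.\<xi>_meas[OF wk])
  let ?R = "\<lambda>d \<omega>. (norm (X d \<omega>))\<^sup>2 / a (n d)"
  have R_meas: "?R d \<in> borel_measurable (P d)" for d using X[of d] by measurable
  let ?G = "\<lambda>d u. real (n d) * measure (P d) {\<omega> \<in> space (P d). u < ?R d \<omega>}"
  have G_lim: "(\<lambda>d. ?G d u) \<longlonglongrightarrow> pa.tail u" if "0 < u" "emeasure \<nu> {ennreal u} = 0" for u
    by (rule pa.scaled_prob_tendsto_tail[OF P R_meas a1 that])
  show ?thesis
  proof (rule conv_in_distribution_finite_approxI[OF Q])
    show "prob_space (completion W)" using W by (rule prob_space.prob_space_completion)
    show "(\<lambda>\<omega>. gh_of_set (crinkled_range I x y T \<omega>)) \<in> borel_measurable (completion W)"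
      using T by (intro pa.measurable_gh_crinkled_range) simp
    show "(\<lambda>\<omega>. gh_of_set ((\<lambda>k. partial_sum (\<xi> d) k \<omega> /\<^sub>R sqrt (a (n d))) ` {0..nat \<lfloor>real (n d) * T\<rfloor>}))
        \<in> borel_measurable (Q d)" for d
    proof (rule measurable_gh_of_set_image)
      fix k
      note [measurable] = \<xi>_meas
      show "(\<lambda>\<omega>. partial_sum (\<xi> d) k \<omega> /\<^sub>R sqrt (a (n d))) \<in> borel_measurable (Q d)"
        unfolding partial_sum_def by measurable
    qed
  next
    fix e :: real and thesis
    assume e: "0 < e"
      and *: "\<And>(K :: (nat \<Rightarrow> nat) set) g A B A' B'. finite K \<Longrightarrow>
        (\<And>d \<kappa>. \<kappa> \<in> K \<Longrightarrow> A d \<kappa> \<in> sets (Q d)) \<Longrightarrow> (\<And>d. disjoint_family_on (A d) K) \<Longrightarrow>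
        (\<And>d. B d \<in> sets (Q d)) \<Longrightarrow>
        (\<And>d \<kappa> \<omega>. \<kappa> \<in> K \<Longrightarrow> \<omega> \<in> A d \<kappa> \<Longrightarrow> \<omega> \<in> B d \<Longrightarrow> dist (gh_of_set ((\<lambda>k. partial_sum (\<xi> d) k \<omega> /\<^sub>R sqrt (a (n d))) ` {0..nat \<lfloor>real (n d) * T\<rfloor>})) (g \<kappa>) \<le> e) \<Longrightarrow>
        (\<And>\<kappa>. \<kappa> \<in> K \<Longrightarrow> A' \<kappa> \<in> sets (completion W)) \<Longrightarrow> disjoint_family_on A' K \<Longrightarrow> B' \<in> sets (completion W) \<Longrightarrow>
        (\<And>\<kappa> \<omega>. \<kappa> \<in> K \<Longrightarrow> \<omega> \<in> A' \<kappa> \<Longrightarrow> \<omega> \<in> B' \<Longrightarrow> dist (gh_of_set (crinkled_range I x y T \<omega>)) (g \<kappa>) \<le> e) \<Longrightarrow>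
        (\<And>\<kappa>. \<kappa> \<in> K \<Longrightarrow> (\<lambda>d. measure (Q d) (A d \<kappa>)) \<longlonglongrightarrow> measure (completion W) (A' \<kappa>)) \<Longrightarrow>
        1 - e \<le> (\<Sum>\<kappa>\<in>K. measure (completion W) (A' \<kappa>)) \<Longrightarrow>
        (\<forall>\<^sub>F d in sequentially. 1 - e \<le> measure (Q d) (B d)) \<Longrightarrow> 1 - e \<le> measure (completion W) B' \<Longrightarrow> thesis"
    \<comment> \<open>Half of e is for the steps and jumps below s, the other half for the
      distortion of the large ones; they are recombined in \<open>total\<close>.\<close>
    define \<eta> where "\<eta> = e / 2"
    have \<eta>: "0 < \<eta>" using e by (simp add: \<eta>_def)

    \<comment> \<open>Truncation level below which steps and jumps are negligible.\<close>
    define \<theta>1 where "\<theta>1 = e / 4 * \<eta>\<^sup>2 / (4 * T)"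
    define \<theta>2 where "\<theta>2 = \<eta> / 2 / T"
    define \<theta>3 where "\<theta>3 = e * \<eta>\<^sup>2 / T"
    \<comment> \<open>\<theta>1 makes the maximal inequality yield 4 T / \<eta>^2 * \<theta>1 = e /
      4, \<theta>2 limits the drift to T * \<theta>2 = \<eta> / 2, and \<theta>3 makes Markov's
      inequality for the small jumps yield e.\<close>
    have \<theta>: "0 < \<theta>1" "0 < \<theta>2" "0 < \<theta>3" using e \<eta> T by (simp_all add: \<theta>1_def \<theta>2_def \<theta>3_def)
    have "\<forall>\<^sub>F s in at_right 0. limsup (\<lambda>d. ereal (real (n d) / a (n d) *
        (\<integral>\<omega>. (norm (X d \<omega>))\<^sup>2 * indicator {v. (norm v)\<^sup>2 \<le> s * a (n d)} (X d \<omega>) \<partial>P d))) < ereal \<theta>1"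
      by (rule order_tendstoD(2)[OF a2]) (use \<theta> in simp)
    then obtain b1 where b1: "0 < b1" "\<And>s. 0 < s \<Longrightarrow> s < b1 \<Longrightarrow> limsup (\<lambda>d. ereal (real (n d) / a (n d) *
        (\<integral>\<omega>. (norm (X d \<omega>))\<^sup>2 * indicator {v. (norm v)\<^sup>2 \<le> s * a (n d)} (X d \<omega>) \<partial>P d))) < ereal \<theta>1"
      unfolding eventually_at_right_field by blast
    have "\<forall>\<^sub>F s in at_right 0. limsup (\<lambda>d. ereal (real (n d) / sqrt (a (n d)) *
        norm (\<integral>\<omega>. indicator {v. (norm v)\<^sup>2 \<le> s * a (n d)} (X d \<omega>) *\<^sub>R X d \<omega> \<partial>P d))) < ereal \<theta>2"
      by (rule order_tendstoD(2)[OF c]) (use \<theta> in simp)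
    then obtain b2 where b2: "0 < b2" "\<And>s. 0 < s \<Longrightarrow> s < b2 \<Longrightarrow> limsup (\<lambda>d. ereal (real (n d) / sqrt (a (n d)) *
        norm (\<integral>\<omega>. indicator {v. (norm v)\<^sup>2 \<le> s * a (n d)} (X d \<omega>) *\<^sub>R X d \<omega> \<partial>P d))) < ereal \<theta>2"
      unfolding eventually_at_right_field by blast
    obtain s0 where s0: "0 < s0" "\<And>s. s \<le> s0 \<Longrightarrow> (\<integral>\<^sup>+z\<in>{0<..ennreal s}. z \<partial>\<nu>) \<le> ennreal \<theta>3"
      using pa.small_jumps_integral[OF \<theta>(3)] by blast
    define s1 where "s1 = min b1 (min b2 s0)"
    have s1: "0 < s1" using b1 b2 s0 by (simp add: s1_def)
    \<comment> \<open>The level is a non-atom so that n P (R > s) converges to the tail at s; it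
      exceeds s1 / 2 to stay positive.\<close>
    obtain s where s: "s1 / 2 < s" "s < s1" "emeasure \<nu> {ennreal s} = 0"
      using pa.null_atom_exists[of "s1 / 2" s1] s1 by auto
    have s_pos: "0 < s" using s s1 by simp
    have sm1: "\<forall>\<^sub>F d in sequentially. real (n d) / a (n d) *
        (\<integral>\<omega>. (norm (X d \<omega>))\<^sup>2 * indicator {v. (norm v)\<^sup>2 \<le> s * a (n d)} (X d \<omega>) \<partial>P d) < \<theta>1"
      using Limsup_lessD[OF b1(2)[of s]] s s_pos by (simp add: s1_def)
    have sm2: "\<forall>\<^sub>F d in sequentially. real (n d) / sqrt (a (n d)) *
        norm (\<integral>\<omega>. indicator {v. (norm v)\<^sup>2 \<le> s * a (n d)} (X d \<omega>) *\<^sub>R X d \<omega> \<partial>P d) < \<theta>2"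
      using Limsup_lessD[OF b2(2)[of s]] s s_pos by (simp add: s1_def)
    have sm3: "(\<integral>\<^sup>+z\<in>{0<..ennreal s}. z \<partial>\<nu>) \<le> ennreal \<theta>3" using s0(2)[of s] s by (simp add: s1_def)

    \<comment> \<open>So many time blocks that, with high probability, none contains two large jumps.\<close>
    define \<Lambda> where "\<Lambda> = T * pa.tail s"
    \<comment> \<open>This is the limit probability that each of the q blocks has at most one jump
      above s: a product of q factors (1 + \<Lambda> / q) exp (- \<Lambda> / q).\<close>
    have "(\<lambda>q. exp (- \<Lambda>) * (1 + \<Lambda> / real q) ^ q) \<longlonglongrightarrow> exp (- \<Lambda>) * exp \<Lambda>"
      by (intro tendsto_mult tendsto_const tendsto_exp_limit_sequentially)
    then have "\<forall>\<^sub>F q in sequentially. 1 - e < exp (- \<Lambda>) * (1 + \<Lambda> / real q) ^ q"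
      by (rule order_tendstoD(1)) (use e in \<open>simp add: exp_add[symmetric]\<close>)
    then obtain q where q: "0 < q" "1 - e < exp (- \<Lambda>) * (1 + \<Lambda> / real q) ^ q"
      using eventually_conj[OF _ eventually_gt_at_top[of 0]] eventually_happens'[OF sequentially_bot] by blast
    \<comment> \<open>The same probability with the further demand that no large jump exceeds M; the
      finite alphabet covers sizes up to such an M only.\<close>
    have "((\<lambda>M. exp (- \<Lambda>) * (1 + (\<Lambda> - T * pa.tail M) / real q) ^ q) \<longlongrightarrow>
        exp (- \<Lambda>) * (1 + (\<Lambda> - T * 0) / real q) ^ q) at_top"
      using q by (intro tendsto_intros pa.tail_at_top) auto
    then have "\<forall>\<^sub>F M in at_top. 1 - e < exp (- \<Lambda>) * (1 + (\<Lambda> - T * pa.tail M) / real q) ^ q"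
      by (rule order_tendstoD(1)) (use q in simp)
    then obtain M0 where M0: "\<And>M. M0 \<le> M \<Longrightarrow> 1 - e < exp (- \<Lambda>) * (1 + (\<Lambda> - T * pa.tail M) / real q) ^ q"
      unfolding eventually_at_top_linorder by blast

    \<comment> \<open>\<delta>1 and \<delta>2 each contribute \<eta>^2 / 2 to the squared distortion
      q \<delta>1 + q^2 \<delta>2.\<close>
    define \<delta>1 where "\<delta>1 = \<eta>\<^sup>2 / (2 * real q)"
    define \<delta>2 where "\<delta>2 = \<eta>\<^sup>2 / (2 * (real q)\<^sup>2)"
    have \<delta>: "0 < \<delta>1" "0 < \<delta>2" using \<eta> q by (simp_all add: \<delta>1_def \<delta>2_def)
    have "real q * \<delta>1 + (real q)\<^sup>2 * \<delta>2 = \<eta>\<^sup>2"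
      using q by (simp add: \<delta>1_def \<delta>2_def)
    then have total: "\<eta> + sqrt (real q * \<delta>1 + (real q)\<^sup>2 * \<delta>2) = e" using \<eta> by (simp add: \<eta>_def)
    obtain t :: "nat \<Rightarrow> real" where t: "t 0 = s" "strict_mono t" "\<And>j. emeasure \<nu> {ennreal (t j)} = 0"
      "\<And>j. t (Suc j) - t j \<le> \<delta>1" "\<And>M. \<exists>R. M \<le> t R"
      using pa.null_grid_exists[OF s_pos s(3) \<delta>(1)] by blast
    obtain R where R: "M0 \<le> t R" using t(5) by blast
    have t_pos: "0 < t j" for j using s_pos t(1) strict_mono_less_eq[OF t(2), of 0 j] by simp
    \<comment> \<open>Chosen after the ceiling t R, so that inner products of large steps are at
      most \<delta>2.\<close>
    define \<epsilon> where "\<epsilon> = \<delta>2 / t R"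
    have \<epsilon>: "0 < \<epsilon>" "t R * \<epsilon> = \<delta>2" using \<delta> t_pos[of R] by (simp_all add: \<epsilon>_def)

    define K :: "(nat \<Rightarrow> nat) set" where "K = PiE {..<q} (\<lambda>_. {..R})"
    define C where "C j = (if j = 0 then {} else {t (j - 1)<..t j})" for j
    have C_borel: "C j \<in> sets borel" for j by (simp add: C_def)
    have C_s: "C j \<subseteq> {s<..}" for j
      using strict_mono_less_eq[OF t(2), of 0 "j - 1"] by (auto simp: C_def t(1))
    have C_disj: "C i \<inter> C j = {}" if "i \<noteq> j" for i j
    proof -
      have *: "C i \<inter> C j = {}" if "i < j" for i j
        using that strict_mono_less_eq[OF t(2), of i "j - 1"] by (auto simp: C_def)
      show ?thesis using *[of i j] *[of j i] that by (cases "i < j") auto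
    qed
    let ?v = "\<lambda>d k \<omega>. (norm (\<xi> d k \<omega>))\<^sup>2 / a (n d)"
    have v_eq: "scaled_walk.v (\<xi> d) (a (n d)) = ?v d" for d
      by (intro ext) (rule scaled_walk.v_def[OF wk])
    have v_meas: "?v d k \<in> borel_measurable (Q d)" for d k
      using \<xi>_meas[of d k] by measurable
    define A where "A d \<kappa> = {\<omega> \<in> space (Q d). \<forall>i<q. block_config s C (\<kappa> i) (walk_block (n d) T q i) (\<lambda>k. ?v d k \<omega>)}" for d \<kappa>
    define N where "N d = nat \<lfloor>real (n d) * T\<rfloor>" for d
    define B1 where "B1 d = {\<omega> \<in> space (Q d). \<exists>k\<le>N d. \<eta> < norm (\<Sum>i<k. scaled_walk.small (a (n d)) s (\<xi> d i \<omega>)) / sqrt (a (n d))}" for d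
    define B2 where "B2 d = {\<omega> \<in> space (Q d). \<exists>i<N d. \<exists>j<N d. i \<noteq> j \<and> scaled_walk.aligned (a (n d)) s \<epsilon> (\<xi> d i \<omega>) (\<xi> d j \<omega>)}" for d
    have B12: "B1 d \<in> sets (Q d)" "B2 d \<in> sets (Q d)" for d
    proof -
      note [measurable] = \<xi>_meas scaled_walk.small_meas[OF wk]
      show "B1 d \<in> sets (Q d)" unfolding B1_def by measurable
      have [measurable]: "Measurable.pred (Q d) (\<lambda>\<omega>. scaled_walk.aligned (a (n d)) s \<epsilon> (\<xi> d i \<omega>) (\<xi> d j \<omega>))" for i j
        using measurable_compose[OF _ scaled_walk.aligned_meas[OF wk], of "\<lambda>\<omega>. (\<xi> d i \<omega>, \<xi> d j \<omega>)" "Q d" d] by simp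
      show "B2 d \<in> sets (Q d)" unfolding B2_def by measurable
    qed
    have AE_r: "AE \<omega> in W. pa.regular T \<omega>" using T by (intro pa.AE_regular) simp
    \<comment> \<open>The irregular outcomes are covered by a null set of W, which is later cut out
      of the good event for the limit.\<close>
    then obtain Z where Z: "Z \<in> null_sets W" "\<And>\<omega>. \<omega> \<in> space W - Z \<Longrightarrow> pa.regular T \<omega>"
      by (auto elim!: AE_E3)
    let ?A' = "pa.atom_config T s q t"
    have A'_sets: "?A' \<kappa> \<in> sets W" for \<kappa> by (rule pa.atom_config_in_sets[OF T q(1) s_pos t(1,2)])
    have S_sets: "pa.small_jumps T s \<eta> \<in> sets W" using T \<eta> by (intro pa.small_jumps_in_sets) auto
    show thesis
    proof (rule *[of K A "\<lambda>d. space (Q d) - (B1 d \<union> B2 d)" "\<lambda>\<kappa>. gh_of_set (staircase q (\<lambda>i. if \<kappa> i = 0 then 0 else t (\<kappa> i)))"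
          ?A' "pa.small_jumps T s \<eta> - Z"])
      show "finite K" unfolding K_def by (intro finite_PiE) auto
      show "A d \<kappa> \<in> sets (Q d)" for d \<kappa>
      proof -
        have [measurable]: "Measurable.pred (Q d) (\<lambda>\<omega>. block_config s C (\<kappa> i) (walk_block (n d) T q i) (\<lambda>k. ?v d k \<omega>))" for i
          using v_meas C_borel finite_walk_block[OF n_pos T] by (intro measurable_block_config) auto
        show ?thesis unfolding A_def by measurable
      qed
      show "disjoint_family_on (A d) K" for d
        unfolding disjoint_family_on_def
      proof (intro ballI impI)
        fix \<kappa> \<kappa>' assume \<kappa>: "\<kappa> \<in> K" "\<kappa>' \<in> K" "\<kappa> \<noteq> \<kappa>'"
        then obtain i where i: "i < q" "\<kappa> i \<noteq> \<kappa>' i" unfolding K_def by (metis PiE_ext lessThan_iff)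
        have False if "\<omega> \<in> A d \<kappa>" "\<omega> \<in> A d \<kappa>'" for \<omega>
          using block_config_unique[of s C "\<kappa> i" _ _ "\<kappa>' i", OF _ _ C_s C_disj] that i unfolding A_def by blast
        then show "A d \<kappa> \<inter> A d \<kappa>' = {}" by blast
      qed
      show "space (Q d) - (B1 d \<union> B2 d) \<in> sets (Q d)" for d using B12 by auto
      show "dist (gh_of_set ((\<lambda>k. partial_sum (\<xi> d) k \<omega> /\<^sub>R sqrt (a (n d))) ` {0..nat \<lfloor>real (n d) * T\<rfloor>}))
          (gh_of_set (staircase q (\<lambda>i. if \<kappa> i = 0 then 0 else t (\<kappa> i)))) \<le> e"
        if \<kappa>: "\<kappa> \<in> K" and \<omega>: "\<omega> \<in> A d \<kappa>" "\<omega> \<in> space (Q d) - (B1 d \<union> B2 d)" for d \<kappa> \<omega>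
        unfolding total[symmetric] \<epsilon>(2)[symmetric]
      proof (rule scaled_walk.dist_walk_staircase[OF wk T q(1) s_pos t(1,2,4) less_imp_le[OF \<epsilon>(1)]])
        show "\<kappa> i \<le> R" if "i < q" for i using \<kappa> that by (auto simp: K_def PiE_iff)
        show "block_config s (\<lambda>j. if j = 0 then {} else {t (j - 1)<..t j}) (\<kappa> i) (walk_block (n d) T q i)
            (\<lambda>k. scaled_walk.v (\<xi> d) (a (n d)) k \<omega>)" if "i < q" for i
          using \<omega>(1) that unfolding v_eq A_def C_def[abs_def] by blast
        show "norm (\<Sum>i<k. scaled_walk.small (a (n d)) s (\<xi> d i \<omega>)) / sqrt (a (n d)) \<le> \<eta>"
          if "k \<le> nat \<lfloor>real (n d) * T\<rfloor>" for k
          using \<omega>(2) that unfolding B1_def N_def by (auto simp: not_less)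
        show "\<not> scaled_walk.aligned (a (n d)) s \<epsilon> (\<xi> d i \<omega>) (\<xi> d j \<omega>)"
          if "i < nat \<lfloor>real (n d) * T\<rfloor>" "j < nat \<lfloor>real (n d) * T\<rfloor>" "i \<noteq> j" for i j
          using \<omega>(2) that unfolding B2_def N_def by blast
      qed
      show "?A' \<kappa> \<in> sets (completion W)" for \<kappa> using A'_sets by (rule sets_completionI_sets)
      show "disjoint_family_on ?A' K" unfolding K_def by (rule pa.disjoint_atom_config[OF T q(1) s_pos t(1,2)])
      show "pa.small_jumps T s \<eta> - Z \<in> sets (completion W)" using S_sets Z by (intro sets_completionI_sets) auto
      show "dist (gh_of_set (crinkled_range I x y T \<omega>)) (gh_of_set (staircase q (\<lambda>i. if \<kappa> i = 0 then 0 else t (\<kappa> i)))) \<le> e"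
        if "\<omega> \<in> ?A' \<kappa>" "\<omega> \<in> pa.small_jumps T s \<eta> - Z" for \<kappa> \<omega>
        unfolding total[symmetric]
      proof (rule pa.dist_crinkled_range_staircase[OF T q(1) s_pos t(1,2)])
        show "pa.regular T \<omega>" using that by (intro Z) (auto simp: pa.small_jumps_def)
      qed (use that \<eta> t(4) \<delta> in auto)
      show "(\<lambda>d. measure (Q d) (A d \<kappa>)) \<longlonglongrightarrow> measure (completion W) (?A' \<kappa>)" for \<kappa>
      proof -
        define p where "p d j = measure (P d) {\<omega> \<in> space (P d). ?R d \<omega> \<in> C j}" for d j
        have ind: "prob_space.indep_vars (Q d) (\<lambda>_. borel) (?v d) UNIV" for d
          using scaled_walk.indep_v[OF wk, of d] unfolding v_eq .
        have pv: "measure (Q d) {\<omega> \<in> space (Q d). ?v d k \<omega> \<in> S} = measure (P d) {\<omega> \<in> space (P d). ?R d \<omega> \<in> S}"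
          if "S \<in> sets borel" for d k S
          using scaled_walk.prob_v[OF wk that, of d k] unfolding v_eq .
        have "(\<lambda>d. measure (Q d) (A d \<kappa>)) \<longlonglongrightarrow>
            (\<Prod>i<q. (if \<kappa> i = 0 then 1 else T / q * (pa.tail (t (\<kappa> i - 1)) - pa.tail (t (\<kappa> i)))) * exp (- (T / q * pa.tail s)))"
          unfolding A_def
        proof (rule prob_config_tendsto[where \<alpha> = "\<lambda>j. pa.tail (t (j - 1)) - pa.tail (t j)" and p = p
              and ?p0.0 = "\<lambda>d. measure (P d) {\<omega> \<in> space (P d). s < ?R d \<omega>}", OF Q ind n_pos n_lim T C_borel C_s])
          show "measure (Q d) {\<omega> \<in> space (Q d). ?v d k \<omega> \<in> C j} = p d j" for d k j
            unfolding p_def by (rule pv[OF C_borel])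
          show "measure (Q d) {\<omega> \<in> space (Q d). s < ?v d k \<omega>} = measure (P d) {\<omega> \<in> space (P d). s < ?R d \<omega>}" for d k
            using pv[of "{s<..}" d k] by simp
          show "(\<lambda>d. ?G d s) \<longlonglongrightarrow> pa.tail s" by (rule G_lim[OF s_pos s(3)])
          show "(\<lambda>d. real (n d) * p d (\<kappa> i)) \<longlonglongrightarrow> pa.tail (t (\<kappa> i - 1)) - pa.tail (t (\<kappa> i))"
            if i: "\<kappa> i \<noteq> 0" for i
          proof -
            have lt: "t (\<kappa> i - 1) < t (\<kappa> i)" using i strict_mono_less[OF t(2), of "\<kappa> i - 1" "\<kappa> i"] by simp
            have "real (n d) * p d (\<kappa> i) = ?G d (t (\<kappa> i - 1)) - ?G d (t (\<kappa> i))" for d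
            proof -
              interpret Pd: prob_space "P d" by (rule P)
              note [measurable] = R_meas[of d]
              have "{\<omega> \<in> space (P d). ?R d \<omega> \<in> C (\<kappa> i)} =
                  {\<omega> \<in> space (P d). t (\<kappa> i - 1) < ?R d \<omega>} - {\<omega> \<in> space (P d). t (\<kappa> i) < ?R d \<omega>}"
                using i by (auto simp: C_def)
              moreover have "Pd.prob ({\<omega> \<in> space (P d). t (\<kappa> i - 1) < ?R d \<omega>} - {\<omega> \<in> space (P d). t (\<kappa> i) < ?R d \<omega>}) =
                  Pd.prob {\<omega> \<in> space (P d). t (\<kappa> i - 1) < ?R d \<omega>} - Pd.prob {\<omega> \<in> space (P d). t (\<kappa> i) < ?R d \<omega>}"
                by (rule Pd.finite_measure_Diff) (use lt in auto)
              ultimately show ?thesis by (simp add: p_def right_diff_distrib)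
            qed
            then show ?thesis using t_pos t(3) by (simp only:) (intro tendsto_diff G_lim)
          qed
        qed
        then show ?thesis
          using A'_sets[of \<kappa>] by (simp add: pa.prob_atom_config[OF T q(1) s_pos t(1,2)])
      qed
      show "1 - e \<le> (\<Sum>\<kappa>\<in>K. measure (completion W) (?A' \<kappa>))"
      proof -
        define w where "w j = (if j = 0 then 1 else T / q * (pa.tail (t (j - 1)) - pa.tail (t j))) * exp (- (T / q * pa.tail s))" for j
        \<comment> \<open>The masses of the cells telescope.\<close>
        have tel: "(\<Sum>j\<le>R. w j) = (1 + T / q * (pa.tail s - pa.tail (t R))) * exp (- (T / q * pa.tail s))"
        proof (induction R)
          case (Suc R)
          then show ?case by (simp add: w_def algebra_simps)
        qed (simp add: w_def t(1))
        have "(\<Sum>\<kappa>\<in>K. measure (completion W) (?A' \<kappa>)) = (\<Sum>\<kappa>\<in>K. \<Prod>i<q. w (\<kappa> i))"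
          using A'_sets by (simp add: pa.prob_atom_config[OF T q(1) s_pos t(1,2)] w_def)
        \<comment> \<open>Summing a product of letter weights over all words factors into the q-th
          power of the sum over letters.\<close>
        also have "\<dots> = (\<Prod>i<q. \<Sum>j\<le>R. w j)"
          unfolding K_def by (rule prod_sum_PiE[symmetric]) auto
        also have "\<dots> = exp (- \<Lambda>) * (1 + (\<Lambda> - T * pa.tail (t R)) / real q) ^ q"
          unfolding tel using q(1)
          by (simp add: power_mult_distrib exp_of_nat_mult[symmetric] \<Lambda>_def right_diff_distrib diff_divide_distrib mult.commute)
        finally show ?thesis using M0[OF R] by simp
      qed
      show "\<forall>\<^sub>F d in sequentially. 1 - e \<le> measure (Q d) (space (Q d) - (B1 d \<union> B2 d))"
      proof -
        let ?ps = "\<lambda>d. real (n d) * measure (P d) {\<omega> \<in> space (P d). s \<le> ?R d \<omega>}"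
        let ?cp = "\<lambda>d. \<P>(\<omega> in Q d. \<bar>inner (sgn (\<xi> d 0 \<omega>)) (sgn (\<xi> d 1 \<omega>))\<bar> > \<epsilon> \<bar>
           (norm (\<xi> d 0 \<omega>))\<^sup>2 \<ge> s * a (n d) \<and> (norm (\<xi> d 1 \<omega>))\<^sup>2 \<ge> s * a (n d))"
        \<comment> \<open>The level s / 2 lies strictly below s and so bounds the non-strict event
          in terms of a tail.\<close>
        have ev1: "\<forall>\<^sub>F d in sequentially. ?ps d < pa.tail (s / 2) + 1"
          using s_pos by (intro pa.eventually_scaled_prob_less[OF P R_meas a1]) auto
        \<comment> \<open>Here s and \<epsilon> are already fixed, so condition (b) applies to a
          bounded number of pairs on average.\<close>
        have "(\<lambda>d. T\<^sup>2 * (pa.tail (s / 2) + 1)\<^sup>2 * ?cp d) \<longlonglongrightarrow> T\<^sup>2 * (pa.tail (s / 2) + 1)\<^sup>2 * 0"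
          by (intro tendsto_mult tendsto_const b s_pos \<epsilon>)
        then have ev2: "\<forall>\<^sub>F d in sequentially. T\<^sup>2 * (pa.tail (s / 2) + 1)\<^sup>2 * ?cp d < e / 2"
          by (rule order_tendstoD(2)) (use e in simp)
        show ?thesis
          using sm1 sm2 ev1 ev2
        proof eventually_elim
          case (elim d)
          interpret sw: scaled_walk "Q d" "\<xi> d" "P d" "X d" "n d" "a (n d)" by (rule wk)
          have T0: "0 \<le> T" using T by simp
          have ap: "0 < a (n d)" using a_pos n_pos by blast
          have "sw.prob (B1 d) \<le> 4 * T / \<eta>\<^sup>2 * (real (n d) / a (n d) * (\<integral>\<omega>. (norm (sw.small s (X d \<omega>)))\<^sup>2 \<partial>P d))"
            unfolding B1_def N_def
          proof (rule sw.prob_small_walk[OF s_pos \<eta> T0])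
            have "T * (real (n d) / sqrt (a (n d)) * norm (\<integral>\<omega>. sw.small s (X d \<omega>) \<partial>P d)) \<le> T * \<theta>2"
              using elim(2) T by (intro mult_left_mono) (auto simp: sw.small_def)
            also have "T * \<theta>2 = \<eta> / 2" using T by (simp add: \<theta>2_def)
            finally show "T * (real (n d) / sqrt (a (n d)) * norm (\<integral>\<omega>. sw.small s (X d \<omega>) \<partial>P d)) \<le> \<eta> / 2" .
          qed
          also have "(\<integral>\<omega>. (norm (sw.small s (X d \<omega>)))\<^sup>2 \<partial>P d) =
              (\<integral>\<omega>. (norm (X d \<omega>))\<^sup>2 * indicator {v. (norm v)\<^sup>2 \<le> s * a (n d)} (X d \<omega>) \<partial>P d)"
            by (intro Bochner_Integration.integral_cong refl) (auto simp: sw.small_def indicator_def)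
          also have "4 * T / \<eta>\<^sup>2 * (real (n d) / a (n d) *
              (\<integral>\<omega>. (norm (X d \<omega>))\<^sup>2 * indicator {v. (norm v)\<^sup>2 \<le> s * a (n d)} (X d \<omega>) \<partial>P d)) \<le> 4 * T / \<eta>\<^sup>2 * \<theta>1"
            using elim(1) T by (intro mult_left_mono) auto
          also have "\<dots> = e / 4" using T \<eta> by (simp add: \<theta>1_def)
          finally have 1: "sw.prob (B1 d) \<le> e / 4" .
          have "sw.prob (B2 d) \<le> T\<^sup>2 * (?ps d)\<^sup>2 * ?cp d"
            unfolding B2_def N_def by (rule sw.prob_aligned[OF T0])
          also have "\<dots> \<le> T\<^sup>2 * (pa.tail (s / 2) + 1)\<^sup>2 * ?cp d"
            using elim(3) by (intro mult_right_mono mult_left_mono power_mono) (auto simp: cond_prob_def)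
          finally have 2: "sw.prob (B2 d) \<le> e / 2" using elim(4) by simp
          have "sw.prob (B1 d \<union> B2 d) \<le> sw.prob (B1 d) + sw.prob (B2 d)"
            by (rule measure_Un_le[OF B12])
          then show ?case using 1 2 e sw.prob_compl[of "B1 d \<union> B2 d"] B12 by simp
        qed
      qed
      show "1 - e \<le> measure (completion W) (pa.small_jumps T s \<eta> - Z)"
      proof -
        have "ennreal (1 - pa.W.prob (pa.small_jumps T s \<eta>)) \<le> ennreal (T / \<eta>\<^sup>2) * (\<integral>\<^sup>+z\<in>{0<..ennreal s}. z \<partial>\<nu>)"
          using T \<eta> by (intro pa.prob_small_jumps) auto
        also have "\<dots> \<le> ennreal (T / \<eta>\<^sup>2) * ennreal \<theta>3" using sm3 by (intro mult_left_mono) auto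
        also have "\<dots> = ennreal e" using T \<eta> e by (simp add: ennreal_mult[symmetric] \<theta>3_def)
        finally have "1 - pa.W.prob (pa.small_jumps T s \<eta>) \<le> e" using e by simp
        moreover have "measure W (pa.small_jumps T s \<eta> - Z) = measure W (pa.small_jumps T s \<eta>)"
          using S_sets Z(1) by (simp add: measure_Diff_null_set)
        moreover have "pa.small_jumps T s \<eta> - Z \<in> sets W"
          using S_sets null_setsD2[OF Z(1)] by (rule sets.Diff)
        ultimately show ?thesis by simp
      qed
    qed
  qed
qed

end
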